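(* Let $p>1$. There exists an open neighborhood $\mathcal U$ of $B_p^{\mathbb R}(\mathbb R)$ in $B_p(\mathbb R)$ such that the map $\Lambda:\mathcal U\to\mathcal L_p(\mathbb U)$, $\Lambda(u)(x,y)=\dfrac{(\alpha_y*e^u)(x)}{(\beta_y*e^u)(x)}$, is holomorphic and $\Lambda(\mathcal U)\subset\mathcal M_p(\mathbb U)\cap M_0(\mathbb U)$.
   Context: $\mathbb U=\{(x,y):y>0\}$. $B_p(\mathbb R)$ is the complex Banach space (modulo constants) of measurable $u:\mathbb R\to\mathbb C$ with $\|u\|_{B_p}^p=\int\!\int\frac{|u(t)-u(s)|^p}{|t-s|^2}dsdt<\infty$; $B_p^{\mathbb R}(\mathbb R)$ is its real subspace of real-valued functions. With $\phi(x)=\pi^{-1/2}e^{-x^2}$, set $\alpha=-\tfrac14\phi''+\tfrac{3i}{4}\phi'$, $\beta=\phi+\tfrac14\phi''+\tfrac i4\phi'$, and $\varphi_y(x)=y^{-1}\varphi(x/y)$ for $y>0$. (Thus $\Lambda(u)$ is the complex dilatation $\partial_{\bar z}F/\partial_zF$ of $F=\gamma*\phi_y+i\gamma*\phi'_y$, $\gamma(x)=\int_0^xe^u$.) $\mathcal L_p(\mathbb U)$ is the Banach space of $\mu\in L^\infty(\mathbb U)$ with norm $\|\mu\|_\infty+(\iint_{\mathbb U}|\mu|^py^{-2}dxdy)^{1/p}<\infty$; $\mathcal M_p(\mathbb U)$ is its intersection with the open unit ball $M(\mathbb U)$ of $L^\infty(\mathbb U)$; $M_0(\mathbb U)$ is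 the set of $\mu\in M(\mathbb U)$ with $\lim_{t\to0}\operatorname{ess\,sup}_{0<y<t}|\mu(x,y)|=0$. Holomorphic means Fréchet complex-differentiable. *)

theory Defs
  imports "HOL-Analysis.Analysis" "HOL-Probability.Essential_Supremum"
begin

section \<open>The space B_p(R) (seminormed; modulo constants and a.e. equality)\<close>

definition Bp_energy :: "real \<Rightarrow> (real \<Rightarrow> complex) \<Rightarrow> ennreal" where
  "Bp_energy p u = (\<integral>\<^sup>+ ts. ennreal (cmod (u (fst ts) - u (snd ts)) powr p / (fst ts - snd ts)\<^sup>2) \<partial>(lborel :: (real \<times> real) measure))"

definition Bp_space :: "real \<Rightarrow> (real \<Rightarrow> complex) set" where
  "Bp_space p = {u. u \<in> borel_measurable lborel \<and> Bp_energy p u < \<infinity>}"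

definition Bp_norm :: "real \<Rightarrow> (real \<Rightarrow> complex) \<Rightarrow> real" where
  "Bp_norm p u = enn2real (Bp_energy p u) powr (1 / p)"

definition BpR_space :: "real \<Rightarrow> (real \<Rightarrow> complex) set" where
  "BpR_space p = {u \<in> Bp_space p. \<forall>t. u t \<in> \<real>}"

text \<open>Open subsets of B_p w.r.t. the B_p (semi)norm; since the seminorm vanishes exactly
  on constants (and a.e.-null functions), this is the topology of the quotient space.\<close>
definition Bp_open :: "real \<Rightarrow> (real \<Rightarrow> complex) set \<Rightarrow> bool" where
  "Bp_open p U \<longleftrightarrow> U \<subseteq> Bp_space p \<and>
     (\<forall>u\<in>U. \<exists>e>0. \<forall>v\<in>Bp_space p. Bp_norm p (\<lambda>t. v t - u t) < e \<longrightarrow> v \<in> U)"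

definition UHP :: "(real \<times> real) set" where
  "UHP = {z. snd z > 0}"

definition UHP_measure :: "(real \<times> real) measure" where
  "UHP_measure = restrict_space lborel UHP"

definition Linf_norm :: "((real \<times> real) \<Rightarrow> complex) \<Rightarrow> ereal" where
  "Linf_norm \<mu> = esssup UHP_measure (\<lambda>z. ereal (cmod (\<mu> z)))"

definition Lp_integral :: "real \<Rightarrow> ((real \<times> real) \<Rightarrow> complex) \<Rightarrow> ennreal" where
  "Lp_integral p \<mu> = (\<integral>\<^sup>+ z. ennreal (cmod (\<mu> z) powr p / (snd z)\<^sup>2) \<partial>UHP_measure)"

definition Lp_space :: "real \<Rightarrow> ((real \<times> real) \<Rightarrow> complex) set" where
  "Lp_space p = {\<mu>. \<mu> \<in> borel_measurable UHP_measure \<and> Linf_norm \<mu> < \<infinity> \<and> Lp_integral p \<mu> < \<infinity>}"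

definition Lp_norm :: "real \<Rightarrow> ((real \<times> real) \<Rightarrow> complex) \<Rightarrow> real" where
  "Lp_norm p \<mu> = real_of_ereal (Linf_norm \<mu>) + enn2real (Lp_integral p \<mu>) powr (1 / p)"

definition M_ball :: "((real \<times> real) \<Rightarrow> complex) set" where
  "M_ball = {\<mu>. \<mu> \<in> borel_measurable UHP_measure \<and> Linf_norm \<mu> < 1}"

definition Mp_space :: "real \<Rightarrow> ((real \<times> real) \<Rightarrow> complex) set" where
  "Mp_space p = Lp_space p \<inter> M_ball"

definition M0_space :: "((real \<times> real) \<Rightarrow> complex) set" where
  "M0_space = {\<mu> \<in> M_ball.
     ((\<lambda>t. esssup (restrict_space lborel {z. 0 < snd z \<and> snd z < t}) (\<lambda>z. ereal (cmod (\<mu> z))))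
        \<longlongrightarrow> 0) (at_right 0)}"

definition Bp_Lp_holomorphic ::
  "real \<Rightarrow> (real \<Rightarrow> complex) set \<Rightarrow> ((real \<Rightarrow> complex) \<Rightarrow> ((real \<times> real) \<Rightarrow> complex)) \<Rightarrow> bool" where
  "Bp_Lp_holomorphic p U F \<longleftrightarrow>
     (\<forall>u\<in>U. F u \<in> Lp_space p \<and>
       (\<exists>L. (\<forall>h\<in>Bp_space p. L h \<in> Lp_space p)
          \<and> (\<forall>h\<in>Bp_space p. \<forall>k\<in>Bp_space p. \<forall>a b::complex. L (\<lambda>t. a * h t + b * k t) = (\<lambda>z. a * L h z + b * L k z))
          \<and> (\<exists>C. \<forall>h\<in>Bp_space p. Lp_norm p (L h) \<le> C * Bp_norm p h)
          \<and> (\<forall>e>0. \<exists>d>0. \<forall>h\<in>Bp_space p. Bp_norm p h < d \<longrightarrow>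
                Lp_norm p (\<lambda>z. F (\<lambda>t. u t + h t) z - F u z - L h z) \<le> e * Bp_norm p h)))"

definition phi :: "real \<Rightarrow> real" where
  "phi x = exp (- x\<^sup>2) / sqrt pi"

definition alpha :: "real \<Rightarrow> complex" where
  "alpha x = - (1/4) * complex_of_real (deriv (deriv phi) x) + (3 * \<i> / 4) * complex_of_real (deriv phi x)"

definition beta :: "real \<Rightarrow> complex" where
  "beta x = complex_of_real (phi x) + (1/4) * complex_of_real (deriv (deriv phi) x) + (\<i> / 4) * complex_of_real (deriv phi x)"

definition scaled :: "real \<Rightarrow> (real \<Rightarrow> complex) \<Rightarrow> real \<Rightarrow> complex" where
  "scaled y f x = f (x / y) / complex_of_real y"

definition conv :: "(real \<Rightarrow> complex) \<Rightarrow> (real \<Rightarrow> complex) \<Rightarrow> real \<Rightarrow> complex" where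
  "conv f g x = (\<integral> t. f (x - t) * g t \<partial>lborel)"

definition Lambda :: "(real \<Rightarrow> complex) \<Rightarrow> (real \<times> real) \<Rightarrow> complex" where
  "Lambda u z = (let x = fst z; y = snd z in
     if y > 0 then conv (scaled y alpha) (\<lambda>t. exp (u t)) x / conv (scaled y beta) (\<lambda>t. exp (u t)) x
     else 0)"

end

theory Submission
  imports Defs "HOL-Probability.Probability"
begin

text \<open>
  Replacing \<open>u\<close> by \<open>s \<mapsto> u (x - y s)\<close> preserves the \<open>B\<^sub>p\<close>-energy and turns \<open>\<Lambda>(u)(x, y)\<close> into
  \<open>\<Lambda>(u)(0, 1)\<close>, so every estimate only has to be proved at the point \<open>(0, 1)\<close>, uniformly on
  bounded subsets of \<open>B\<^sub>p\<close>. There \<open>\<Lambda>(u) = A / B\<close>, where \<open>A\<close> and \<open>B\<close> are integrals of \<open>exp (u - c)\<close>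
  against bounded kernels times the Gaussian measure, and \<open>c\<close> may be taken to be the Gaussian mean of \<open>u\<close>.
  Since \<open>B\<^sub>p\<close> is a critical space, \<open>exp (k |u - c|)\<close> is Gaussian integrable for every \<open>k\<close> with a bound
  depending only on \<open>k\<close> and the energy. As the kernel of \<open>A\<close> has integral zero, Hoelder's inequality
  bounds \<open>A\<close>, the derivative of \<open>A / B\<close> and its Taylor remainder by the Gaussian \<open>L\<^sup>p\<close>-oscillation of
  \<open>u\<close> or of the increment \<open>h\<close> near \<open>(x, y)\<close>. That oscillation is dominated by the energy pointwise,
  its \<open>p\<close>-th power integrated against \<open>dx dy / y\<^sup>2\<close> is dominated by the energy as well, and it tends
  to zero uniformly as \<open>y\<close> tends to zero. For real \<open>u\<close>, \<open>|B|\<^sup>2 - |A|\<^sup>2\<close> is twice a variance, hence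
  bounded below; the neighbourhood consists of all \<open>u\<close> for which \<open>|B|\<close> and \<open>1 - |A / B|\<close> are bounded
  away from zero uniformly in \<open>(x, y)\<close>.
\<close>

section \<open>Convexity inequalities\<close>

text \<open>A function in B_p need not be bounded, so the size of exp u is the obstacle. Averages of
  u over dyadic intervals shrinking to a point have p-summable increments, so after N steps they
  drift by at most e N plus a constant, with e as small as desired; the scale (1/2)^N of the N-th
  interval beats exp (k e N) once k e < ln 2. Hence every exponential moment is finite, without any
  smallness of u. Why the standard Gaussian: phi has variance 1/2, and phi divided by the standard
  density is a multiple of exp (-x^2/2), which absorbs the quadratic polynomials in alpha and beta.
  The kernels left over are bounded, and besides the zero mean of the first the estimates use only
  that bound; the lower bound for real u uses their exact form. Differentiability requires a
  remainder of order o(norm h) in the sup part and in the integral part of the target norm at once.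
  The pointwise remainder is therefore bounded by r times the oscillation of h near (x, y): r is the
  global size of h and supplies the smallness, while the local factor stays bounded and p-integrable
  over the half plane.\<close>

lemma powr_tangent:
  fixes x c p :: real
  assumes "1 < p" "0 \<le> x" "0 \<le> c"
  shows "c powr p + p * c powr (p - 1) * (x - c) \<le> x powr p"
proof -
  define q where "q = p / (p - 1)"
  have q: "q > 1" "1/p + 1/q = 1" using assms unfolding q_def by (auto simp: field_simps)
  \<comment> \<open>The supporting line of r^p at c is Young's inequality for x and c^(p-1), because
    (c^(p-1))^q = c^p.\<close>
  have "x * c powr (p - 1) \<le> x powr p / p + (c powr (p - 1)) powr q / q"
    using assms q by (intro Youngs_inequality) auto
  also have "(c powr (p - 1)) powr q = c powr p"
    using assms by (simp add: powr_powr q_def)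
  finally have *: "p * (x * c powr (p - 1)) \<le> x powr p + p * (c powr p / q)"
    using assms by (simp add: field_simps)
  have "p / q = p - 1" using assms by (simp add: q_def field_simps)
  hence "p * (c powr p / q) = (p - 1) * c powr p" by (metis times_divide_eq_left times_divide_eq_right)
  moreover have "c powr (p - 1) * c = c powr p"
    using assms by (metis (no_types, opaque_lifting) add.commute diff_add_cancel mult.commute powr_mult_base)
  ultimately show ?thesis using * by (simp add: algebra_simps)
qed

text \<open>Monotonicity replaces the norm of the mean by the mean m of the norm, and the supporting
  line at m is then integrated. With the right side in \<open>ennreal\<close>, integrability of
  \<open>f (norm X)\<close> is a case distinction instead of an assumption.\<close>

lemma (in prob_space) jensen_nn_integral:
  fixes X :: "'a \<Rightarrow> 'b::{banach,second_countable_topology}" and f :: "real \<Rightarrow> real"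
  assumes X: "integrable M X" and f[measurable]: "f \<in> borel_measurable borel"
    and nonneg: "\<And>r. 0 \<le> f r" and mono: "\<And>r s. 0 \<le> r \<Longrightarrow> r \<le> s \<Longrightarrow> f r \<le> f s"
    and tangent: "\<And>m. 0 \<le> m \<Longrightarrow> \<exists>d. \<forall>r\<ge>0. f m + d * (r - m) \<le> f r"
  shows "ennreal (f (norm (\<integral>x. X x \<partial>M))) \<le> (\<integral>\<^sup>+x. ennreal (f (norm (X x))) \<partial>M)"
proof (cases "(\<integral>\<^sup>+x. ennreal (f (norm (X x))) \<partial>M) < \<infinity>")
  case True
  have [measurable]: "X \<in> borel_measurable M" using X by auto
  have int: "integrable M (\<lambda>x. f (norm (X x)))"
    using True by (intro integrableI_bounded) (auto simp: nonneg)
  define m where "m = (\<integral>x. norm (X x) \<partial>M)"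
  have m: "0 \<le> m" unfolding m_def by simp
  have iX: "integrable M (\<lambda>x. norm (X x))" using X by simp
  obtain d where d: "\<And>r. r \<ge> 0 \<Longrightarrow> f m + d * (r - m) \<le> f r" using tangent[OF m] by blast
  have "f (norm (\<integral>x. X x \<partial>M)) \<le> f m"
    unfolding m_def by (intro mono integral_norm_bound) auto
  also have "f m = (\<integral>x. f m + d * (norm (X x) - m) \<partial>M)"
    using iX by (simp add: m_def[symmetric] prob_space)
  also have "\<dots> \<le> (\<integral>x. f (norm (X x)) \<partial>M)"
    using iX by (intro integral_mono int) (auto intro!: d)
  finally show ?thesis
    using int by (subst nn_integral_eq_integral) (auto simp: nonneg intro: ennreal_leI)
qed (simp add: less_top[symmetric] top_unique)

lemma (in prob_space) jensen_powr:
  fixes X :: "'a \<Rightarrow> complex"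
  assumes "1 < p" "integrable M X"
  shows "ennreal (cmod (\<integral>x. X x \<partial>M) powr p) \<le> (\<integral>\<^sup>+x. ennreal (cmod (X x) powr p) \<partial>M)"
  using assms
  by (intro jensen_nn_integral[where f="\<lambda>r. r powr p"])
     (auto intro!: powr_mono2 exI powr_tangent)

lemma (in prob_space) jensen_exp:
  fixes X :: "'a \<Rightarrow> complex"
  assumes "0 \<le> k" "integrable M X"
  shows "ennreal (exp (k * cmod (\<integral>x. X x \<partial>M))) \<le> (\<integral>\<^sup>+x. ennreal (exp (k * cmod (X x))) \<partial>M)"
proof (rule jensen_nn_integral[where f="\<lambda>r. exp (k * r)"])
  fix m :: real
  have "exp (k * m) + k * exp (k * m) * (r - m) \<le> exp (k * r)" for r
  proof -
    have "exp (k * m) * (1 + k * (r - m)) \<le> exp (k * m) * exp (k * (r - m))"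
      by (intro mult_left_mono exp_ge_add_one_self) auto
    also have "\<dots> = exp (k * r)" by (simp add: exp_add[symmetric] algebra_simps)
    finally show ?thesis by (simp add: algebra_simps)
  qed
  thus "\<exists>d. \<forall>r\<ge>0. exp (k * m) + d * (r - m) \<le> exp (k * r)" by blast
qed (use assms in \<open>auto intro: mult_left_mono\<close>)

text \<open>Upper bounds A and B stand in for the two integrals, so that uniform constants can be
  inserted directly. A may be 0 because an oscillation may vanish.\<close>

lemma nn_integral_Hoelder:
  fixes f g :: "'a \<Rightarrow> real"
  assumes p: "1 < p" and q: "q = p / (p - 1)"
    and [measurable]: "f \<in> borel_measurable M" "g \<in> borel_measurable M"
    and f: "\<And>x. 0 \<le> f x" and g: "\<And>x. 0 \<le> g x"
    and A: "(\<integral>\<^sup>+x. ennreal (f x powr p) \<partial>M) \<le> ennreal A" "0 \<le> A"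
    and B: "(\<integral>\<^sup>+x. ennreal (g x powr q) \<partial>M) \<le> ennreal B" "0 < B"
  shows "(\<integral>\<^sup>+x. ennreal (f x * g x) \<partial>M) \<le> ennreal (A powr (1/p) * B powr (1/q))"
proof (cases "A = 0")
  case True
  hence "(\<integral>\<^sup>+x. ennreal (f x powr p) \<partial>M) = 0" using A by simp
  hence "AE x in M. f x = 0" by (subst (asm) nn_integral_0_iff_AE) auto
  hence "(\<integral>\<^sup>+x. ennreal (f x * g x) \<partial>M) = (\<integral>\<^sup>+x. 0 \<partial>M)"
    by (intro nn_integral_cong_AE) auto
  thus ?thesis by simp
next
  case False
  hence A0: "A > 0" using A by simp
  have q1: "q > 1" "1/p + 1/q = 1" using p unfolding q by (auto simp: field_simps)
  define a where "a = A powr (1/p)"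
  define b where "b = B powr (1/q)"
  have ab: "a > 0" "b > 0" "a powr p = A" "b powr q = B"
    using A0 B p q1 by (auto simp: a_def b_def powr_powr)
  have pt: "f x * g x \<le> a * b * (f x powr p / (p * A) + g x powr q / (q * B))" for x
  proof -
    have "f x / a * (g x / b) \<le> (f x / a) powr p / p + (g x / b) powr q / q"
      using p q1 ab f g by (intro Youngs_inequality) auto
    also have "\<dots> = f x powr p / (p * A) + g x powr q / (q * B)"
      using ab f g by (simp add: powr_divide mult.commute)
    finally show ?thesis using ab by (simp add: field_simps)
  qed
  have "(\<integral>\<^sup>+x. ennreal (f x * g x) \<partial>M)
     \<le> (\<integral>\<^sup>+x. ennreal (a * b / (p * A)) * ennreal (f x powr p) + ennreal (a * b / (q * B)) * ennreal (g x powr q) \<partial>M)"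
  proof (intro nn_integral_mono)
    fix x
    have "ennreal (f x * g x) \<le> ennreal (a * b / (p * A) * f x powr p + a * b / (q * B) * g x powr q)"
      using pt[of x] by (intro ennreal_leI) (simp add: algebra_simps)
    also have "\<dots> = ennreal (a * b / (p * A)) * ennreal (f x powr p) + ennreal (a * b / (q * B)) * ennreal (g x powr q)"
      using ab A0 B p q1 by (simp add: ennreal_plus ennreal_mult del: times_divide_eq_left)
    finally show "ennreal (f x * g x) \<le> ennreal (a * b / (p * A)) * ennreal (f x powr p) + ennreal (a * b / (q * B)) * ennreal (g x powr q)" .
  qed
  also have "\<dots> = ennreal (a * b / (p * A)) * (\<integral>\<^sup>+x. ennreal (f x powr p) \<partial>M) + ennreal (a * b / (q * B)) * (\<integral>\<^sup>+x. ennreal (g x powr q) \<partial>M)"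
    by (simp add: nn_integral_add nn_integral_cmult)
  also have "\<dots> \<le> ennreal (a * b / (p * A)) * ennreal A + ennreal (a * b / (q * B)) * ennreal B"
    using A B by (intro add_mono mult_left_mono) auto
  also have "\<dots> = ennreal (a * b / (p * A) * A + a * b / (q * B) * B)"
    using ab A0 B p q1 by (simp add: ennreal_mult[symmetric])
  also have "a * b / (p * A) * A + a * b / (q * B) * B = a * b * (1/p + 1/q)"
    using A0 B p q1 by (simp add: field_simps)
  finally show ?thesis using q1 by (simp add: a_def b_def)
qed

section \<open>Energy and Gaussian oscillation\<close>

lemma Bp_energy_iterated:
  assumes [measurable]: "u \<in> borel_measurable borel"
  shows "Bp_energy p u = (\<integral>\<^sup>+s. \<integral>\<^sup>+t. ennreal (cmod (u s - u t) powr p / (s - t)\<^sup>2) \<partial>lborel \<partial>lborel)"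
  unfolding Bp_energy_def
  by (subst lborel_prod[symmetric], subst lborel.nn_integral_fst[symmetric]) auto

lemma nn_integral_affine2:
  fixes F :: "real \<Rightarrow> real \<Rightarrow> ennreal"
  assumes [measurable]: "case_prod F \<in> borel_measurable (borel \<Otimes>\<^sub>M borel)" and y: "y \<noteq> 0"
  shows "(\<integral>\<^sup>+s. \<integral>\<^sup>+t. F s t \<partial>lborel \<partial>lborel)
    = (\<integral>\<^sup>+s. \<integral>\<^sup>+t. ennreal (y\<^sup>2) * F (x + y * s) (x + y * t) \<partial>lborel \<partial>lborel)"
proof -
  have y2: "ennreal (y\<^sup>2) = ennreal \<bar>y\<bar> * ennreal \<bar>y\<bar>"
    by (simp add: ennreal_mult[symmetric] power2_eq_square abs_mult_self_eq)
  have "(\<integral>\<^sup>+s. \<integral>\<^sup>+t. F s t \<partial>lborel \<partial>lborel) = ennreal \<bar>y\<bar> * (\<integral>\<^sup>+s. \<integral>\<^sup>+t. F (x + y * s) t \<partial>lborel \<partial>lborel)"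
    by (rule nn_integral_real_affine[OF _ y]) measurable
  also have "\<dots> = ennreal \<bar>y\<bar> * (\<integral>\<^sup>+s. ennreal \<bar>y\<bar> * (\<integral>\<^sup>+t. F (x + y * s) (x + y * t) \<partial>lborel) \<partial>lborel)"
    by (subst nn_integral_real_affine[OF _ y, where t=x]) auto
  also have "\<dots> = (\<integral>\<^sup>+s. \<integral>\<^sup>+t. ennreal (y\<^sup>2) * F (x + y * s) (x + y * t) \<partial>lborel \<partial>lborel)"
    by (simp add: nn_integral_cmult y2 mult.assoc)
  finally show ?thesis .
qed

text \<open>The Jacobian y^2 of the double substitution cancels the factor which (s - t)^2 acquires,
  whatever p is. Negative y is allowed, as the profiles met later have the form
  \<open>u (x - y * s)\<close>.\<close>

lemma Bp_energy_affine:
  assumes [measurable]: "u \<in> borel_measurable borel" and y: "y \<noteq> 0"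
  shows "Bp_energy p (\<lambda>s. u (x + y * s)) = Bp_energy p u"
proof -
  define F where "F s t = ennreal (cmod (u s - u t) powr p / (s - t)\<^sup>2)" for s t
  have [measurable]: "case_prod F \<in> borel_measurable (borel \<Otimes>\<^sub>M borel)"
    unfolding F_def by measurable
  have y2: "ennreal (y\<^sup>2) * F (x + y * s) (x + y * t) =
     ennreal (cmod (u (x + y * s) - u (x + y * t)) powr p / (s - t)\<^sup>2)" for s t
  proof -
    have "(x + y * s - (x + y * t))\<^sup>2 = y\<^sup>2 * (s - t)\<^sup>2"
      by (simp add: power_mult_distrib[symmetric] algebra_simps)
    moreover have "y\<^sup>2 * (c / (y\<^sup>2 * d)) = c / d" for c d
      using y by simp
    ultimately show ?thesis
      unfolding F_def by (simp add: ennreal_mult[symmetric] del: times_divide_eq_right)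
  qed
  have "Bp_energy p u = (\<integral>\<^sup>+s. \<integral>\<^sup>+t. F s t \<partial>lborel \<partial>lborel)"
    by (simp add: Bp_energy_iterated F_def)
  also have "\<dots> = Bp_energy p (\<lambda>s. u (x + y * s))"
    by (subst nn_integral_affine2[OF _ y, where x=x]) (auto simp: y2 Bp_energy_iterated)
  finally show ?thesis by simp
qed

abbreviation gauss :: "real measure" where "gauss \<equiv> std_normal_distribution"

lemma prob_space_gauss: "prob_space gauss"
  by (rule prob_space_normal_density) simp

interpretation gauss: prob_space gauss
  by (rule prob_space_gauss)

lemma nn_integral_gauss:
  assumes [measurable]: "f \<in> borel_measurable borel"
  shows "(\<integral>\<^sup>+s. f s \<partial>gauss) = (\<integral>\<^sup>+s. ennreal (std_normal_density s) * f s \<partial>lborel)"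
  by (subst nn_integral_density) auto

lemma std_normal_density_le: "std_normal_density s \<le> exp (- s\<^sup>2 / 2)"
proof -
  have "1 \<le> sqrt (2 * pi)" using pi_ge_two by (intro real_le_rsqrt) auto
  thus ?thesis unfolding std_normal_density_def
    using mult_left_mono[of 1 "sqrt (2*pi)" "exp (-(s\<^sup>2/2))"] by (simp add: divide_simps mult.commute)
qed

definition gauss_osc :: "real \<Rightarrow> (real \<Rightarrow> complex) \<Rightarrow> ennreal" where
  "gauss_osc p u = (\<integral>\<^sup>+s. \<integral>\<^sup>+t. ennreal (cmod (u s - u t) powr p) \<partial>gauss \<partial>gauss)"

text \<open>The weight of the Gaussian oscillation relative to the energy density: exp (-r^2/4) is
  what remains of two Gaussian densities at distance r, and r^2 undoes the denominator of the
  energy.\<close>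

definition bump :: "real \<Rightarrow> real" where
  "bump r = r\<^sup>2 * exp (- r\<^sup>2 / 4)"

lemma bump_nonneg: "0 \<le> bump r" and bump_le: "bump r \<le> 4"
proof -
  show "0 \<le> bump r" by (simp add: bump_def)
  have "r\<^sup>2 / 4 \<le> exp (r\<^sup>2 / 4)" using exp_ge_add_one_self[of "r\<^sup>2/4"] by linarith
  thus "bump r \<le> 4" by (simp add: bump_def exp_minus divide_simps)
qed

lemma bump_measurable[measurable]: "bump \<in> borel_measurable borel"
  unfolding bump_def by measurable

lemma gauss_osc_lborel:
  assumes [measurable]: "u \<in> borel_measurable borel"
  shows "gauss_osc p u = (\<integral>\<^sup>+s. \<integral>\<^sup>+t. ennreal (std_normal_density s * std_normal_density t * cmod (u s - u t) powr p) \<partial>lborel \<partial>lborel)"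
  unfolding gauss_osc_def
  by (simp add: nn_integral_gauss nn_integral_cmult[symmetric] ennreal_mult mult.assoc)

text \<open>Since s^2 + t^2 is at least (s - t)^2 / 2, the product of the two densities is at most a
  function of s - t. The position x then disappears by translation, so the bound is uniform in
  x.\<close>

lemma gauss_osc_scaled_le:
  assumes [measurable]: "u \<in> borel_measurable borel" and y: "y > 0"
  shows "gauss_osc p (\<lambda>s. u (x - y * s)) \<le>
    (\<integral>\<^sup>+s. \<integral>\<^sup>+t. ennreal (cmod (u s - u t) powr p / (s - t)\<^sup>2 * bump ((s - t) / y)) \<partial>lborel \<partial>lborel)"
proof -
  let ?g = std_normal_density
  let ?F = "\<lambda>s t. ennreal (cmod (u s - u t) powr p / (s - t)\<^sup>2 * bump ((s - t) / y))"
  have "gauss_osc p (\<lambda>s. u (x - y * s)) =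
    (\<integral>\<^sup>+s. \<integral>\<^sup>+t. ennreal (?g s * ?g t * cmod (u (x - y * s) - u (x - y * t)) powr p) \<partial>lborel \<partial>lborel)"
    by (rule gauss_osc_lborel) measurable
  also have "\<dots> \<le> (\<integral>\<^sup>+s. \<integral>\<^sup>+t. ennreal ((- y)\<^sup>2) * ?F (x + (- y) * s) (x + (- y) * t) \<partial>lborel \<partial>lborel)"
  proof (intro nn_integral_mono)
    fix s t :: real
    define D where "D = cmod (u (x - y * s) - u (x - y * t)) powr p"
    have D: "D \<ge> 0" "s = t \<Longrightarrow> D = 0" by (auto simp: D_def)
    have "?g s * ?g t \<le> exp (- s\<^sup>2 / 2) * exp (- t\<^sup>2 / 2)"
      by (intro mult_mono std_normal_density_le) auto
    also have "\<dots> = exp (- (s\<^sup>2 + t\<^sup>2) / 2)" by (simp add: exp_add[symmetric] field_simps)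
    also have "\<dots> \<le> exp (- (s - t)\<^sup>2 / 4)"
    proof -
      have "0 \<le> (s + t)\<^sup>2" by simp
      hence "(s - t)\<^sup>2 \<le> 2 * (s\<^sup>2 + t\<^sup>2)" by (simp add: power2_eq_square algebra_simps)
      thus ?thesis by simp
    qed
    finally have le: "?g s * ?g t * D \<le> exp (- (s - t)\<^sup>2 / 4) * D"
      using D by (intro mult_right_mono)
    have e: "(x + (- y) * s - (x + (- y) * t)) = - (y * (s - t))" by (simp add: algebra_simps)
    have "exp (- (s - t)\<^sup>2 / 4) * D = y\<^sup>2 * (D / (y * (s - t))\<^sup>2 * bump (s - t))"
      using y D by (cases "s = t") (auto simp: bump_def power_mult_distrib)
    also have "bump (s - t) = bump (- (y * (s - t)) / y)"
      using y by (simp add: bump_def power2_commute)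
    finally have eq: "exp (- (s - t)\<^sup>2 / 4) * D = (- y)\<^sup>2 * (D / (- (y * (s - t)))\<^sup>2 * bump (- (y * (s - t)) / y))"
      by simp
    have "ennreal ((- y)\<^sup>2) * ?F (x + (- y) * s) (x + (- y) * t)
       = ennreal ((- y)\<^sup>2) * ennreal (D / (- (y * (s - t)))\<^sup>2 * bump (- (y * (s - t)) / y))"
      unfolding e by (simp add: D_def)
    also have "\<dots> = ennreal ((- y)\<^sup>2 * (D / (- (y * (s - t)))\<^sup>2 * bump (- (y * (s - t)) / y)))"
      by (intro ennreal_mult[symmetric]) (auto intro!: mult_nonneg_nonneg bump_nonneg divide_nonneg_nonneg D)
    finally show "ennreal (?g s * ?g t * cmod (u (x - y * s) - u (x - y * t)) powr p) \<le> ennreal ((- y)\<^sup>2) * ?F (x + (- y) * s) (x + (- y) * t)"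
      using le unfolding eq D_def[symmetric] by (simp add: ennreal_leI)
  qed
  also have "\<dots> = (\<integral>\<^sup>+s. \<integral>\<^sup>+t. ?F s t \<partial>lborel \<partial>lborel)"
    using y by (intro nn_integral_affine2[symmetric]) auto
  finally show ?thesis .
qed

lemma gauss_osc_le:
  assumes [measurable]: "u \<in> borel_measurable borel" and y: "y > 0"
  shows "gauss_osc p (\<lambda>s. u (x - y * s)) \<le> 4 * Bp_energy p u"
proof -
  have "gauss_osc p (\<lambda>s. u (x - y * s)) \<le>
    (\<integral>\<^sup>+s. \<integral>\<^sup>+t. ennreal (cmod (u s - u t) powr p / (s - t)\<^sup>2 * bump ((s - t) / y)) \<partial>lborel \<partial>lborel)"
    using y by (intro gauss_osc_scaled_le) auto
  also have "\<dots> \<le> (\<integral>\<^sup>+s. \<integral>\<^sup>+t. ennreal (cmod (u s - u t) powr p / (s - t)\<^sup>2) * 4 \<partial>lborel \<partial>lborel)"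
    using mult_left_mono[OF bump_le]
    by (intro nn_integral_mono) (auto simp: ennreal_mult[symmetric] simp flip: ennreal_numeral
          intro!: ennreal_leI simp del: times_divide_eq_left)
  also have "\<dots> = 4 * Bp_energy p u"
    by (subst mult.commute) (simp add: Bp_energy_iterated nn_integral_multc)
  finally show ?thesis .
qed

text \<open>For two fixed nodes a and a + c, a shift in x removes a, and t = x + y c turns dy / y^2
  into |c| dt / (x - t)^2.\<close>

lemma nn_integral_translation_energy:
  assumes [measurable]: "u \<in> borel_measurable borel" and c: "c \<noteq> 0"
  shows "(\<integral>\<^sup>+y. \<integral>\<^sup>+x. ennreal (cmod (u (x + y * a) - u (x + y * (a + c))) powr p / y\<^sup>2) \<partial>lborel \<partial>lborel)
     = ennreal \<bar>c\<bar> * Bp_energy p u"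
proof -
  have "(\<integral>\<^sup>+x. ennreal (cmod (u (x + y * a) - u (x + y * (a + c))) powr p / y\<^sup>2) \<partial>lborel)
      = (\<integral>\<^sup>+x. ennreal (cmod (u x - u (x + y * c)) powr p / y\<^sup>2) \<partial>lborel)" for y
    using nn_integral_real_affine[of "\<lambda>x. ennreal (cmod (u x - u (x + y * c)) powr p / y\<^sup>2)" 1 "y * a"]
    by (simp add: algebra_simps)
  hence "(\<integral>\<^sup>+y. \<integral>\<^sup>+x. ennreal (cmod (u (x + y * a) - u (x + y * (a + c))) powr p / y\<^sup>2) \<partial>lborel \<partial>lborel)
    = (\<integral>\<^sup>+y. \<integral>\<^sup>+x. ennreal (cmod (u x - u (x + y * c)) powr p / y\<^sup>2) \<partial>lborel \<partial>lborel)"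
    by simp
  also have "\<dots> = (\<integral>\<^sup>+x. \<integral>\<^sup>+y. ennreal (cmod (u x - u (x + y * c)) powr p / y\<^sup>2) \<partial>lborel \<partial>lborel)"
    by (rule lborel_pair.Fubini') measurable
  also have "\<dots> = (\<integral>\<^sup>+x. ennreal \<bar>c\<bar> * (\<integral>\<^sup>+t. ennreal (cmod (u x - u t) powr p / (x - t)\<^sup>2) \<partial>lborel) \<partial>lborel)"
  proof (intro nn_integral_cong)
    fix x
    have "(\<integral>\<^sup>+t. ennreal (cmod (u x - u t) powr p / (x - t)\<^sup>2) \<partial>lborel)
       = ennreal \<bar>c\<bar> * (\<integral>\<^sup>+y. ennreal (cmod (u x - u (x + c * y)) powr p / (x - (x + c * y))\<^sup>2) \<partial>lborel)"
      by (rule nn_integral_real_affine[OF _ c]) measurable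
    hence "ennreal \<bar>c\<bar> * (\<integral>\<^sup>+t. ennreal (cmod (u x - u t) powr p / (x - t)\<^sup>2) \<partial>lborel)
       = (\<integral>\<^sup>+y. ennreal \<bar>c\<bar> * ennreal \<bar>c\<bar> * ennreal (cmod (u x - u (x + c * y)) powr p / (x - (x + c * y))\<^sup>2) \<partial>lborel)"
      by (simp add: nn_integral_cmult mult.assoc)
    also have "\<dots> = (\<integral>\<^sup>+y. ennreal (cmod (u x - u (x + y * c)) powr p / y\<^sup>2) \<partial>lborel)"
    proof (intro nn_integral_cong)
      fix y
      have "\<bar>c\<bar> * \<bar>c\<bar> * (d / (x - (x + c * y))\<^sup>2) = d / y\<^sup>2" for d
        using c by (simp add: power_mult_distrib power2_eq_square)
      thus "ennreal \<bar>c\<bar> * ennreal \<bar>c\<bar> * ennreal (cmod (u x - u (x + c * y)) powr p / (x - (x + c * y))\<^sup>2)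
         = ennreal (cmod (u x - u (x + y * c)) powr p / y\<^sup>2)"
        unfolding mult.commute[of y c] by (simp only: ennreal_mult[symmetric] abs_ge_zero mult_nonneg_nonneg divide_nonneg_nonneg powr_ge_zero zero_le_power2)
    qed
    finally show "(\<integral>\<^sup>+y. ennreal (cmod (u x - u (x + y * c)) powr p / y\<^sup>2) \<partial>lborel) =
      ennreal \<bar>c\<bar> * (\<integral>\<^sup>+t. ennreal (cmod (u x - u t) powr p / (x - t)\<^sup>2) \<partial>lborel)" by simp
  qed
  also have "\<dots> = ennreal \<bar>c\<bar> * Bp_energy p u"
    by (simp add: nn_integral_cmult Bp_energy_iterated)
  finally show ?thesis .
qed

text \<open>Averages the factor |c| of \<open>nn_integral_translation_energy\<close> over Gaussian
  nodes; the first absolute moment is sqrt (2/pi) <= 1.\<close>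

lemma nn_integral_gauss_abs_diff_le:
  "(\<integral>\<^sup>+s. \<integral>\<^sup>+t. ennreal \<bar>s - t\<bar> \<partial>gauss \<partial>gauss) \<le> 2"
proof -
  have i: "integrable lborel (\<lambda>x. std_normal_density x * \<bar>x\<bar>^1)"
    by (rule integrable_std_normal_moment_abs)
  have "(\<integral>\<^sup>+t. ennreal \<bar>t\<bar> \<partial>gauss) = (\<integral>\<^sup>+t. ennreal (std_normal_density t * \<bar>t\<bar>) \<partial>lborel)"
    by (simp add: nn_integral_gauss ennreal_mult)
  also have "\<dots> = ennreal (\<integral>t. std_normal_density t * \<bar>t\<bar> \<partial>lborel)"
    using i by (subst nn_integral_eq_integral) auto
  also have "(\<integral>t. std_normal_density t * \<bar>t\<bar> \<partial>lborel) = sqrt (2/pi)"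
    using integral_std_normal_moment_abs_odd[of 0] by simp
  also have "ennreal (sqrt (2/pi)) \<le> 1"
    using pi_ge_two by (simp add: divide_simps)
  finally have m: "(\<integral>\<^sup>+t. ennreal \<bar>t\<bar> \<partial>gauss) \<le> 1" .
  have "(\<integral>\<^sup>+s. \<integral>\<^sup>+t. ennreal \<bar>s - t\<bar> \<partial>gauss \<partial>gauss) \<le> (\<integral>\<^sup>+s. \<integral>\<^sup>+t. ennreal \<bar>s\<bar> + ennreal \<bar>t\<bar> \<partial>gauss \<partial>gauss)"
    by (intro nn_integral_mono) (auto simp: ennreal_plus[symmetric] simp del: ennreal_plus intro!: ennreal_leI)
  also have "\<dots> = (\<integral>\<^sup>+s. ennreal \<bar>s\<bar> \<partial>gauss) + (\<integral>\<^sup>+t. ennreal \<bar>t\<bar> \<partial>gauss)"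
    by (simp add: nn_integral_add gauss.emeasure_space_1[simplified])
  also have "\<dots> \<le> 1 + 1" using m by (intro add_mono)
  finally show ?thesis by simp
qed

lemma nn_integral_UHP:
  assumes [measurable]: "(\<lambda>z. f (fst z) (snd z)) \<in> borel_measurable (borel \<Otimes>\<^sub>M borel)"
  shows "(\<integral>\<^sup>+z. f (fst z) (snd z) \<partial>UHP_measure) = (\<integral>\<^sup>+x. \<integral>\<^sup>+y. f x y * indicator {0<..} y \<partial>lborel \<partial>lborel)"
proof -
  have [measurable]: "UHP \<in> sets (borel :: (real \<times> real) measure)"
    unfolding UHP_def by (auto intro!: borel_open open_Collect_less continuous_intros)
  have "(\<integral>\<^sup>+z. f (fst z) (snd z) \<partial>UHP_measure) = (\<integral>\<^sup>+z. f (fst z) (snd z) * indicator UHP z \<partial>lborel)"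
    unfolding UHP_measure_def by (subst nn_integral_restrict_space) auto
  also have "\<dots> = (\<integral>\<^sup>+z. f (fst z) (snd z) * indicator {0<..} (snd z) \<partial>lborel)"
    by (intro nn_integral_cong) (auto simp: UHP_def indicator_def)
  also have "\<dots> = (\<integral>\<^sup>+x. \<integral>\<^sup>+y. f x y * indicator {0<..} y \<partial>lborel \<partial>lborel)"
    by (subst lborel_prod[symmetric], subst lborel.nn_integral_fst[symmetric]) auto
  finally show ?thesis .
qed

lemma gauss_osc_measurable[measurable]:
  assumes [measurable]: "u \<in> borel_measurable borel"
  shows "(\<lambda>z. gauss_osc p (\<lambda>s. u (fst z - snd z * s))) \<in> borel_measurable (borel \<Otimes>\<^sub>M borel)"
  unfolding gauss_osc_def by measurable

text \<open>With the Gaussian nodes s, t moved outside and the range of y enlarged to the whole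
  line, each pair contributes |s - t| times the energy, and the mean of |s - t| is at most
  2.\<close>

lemma nn_integral_UHP_gauss_osc:
  assumes [measurable]: "u \<in> borel_measurable borel"
  shows "(\<integral>\<^sup>+z. gauss_osc p (\<lambda>s. u (fst z - snd z * s)) * ennreal (1 / (snd z)\<^sup>2) \<partial>UHP_measure) \<le> 2 * Bp_energy p u"
proof -
  define H where "H x y s t = ennreal (cmod (u (x - y * s) - u (x - y * t)) powr p / y\<^sup>2)" for x y s t
  note swap = pair_sigma_finite.Fubini'[OF pair_sigma_finite.intro]
  note sf = lborel.sigma_finite_measure_axioms gauss.sigma_finite_measure_axioms
  have "(\<integral>\<^sup>+z. gauss_osc p (\<lambda>s. u (fst z - snd z * s)) * ennreal (1 / (snd z)\<^sup>2) \<partial>UHP_measure)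
     = (\<integral>\<^sup>+x. \<integral>\<^sup>+y. gauss_osc p (\<lambda>s. u (x - y * s)) * ennreal (1 / y\<^sup>2) * indicator {0<..} y \<partial>lborel \<partial>lborel)"
    by (rule nn_integral_UHP) measurable
  also have "\<dots> \<le> (\<integral>\<^sup>+x. \<integral>\<^sup>+y. gauss_osc p (\<lambda>s. u (x - y * s)) * ennreal (1 / y\<^sup>2) \<partial>lborel \<partial>lborel)"
    by (intro nn_integral_mono) (auto simp: indicator_def)
  also have "\<dots> = (\<integral>\<^sup>+x. \<integral>\<^sup>+y. \<integral>\<^sup>+s. \<integral>\<^sup>+t. H x y s t \<partial>gauss \<partial>gauss \<partial>lborel \<partial>lborel)"
  proof (intro nn_integral_cong)
    fix x y
    have "gauss_osc p (\<lambda>s. u (x - y * s)) * ennreal (1 / y\<^sup>2)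
      = (\<integral>\<^sup>+s. \<integral>\<^sup>+t. ennreal (cmod (u (x - y * s) - u (x - y * t)) powr p) * ennreal (1 / y\<^sup>2) \<partial>gauss \<partial>gauss)"
      unfolding gauss_osc_def by (simp add: nn_integral_multc)
    thus "gauss_osc p (\<lambda>s. u (x - y * s)) * ennreal (1 / y\<^sup>2) = (\<integral>\<^sup>+s. \<integral>\<^sup>+t. H x y s t \<partial>gauss \<partial>gauss)"
      by (simp add: H_def ennreal_mult[symmetric])
  qed
  \<comment> \<open>Five adjacent transpositions carry the order x, y, s, t to s, t, y, x.\<close>
  also have "\<dots> = (\<integral>\<^sup>+y. \<integral>\<^sup>+x. \<integral>\<^sup>+s. \<integral>\<^sup>+t. H x y s t \<partial>gauss \<partial>gauss \<partial>lborel \<partial>lborel)"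
    unfolding H_def by (rule swap[OF sf(1) sf(1)]) measurable
  also have "\<dots> = (\<integral>\<^sup>+y. \<integral>\<^sup>+s. \<integral>\<^sup>+x. \<integral>\<^sup>+t. H x y s t \<partial>gauss \<partial>lborel \<partial>gauss \<partial>lborel)"
    unfolding H_def by (intro nn_integral_cong swap[OF sf(2) sf(1)]) measurable
  also have "\<dots> = (\<integral>\<^sup>+y. \<integral>\<^sup>+s. \<integral>\<^sup>+t. \<integral>\<^sup>+x. H x y s t \<partial>lborel \<partial>gauss \<partial>gauss \<partial>lborel)"
    unfolding H_def by (intro nn_integral_cong swap[OF sf(2) sf(1)]) measurable
  also have "\<dots> = (\<integral>\<^sup>+s. \<integral>\<^sup>+y. \<integral>\<^sup>+t. \<integral>\<^sup>+x. H x y s t \<partial>lborel \<partial>gauss \<partial>lborel \<partial>gauss)"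
    unfolding H_def by (rule swap[OF sf(2) sf(1)]) measurable
  also have "\<dots> = (\<integral>\<^sup>+s. \<integral>\<^sup>+t. \<integral>\<^sup>+y. \<integral>\<^sup>+x. H x y s t \<partial>lborel \<partial>lborel \<partial>gauss \<partial>gauss)"
    unfolding H_def by (intro nn_integral_cong swap[OF sf(2) sf(1)]) measurable
  also have "\<dots> \<le> (\<integral>\<^sup>+s. \<integral>\<^sup>+t. ennreal \<bar>s - t\<bar> * Bp_energy p u \<partial>gauss \<partial>gauss)"
  proof (intro nn_integral_mono)
    fix s t
    show "(\<integral>\<^sup>+y. \<integral>\<^sup>+x. H x y s t \<partial>lborel \<partial>lborel) \<le> ennreal \<bar>s - t\<bar> * Bp_energy p u"
    proof (cases "s = t")
      case False
      thus ?thesis unfolding H_def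
        using nn_integral_translation_energy[of u "s - t" "- s" p] by simp
    qed (simp add: H_def)
  qed
  also have "\<dots> = (\<integral>\<^sup>+s. \<integral>\<^sup>+t. ennreal \<bar>s - t\<bar> \<partial>gauss \<partial>gauss) * Bp_energy p u"
    by (simp add: nn_integral_multc)
  also have "\<dots> \<le> 2 * Bp_energy p u"
    by (intro mult_right_mono nn_integral_gauss_abs_diff_le) auto
  finally show ?thesis .
qed

section \<open>Exponential integrability\<close>

lemma Bp_space_iff: "u \<in> Bp_space p \<longleftrightarrow> u \<in> borel_measurable borel \<and> Bp_energy p u < \<infinity>"
  by (simp add: Bp_space_def)

text \<open>By Tonelli some s makes the p-th power of |u s - u t| Gaussian integrable in t; on a
  probability space this gives integrability of u s - u t, and u s is a constant.\<close>

lemma integrable_gauss_Bp: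
  assumes p: "1 < p" and u: "u \<in> Bp_space p"
  shows "integrable gauss u"
proof -
  have [measurable]: "u \<in> borel_measurable borel" and E: "Bp_energy p u < \<infinity>"
    using u by (auto simp: Bp_space_iff)
  let ?F = "\<lambda>s. \<integral>\<^sup>+t. ennreal (cmod (u s - u t) powr p) \<partial>gauss"
  \<comment> \<open>\<open>gauss_osc_le\<close> treats profiles \<open>u (x - y * s)\<close> with y
    > 0; reflecting u first and taking x = 0, y = 1 recovers u itself.\<close>
  have "gauss_osc p (\<lambda>s. u (0 - (-1) * s)) \<le> 4 * Bp_energy p (\<lambda>s. u (- s))"
    using gauss_osc_le[of "\<lambda>s. u (- s)" 1 p 0] by simp
  also have "Bp_energy p (\<lambda>s. u (- s)) = Bp_energy p u"
    using Bp_energy_affine[of u "-1" p 0] by simp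
  also have "4 * Bp_energy p u < \<infinity>" using E by (simp add: ennreal_mult_less_top)
  finally have "(\<integral>\<^sup>+s. ?F s \<partial>gauss) \<noteq> \<infinity>" by (simp add: gauss_osc_def)
  hence "AE s in gauss. ?F s \<noteq> \<infinity>"
    by (intro nn_integral_PInf_AE) measurable
  then obtain s where s: "?F s \<noteq> \<infinity>"
    using gauss.AE_contr eventually_ex gauss.ae_filter_bot by blast
  have "integrable gauss (\<lambda>t. u s - u t)"
  proof (rule integrableI_bounded)
    have "x \<le> 1 + x powr p" if "0 \<le> x" for x :: real
      using that p powr_mono[of 1 p x] by (cases "x \<le> 1") (auto intro: add_increasing2)
    hence "(\<integral>\<^sup>+t. ennreal (norm (u s - u t)) \<partial>gauss) \<le> (\<integral>\<^sup>+t. 1 + ennreal (cmod (u s - u t) powr p) \<partial>gauss)"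
      by (intro nn_integral_mono)
         (auto simp flip: ennreal_1 ennreal_plus intro!: ennreal_leI)
    also have "\<dots> = 1 + ?F s"
      by (simp add: nn_integral_add gauss.emeasure_space_1[simplified])
    also have "\<dots> < \<infinity>" using s by (simp add: less_top)
    finally show "(\<integral>\<^sup>+t. ennreal (norm (u s - u t)) \<partial>gauss) < \<infinity>" .
  qed simp
  from Bochner_Integration.integrable_diff[OF gauss.integrable_const[of "u s"] this]
  show ?thesis by simp
qed

lemma prob_space_uniform_Ioc: "a < b \<Longrightarrow> prob_space (uniform_measure lborel {a<..b::real})"
  by (intro prob_space_uniform_measure) auto

lemma nn_integral_uniform_Ioc:
  assumes [measurable]: "f \<in> borel_measurable borel" and ab: "a < (b::real)"
  shows "(\<integral>\<^sup>+x. f x \<partial>uniform_measure lborel {a<..b}) = ennreal (1 / (b - a)) * (\<integral>\<^sup>+x. f x * indicator {a<..b} x \<partial>lborel)"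
proof -
  have "(\<integral>\<^sup>+x. f x \<partial>uniform_measure lborel {a<..b}) = (\<integral>\<^sup>+x. f x * indicator {a<..b} x \<partial>lborel) / ennreal (b - a)"
    using ab by (subst nn_integral_uniform_measure) auto
  also have "\<dots> = ennreal (1 / (b - a)) * (\<integral>\<^sup>+x. f x * indicator {a<..b} x \<partial>lborel)"
    using ab by (simp add: divide_ennreal_def inverse_ennreal mult.commute inverse_eq_divide)
  finally show ?thesis .
qed

text \<open>On a bounded interval the Gaussian density is at least its value at one of the
  endpoints, so Gaussian integrability carries over.\<close>

lemma integrable_uniform_Bp:
  assumes p: "1 < p" and u: "u \<in> Bp_space p" and ab: "a < b"
  shows "integrable (uniform_measure lborel {a<..b}) u"
proof (rule integrableI_bounded)
  have [measurable]: "u \<in> borel_measurable borel" using u by (auto simp: Bp_space_iff)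
  show "u \<in> borel_measurable (uniform_measure lborel {a<..b})" by simp
  define m where "m = Min (std_normal_density ` {a, b})"
  have m: "m > 0" by (simp add: m_def normal_density_pos)
  have le: "m \<le> std_normal_density x" if "x \<in> {a<..b}" for x
  proof -
    have "x\<^sup>2 \<le> a\<^sup>2 \<or> x\<^sup>2 \<le> b\<^sup>2"
      using that by (cases "x \<ge> 0") (auto simp: abs_le_square_iff[symmetric])
    hence "std_normal_density a \<le> std_normal_density x \<or> std_normal_density b \<le> std_normal_density x"
      by (auto simp: std_normal_density_def divide_simps)
    thus ?thesis by (auto simp: m_def min_le_iff_disj)
  qed
  have "(\<integral>\<^sup>+x. ennreal (norm (u x)) * indicator {a<..b} x \<partial>lborel)
     \<le> (\<integral>\<^sup>+x. ennreal (1/m) * (ennreal (std_normal_density x) * ennreal (norm (u x))) \<partial>lborel)"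
  proof (intro nn_integral_mono)
    fix x
    have "cmod (u x) \<le> 1 / m * (std_normal_density x * cmod (u x))" if "x \<in> {a<..b}"
      using mult_right_mono[OF le[OF that] norm_ge_zero[of "u x"]] m by (simp add: divide_simps mult.commute)
    thus "ennreal (norm (u x)) * indicator {a<..b} x \<le> ennreal (1/m) * (ennreal (std_normal_density x) * ennreal (norm (u x)))"
      using m by (auto simp: ennreal_mult[symmetric] indicator_def simp del: greaterThanAtMost_iff intro!: ennreal_leI)
  qed
  also have "\<dots> = ennreal (1/m) * (\<integral>\<^sup>+x. ennreal (norm (u x)) \<partial>gauss)"
    by (simp add: nn_integral_cmult nn_integral_gauss)
  also have "\<dots> < \<infinity>"
    using integrable_gauss_Bp[OF p u] by (auto simp: integrable_iff_bounded ennreal_mult_less_top)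
  finally show "(\<integral>\<^sup>+x. ennreal (norm (u x)) \<partial>uniform_measure lborel {a<..b}) < \<infinity>"
    using ab by (subst nn_integral_uniform_Ioc) (auto simp: ennreal_mult_less_top)
qed

section \<open>Interval means and their dyadic increments\<close>

definition mean :: "real \<Rightarrow> real \<Rightarrow> (real \<Rightarrow> complex) \<Rightarrow> complex" where
  "mean a b u = (\<integral>t. u t \<partial>uniform_measure lborel {a<..b})"

text \<open>An integral against one fixed measure, with the interval inside the integrand, is what
  makes measurability in a moving interval accessible.\<close>

lemma mean_lborel:
  assumes [measurable]: "u \<in> borel_measurable borel" and ab: "a < b"
  shows "mean a b u = (\<integral>t. (if a < t \<and> t \<le> b then u t / (b - a) else 0) \<partial>lborel)"
proof -
  have "mean a b u = (\<integral>t. u t \<partial>density lborel (\<lambda>x. ennreal (indicator {a<..b} x / (b - a))))"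
    unfolding mean_def uniform_measure_def using ab
    by (intro Bochner_Integration.integral_cong arg_cong[where f="density lborel"] ext refl)
       (auto simp: indicator_def divide_ennreal[symmetric])
  also have "\<dots> = (\<integral>t. (indicator {a<..b} t / (b - a)) *\<^sub>R u t \<partial>lborel)"
    using ab by (intro integral_density) auto
  also have "\<dots> = (\<integral>t. (if a < t \<and> t \<le> b then u t / (b - a) else 0) \<partial>lborel)"
    by (intro Bochner_Integration.integral_cong) (auto simp: indicator_def scaleR_conv_of_real)
  finally show ?thesis .
qed

lemma mean_measurable:
  assumes [measurable]: "u \<in> borel_measurable borel" and r: "r > 0"
  shows "(\<lambda>x. mean (x + r) (x + 2 * r) u) \<in> borel_measurable borel"
proof -
  have "(\<lambda>x. \<integral>t. (if x + r < t \<and> t \<le> x + 2 * r then u t / r else 0) \<partial>lborel) \<in> borel_measurable borel"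
    by measurable
  thus ?thesis using r by (simp add: mean_lborel)
qed

definition energy_density :: "real \<Rightarrow> (real \<Rightarrow> complex) \<Rightarrow> real \<Rightarrow> real \<Rightarrow> ennreal" where
  "energy_density p u s t = ennreal (cmod (u s - u t) powr p / (s - t)\<^sup>2)"

lemma energy_density_measurable[measurable]:
  assumes [measurable]: "u \<in> borel_measurable borel" "a \<in> borel_measurable M" "b \<in> borel_measurable M"
  shows "(\<lambda>x. energy_density p u (a x) (b x)) \<in> borel_measurable M"
  unfolding energy_density_def by measurable

text \<open>Jensen's inequality for the uniform measure; then |s - t| <= D inserts the denominator
  (s - t)^2 of the energy at the price D^2.\<close>

lemma mean_dist_point:
  assumes p: "1 < p" and u: "u \<in> Bp_space p" and ab: "a < b"
    and D: "\<And>t. t \<in> {a<..b} \<Longrightarrow> \<bar>s - t\<bar> \<le> D"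
  shows "ennreal (cmod (u s - mean a b u) powr p)
    \<le> ennreal (D\<^sup>2 / (b - a)) * (\<integral>\<^sup>+t. energy_density p u s t * indicator {a<..b} t \<partial>lborel)"
proof -
  have [measurable]: "u \<in> borel_measurable borel" using u by (auto simp: Bp_space_iff)
  interpret I: prob_space "uniform_measure lborel {a<..b}" using ab by (rule prob_space_uniform_Ioc)
  have i: "integrable (uniform_measure lborel {a<..b}) u" using p u ab by (rule integrable_uniform_Bp)
  have "u s - mean a b u = (\<integral>t. u s - u t \<partial>uniform_measure lborel {a<..b})"
    unfolding mean_def using i I.prob_space by simp
  also have "ennreal (cmod \<dots> powr p) \<le> (\<integral>\<^sup>+t. ennreal (cmod (u s - u t) powr p) \<partial>uniform_measure lborel {a<..b})"
    using p i by (intro I.jensen_powr) auto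
  also have "\<dots> = ennreal (1 / (b - a)) * (\<integral>\<^sup>+t. ennreal (cmod (u s - u t) powr p) * indicator {a<..b} t \<partial>lborel)"
    using ab by (intro nn_integral_uniform_Ioc) auto
  also have "\<dots> \<le> ennreal (1 / (b - a)) * (\<integral>\<^sup>+t. ennreal (D\<^sup>2) * (energy_density p u s t * indicator {a<..b} t) \<partial>lborel)"
  proof (intro mult_left_mono nn_integral_mono)
    fix t
    show "ennreal (cmod (u s - u t) powr p) * indicator {a<..b} t \<le> ennreal (D\<^sup>2) * (energy_density p u s t * indicator {a<..b} t)"
    proof (cases "t \<in> {a<..b} \<and> s \<noteq> t")
      case True
      hence "(s - t)\<^sup>2 \<le> D\<^sup>2" using D[of t] by (auto simp: abs_le_square_iff[symmetric])
      hence "cmod (u s - u t) powr p * (s - t)\<^sup>2 \<le> cmod (u s - u t) powr p * D\<^sup>2"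
        by (intro mult_left_mono) auto
      thus ?thesis using True
        by (auto simp: energy_density_def ennreal_mult[symmetric] divide_simps mult.commute intro!: ennreal_leI)
    qed auto
  qed auto
  also have "\<dots> = ennreal (D\<^sup>2 / (b - a)) * (\<integral>\<^sup>+t. energy_density p u s t * indicator {a<..b} t \<partial>lborel)"
    using ab by (subst nn_integral_cmult) (auto simp: mult.assoc[symmetric] ennreal_mult[symmetric])
  finally show ?thesis .
qed

text \<open>Jensen once more in s. The indicators stay on the right so that contributions from
  disjoint intervals can be added without counting energy twice.\<close>

lemma mean_dist_mean:
  assumes p: "1 < p" and u: "u \<in> Bp_space p" and ab: "a < b" and cd: "c < d"
    and D: "\<And>s t. s \<in> {c<..d} \<Longrightarrow> t \<in> {a<..b} \<Longrightarrow> \<bar>s - t\<bar> \<le> D"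
  shows "ennreal (cmod (mean c d u - mean a b u) powr p)
    \<le> ennreal (D\<^sup>2 / ((b - a) * (d - c))) * (\<integral>\<^sup>+s. \<integral>\<^sup>+t. energy_density p u s t * indicator {a<..b} t * indicator {c<..d} s \<partial>lborel \<partial>lborel)"
proof -
  have [measurable]: "u \<in> borel_measurable borel" using u by (auto simp: Bp_space_iff)
  interpret I: prob_space "uniform_measure lborel {c<..d}" using cd by (rule prob_space_uniform_Ioc)
  have i: "integrable (uniform_measure lborel {c<..d}) u" using p u cd by (rule integrable_uniform_Bp)
  have "mean c d u - mean a b u = (\<integral>s. u s - mean a b u \<partial>uniform_measure lborel {c<..d})"
    unfolding mean_def[of c] using i I.prob_space by simp
  also have "ennreal (cmod \<dots> powr p) \<le> (\<integral>\<^sup>+s. ennreal (cmod (u s - mean a b u) powr p) \<partial>uniform_measure lborel {c<..d})"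
    using p i by (intro I.jensen_powr) auto
  also have "\<dots> = ennreal (1 / (d - c)) * (\<integral>\<^sup>+s. ennreal (cmod (u s - mean a b u) powr p) * indicator {c<..d} s \<partial>lborel)"
    using cd by (intro nn_integral_uniform_Ioc) auto
  also have "\<dots> \<le> ennreal (1 / (d - c)) * (\<integral>\<^sup>+s. ennreal (D\<^sup>2 / (b - a)) * (\<integral>\<^sup>+t. energy_density p u s t * indicator {a<..b} t * indicator {c<..d} s \<partial>lborel) \<partial>lborel)"
  proof (intro mult_left_mono nn_integral_mono)
    fix s
    show "ennreal (cmod (u s - mean a b u) powr p) * indicator {c<..d} s \<le>
      ennreal (D\<^sup>2 / (b - a)) * (\<integral>\<^sup>+t. energy_density p u s t * indicator {a<..b} t * indicator {c<..d} s \<partial>lborel)"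
      using mean_dist_point[OF p u ab D, of s] by (cases "s \<in> {c<..d}") auto
  qed auto
  also have "\<dots> = ennreal (D\<^sup>2 / ((b - a) * (d - c))) * (\<integral>\<^sup>+s. \<integral>\<^sup>+t. energy_density p u s t * indicator {a<..b} t * indicator {c<..d} s \<partial>lborel \<partial>lborel)"
  proof (subst nn_integral_cmult)
    have "ennreal (1 / (d - c)) * (ennreal (D\<^sup>2 / (b - a)) * X) = ennreal (D\<^sup>2 / ((b - a) * (d - c))) * X" for X
      using ab cd by (simp add: mult.assoc[symmetric] ennreal_mult[symmetric]) (simp only: mult.commute[of "d - c"])
    thus "ennreal (1 / (d - c)) * (ennreal (D\<^sup>2 / (b - a)) * (\<integral>\<^sup>+s. \<integral>\<^sup>+t. energy_density p u s t * indicator {a<..b} t * indicator {c<..d} s \<partial>lborel \<partial>lborel))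
      = ennreal (D\<^sup>2 / ((b - a) * (d - c))) * (\<integral>\<^sup>+s. \<integral>\<^sup>+t. energy_density p u s t * indicator {a<..b} t * indicator {c<..d} s \<partial>lborel \<partial>lborel)" .
  qed measurable
  finally show ?thesis .
qed

text \<open>Exchanges a first power for a p-th power at an additive cost e that may be taken as
  small as desired; both the dyadic drift and the growth of unit-scale means are tamed by
  it.\<close>

lemma le_eps_powr:
  assumes "1 < p" "0 < e" "0 \<le> (x::real)"
  shows "x \<le> e + e powr (1 - p) * x powr p"
proof (cases "x \<le> e")
  case False
  hence x: "0 < x" using assms by simp
  have "x powr (1 - p) \<le> e powr (1 - p)"
    using assms False by (intro powr_mono2') auto
  hence "x powr (1 - p) * x powr p \<le> e powr (1 - p) * x powr p"
    by (intro mult_right_mono) auto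
  also have "x powr (1 - p) * x powr p = x" using x by (simp flip: powr_add)
  finally show ?thesis using assms by simp
qed (use assms in \<open>auto intro: add_increasing2\<close>)

text \<open>
  The intervals over which the means are taken are disjoint for different \<open>n\<close>, so the increments
  \<open>dyadic_mean n - dyadic_mean (n + 1)\<close> are controlled by disjoint parts of the energy.
\<close>

definition dyadic_mean :: "nat \<Rightarrow> (real \<Rightarrow> complex) \<Rightarrow> real \<Rightarrow> complex" where
  "dyadic_mean n u x = mean (x + (1/2)^n) (x + 2 * (1/2)^n) u"

lemma dyadic_mean_measurable[measurable]:
  "u \<in> borel_measurable borel \<Longrightarrow> dyadic_mean n u \<in> borel_measurable borel"
  unfolding dyadic_mean_def by (rule mean_measurable) auto

lemma dyadic_mean_increments:
  assumes p: "1 < p" and u: "u \<in> Bp_space p"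
  shows "(\<Sum>n<N. ennreal (cmod (dyadic_mean n u x - dyadic_mean (Suc n) u x) powr p)) \<le> 5 * Bp_energy p u"
proof -
  have [measurable]: "u \<in> borel_measurable borel" using u by (auto simp: Bp_space_iff)
  define A where "A n = {x + (1/2)^n <.. x + 2 * (1/2)^n}" for n :: nat
  have [measurable]: "A n \<in> sets borel" for n by (simp add: A_def)
  have "ennreal (cmod (dyadic_mean n u x - dyadic_mean (Suc n) u x) powr p)
     \<le> 5 * (\<integral>\<^sup>+s. \<integral>\<^sup>+t. energy_density p u s t * indicator (A n) s \<partial>lborel \<partial>lborel)" (is "?l n \<le> 5 * ?r n") for n
  proof -
    have h: "(0::real) < (1/2)^n" by simp
    have "?l n \<le> ennreal ((3 / 2 * (1/2)^n)\<^sup>2 / ((x + 2 * (1/2)^Suc n - (x + (1/2)^Suc n)) * (x + 2 * (1/2)^n - (x + (1/2)^n)))) *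
       (\<integral>\<^sup>+s. \<integral>\<^sup>+t. energy_density p u s t * indicator (A (Suc n)) t * indicator (A n) s \<partial>lborel \<partial>lborel)"
      unfolding dyadic_mean_def A_def by (intro mean_dist_mean p u) (use h in \<open>auto simp: abs_if\<close>)
    \<comment> \<open>Neighbouring intervals of lengths h and h/2 keep s and t within 3h/2, and
      (9/4) h^2 / (h^2/2) = 9/2 at every scale.\<close>
    also have "(3 / 2 * (1/2)^n)\<^sup>2 / ((x + 2 * (1/2)^Suc n - (x + (1/2)^Suc n)) * (x + 2 * (1/2)^n - (x + (1/2)^n))) = (9/2::real)"
      using h by (simp add: power2_eq_square field_simps)
    also have "ennreal (9/2) * (\<integral>\<^sup>+s. \<integral>\<^sup>+t. energy_density p u s t * indicator (A (Suc n)) t * indicator (A n) s \<partial>lborel \<partial>lborel) \<le> 5 * ?r n"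
      by (intro mult_mono nn_integral_mono) (auto simp: indicator_def simp flip: ennreal_numeral intro!: ennreal_leI)
    finally show ?thesis .
  qed
  hence "(\<Sum>n<N. ?l n) \<le> (\<Sum>n<N. 5 * ?r n)" by (intro sum_mono)
  also have "\<dots> = 5 * (\<integral>\<^sup>+s. \<integral>\<^sup>+t. energy_density p u s t * (\<Sum>n<N. indicator (A n) s) \<partial>lborel \<partial>lborel)"
    unfolding sum_distrib_left[symmetric]
    by (subst nn_integral_sum[symmetric], measurable, subst nn_integral_sum[symmetric], measurable)
       (simp only: sum_distrib_left)
  also have "\<dots> \<le> 5 * (\<integral>\<^sup>+s. \<integral>\<^sup>+t. energy_density p u s t \<partial>lborel \<partial>lborel)"
  proof (intro mult_left_mono nn_integral_mono)
    fix s t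
    have disj: "A m \<inter> A n = {}" if "m < n" for m n
    proof -
      \<comment> \<open>Twice the smaller scale is at most the larger one, so the later interval
        ends where the earlier begins or before; a common endpoint belongs only to the later,
        half-open one.\<close>
      have "(1/2)^n \<le> ((1/2)^Suc m :: real)" using that by (intro power_decreasing) auto
      thus ?thesis by (auto simp: A_def)
    qed
    have "disjoint_family_on A {..<N}"
      unfolding disjoint_family_on_def using disj by (metis inf_commute linorder_neqE_nat)
    hence "(\<Sum>n<N. indicator (A n) s) = (indicator (\<Union>n<N. A n) s :: ennreal)"
      by (intro indicator_UN_disjoint[symmetric]) auto
    also have "\<dots> \<le> 1" by (auto simp: indicator_def)
    finally show "energy_density p u s t * (\<Sum>n<N. indicator (A n) s) \<le> energy_density p u s t"
      using mult_left_mono[of _ 1] by fastforce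
  qed auto
  also have "\<dots> = 5 * Bp_energy p u"
    by (simp add: Bp_energy_iterated energy_density_def)
  finally show ?thesis .
qed

text \<open>Telescoping, with \<open>le_eps_powr\<close> for each increment. Bounding the increments
  one by one would give a drift with a fixed slope, whose exponential need not be beaten by
  (1/2)^N.\<close>

lemma dyadic_mean_growth:
  fixes p R e x :: real
  assumes p: "1 < p" and u: "u \<in> Bp_space p" and R: "Bp_energy p u \<le> ennreal R" "0 \<le> R" and e: "0 < e"
  shows "cmod (dyadic_mean 0 u x - dyadic_mean N u x) \<le> e * real N + e powr (1 - p) * (5 * R)"
proof -
  let ?d = "\<lambda>n. cmod (dyadic_mean n u x - dyadic_mean (Suc n) u x)"
  have "ennreal (\<Sum>n<N. ?d n powr p) \<le> 5 * Bp_energy p u"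
    using dyadic_mean_increments[OF p u, of x N] by simp
  also have "\<dots> \<le> 5 * ennreal R" using R by (intro mult_left_mono) auto
  also have "\<dots> = ennreal (5 * R)" using R by (simp add: ennreal_mult)
  finally have s: "(\<Sum>n<N. ?d n powr p) \<le> 5 * R" using R by simp
  have "dyadic_mean 0 u x - dyadic_mean N u x = (\<Sum>n<N. dyadic_mean n u x - dyadic_mean (Suc n) u x)"
    by (rule sum_lessThan_telescope'[symmetric])
  hence "cmod (dyadic_mean 0 u x - dyadic_mean N u x) \<le> (\<Sum>n<N. ?d n)"
    by (simp add: norm_sum)
  also have "\<dots> \<le> (\<Sum>n<N. e + e powr (1 - p) * ?d n powr p)"
    using p e by (intro sum_mono le_eps_powr) auto
  also have "\<dots> = e * real N + e powr (1 - p) * (\<Sum>n<N. ?d n powr p)"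
    by (simp add: sum.distrib sum_distrib_left)
  also have "\<dots> \<le> e * real N + e powr (1 - p) * (5 * R)"
    using s by (intro add_left_mono mult_left_mono) auto
  finally show ?thesis .
qed

text \<open>At scale r = (1/2)^N the averaging interval has length r and lies within 2r of x, so
  \<open>mean_dist_point\<close> has the factor (2r)^2 / r = 4r.\<close>

lemma dyadic_mean_converges:
  assumes p: "1 < p" and u: "u \<in> Bp_space p"
  shows "(\<integral>\<^sup>+x. ennreal (cmod (u x - dyadic_mean N u x) powr p) \<partial>lborel) \<le> ennreal (4 * (1/2)^N) * Bp_energy p u"
proof -
  have [measurable]: "u \<in> borel_measurable borel" using u by (auto simp: Bp_space_iff)
  define r :: real where "r = (1/2)^N"
  have r: "0 < r" by (simp add: r_def)
  have "(\<integral>\<^sup>+x. ennreal (cmod (u x - dyadic_mean N u x) powr p) \<partial>lborel)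
    \<le> (\<integral>\<^sup>+x. ennreal ((2 * r)\<^sup>2 / ((x + 2 * r) - (x + r))) * (\<integral>\<^sup>+t. energy_density p u x t * indicator {x + r<..x + 2 * r} t \<partial>lborel) \<partial>lborel)"
    unfolding dyadic_mean_def r_def[symmetric]
    by (intro nn_integral_mono mean_dist_point p u) (use r in \<open>auto simp: abs_if\<close>)
  also have "\<dots> \<le> (\<integral>\<^sup>+x. ennreal (4 * r) * (\<integral>\<^sup>+t. energy_density p u x t \<partial>lborel) \<partial>lborel)"
    using r by (intro nn_integral_mono mult_mono) (auto simp: indicator_def power2_eq_square)
  also have "\<dots> = ennreal (4 * r) * Bp_energy p u"
    by (simp add: nn_integral_cmult Bp_energy_iterated energy_density_def)
  finally show ?thesis by (simp add: r_def)
qed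


section \<open>Exponential moments from the dyadic means\<close>

lemma nn_integral_exp_quarter: "(\<integral>\<^sup>+x. ennreal (exp (- x\<^sup>2 / 4)) \<partial>lborel) = ennreal (sqrt (4 * pi))"
proof -
  have "exp (- x\<^sup>2 / 4) = sqrt (4 * pi) * normal_density 0 (sqrt 2) x" for x
    by (simp add: normal_density_def)
  hence "(\<integral>\<^sup>+x. ennreal (exp (- x\<^sup>2 / 4)) \<partial>lborel) = (\<integral>\<^sup>+x. ennreal (sqrt (4 * pi)) * ennreal (normal_density 0 (sqrt 2) x) \<partial>lborel)"
    by (simp only: ennreal_mult real_sqrt_ge_zero mult_nonneg_nonneg pi_ge_zero zero_le_numeral normal_density_nonneg)
  also have "\<dots> = ennreal (sqrt (4 * pi)) * ennreal (\<integral>x. normal_density 0 (sqrt 2) x \<partial>lborel)"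
    by (subst nn_integral_cmult) (auto simp: nn_integral_eq_integral)
  finally show ?thesis by simp
qed

text \<open>
  The increments are \<open>p\<close>-summable uniformly in \<open>x\<close> with \<open>p > 1\<close>, so \<open>dyadic_mean 0 - dyadic_mean N\<close> is at
  most \<open>e N + M\<close> with \<open>e\<close> as small as desired. Where \<open>u - dyadic_mean 0\<close> exceeds this by 1 the error
  \<open>u - dyadic_mean N\<close> is at least 1, which happens on a set of measure \<open>O((1/2)\<^sup>N)\<close>.
\<close>

lemma exp_osc_bound:
  fixes p k R :: real
  assumes p: "1 < p" and k: "0 \<le> k" and R: "0 \<le> R"
  shows "\<exists>C>0. \<forall>u\<in>Bp_space p. Bp_energy p u \<le> ennreal R \<longrightarrow>
    (\<integral>\<^sup>+x. ennreal (exp (- x\<^sup>2 / 4) * exp (k * cmod (u x - dyadic_mean 0 u x))) \<partial>lborel) \<le> ennreal C"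
proof -
  \<comment> \<open>Makes exp (k e) at most 3/2, a number below 2, so that the layers contribute
    (3/2)^N (1/2)^N = (3/4)^N, a summable series.\<close>
  define e where "e = ln (3/2) / (k + 1)"
  have e: "0 < e" using k by (simp add: e_def)
  have "k * e \<le> ln (3/2)" using k by (simp add: e_def divide_simps)
  hence eke: "exp (k * e) \<le> 3/2" by (metis exp_le_cancel_iff exp_ln zero_less_divide_iff zero_less_numeral)
  \<comment> \<open>The summand 1 is the gap that forces |u - \<open>dyadic_mean N u\<close>| above
    1 on the N-th layer, where its p-th power then dominates the indicator.\<close>
  define M where "M = 1 + e powr (1 - p) * (5 * R)"
  define C where "C = exp (k * M) * (sqrt (4 * pi) + 24 * R)"
  have bound: "(\<integral>\<^sup>+x. ennreal (exp (- x\<^sup>2 / 4) * exp (k * cmod (u x - dyadic_mean 0 u x))) \<partial>lborel) \<le> ennreal C"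
    if u: "u \<in> Bp_space p" and E: "Bp_energy p u \<le> ennreal R" for u
  proof -
    have [measurable]: "u \<in> borel_measurable borel" using u by (auto simp: Bp_space_iff)
    let ?f = "\<lambda>x. cmod (u x - dyadic_mean 0 u x)"
    let ?d = "\<lambda>N x. cmod (u x - dyadic_mean N u x)"
    let ?c = "\<lambda>N::nat. ennreal (exp (k * M) * (3/2) ^ Suc N)"
    have pt: "ennreal (exp (k * ?f x)) \<le> ennreal (exp (k * M)) + (\<Sum>N. ?c N * ennreal (?d N x powr p))" for x
    proof (cases "?f x \<le> M")
      case True
      hence "ennreal (exp (k * ?f x)) \<le> ennreal (exp (k * M))"
        using k by (intro ennreal_leI) (auto intro: mult_left_mono)
      thus ?thesis by (simp add: add_increasing2)
    next
      case False
      \<comment> \<open>The layer M + e N < |u - \<open>dyadic_mean 0 u\<close>| <= M + e (N + 1)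
        containing x; the ceiling minus one makes the lower inequality strict.\<close>
      define N where "N = nat (\<lceil>(?f x - M) / e\<rceil> - 1)"
      have pos: "0 < (?f x - M) / e" using False e by simp
      have N: "real N < (?f x - M) / e" "(?f x - M) / e \<le> real N + 1"
        unfolding N_def using pos by linarith+
      hence N': "M + e * real N < ?f x" "?f x \<le> M + e * (real N + 1)"
        using e by (simp_all add: field_simps)
      have "?f x \<le> ?d N x + cmod (dyadic_mean 0 u x - dyadic_mean N u x)"
        using norm_triangle_ineq4[of "u x - dyadic_mean N u x" "dyadic_mean 0 u x - dyadic_mean N u x"] by simp
      also have "\<dots> \<le> ?d N x + (e * real N + (M - 1))"
        using dyadic_mean_growth[OF p u E R e, of x N] by (simp add: M_def)
      finally have "1 < ?d N x" using N' by simp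
      hence d: "1 \<le> ?d N x powr p" using p by (intro ge_one_powr_ge_zero) auto
      have "k * ?f x \<le> k * M + real (Suc N) * (k * e)"
        using mult_left_mono[OF N'(2) k] by (simp add: algebra_simps)
      hence "exp (k * ?f x) \<le> exp (k * M + real (Suc N) * (k * e))" by simp
      also have "\<dots> = exp (k * M) * exp (k * e) ^ Suc N"
        by (simp only: exp_add exp_of_nat_mult)
      also have "\<dots> \<le> exp (k * M) * (3/2) ^ Suc N"
        using eke by (intro mult_left_mono power_mono) auto
      also have "\<dots> \<le> exp (k * M) * (3/2) ^ Suc N * ?d N x powr p"
        using mult_left_mono[OF d, of "exp (k * M) * (3/2) ^ Suc N"] by simp
      finally have "ennreal (exp (k * ?f x)) \<le> ?c N * ennreal (?d N x powr p)"
        by (subst ennreal_mult[symmetric]) (auto intro: ennreal_leI)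
      also have "\<dots> = (\<Sum>N\<in>{N}. ?c N * ennreal (?d N x powr p))" by simp
      also have "\<dots> \<le> (\<Sum>N. ?c N * ennreal (?d N x powr p))"
        by (intro sum_le_suminf) auto
      finally show ?thesis by (simp add: add_increasing)
    qed
    have "(\<integral>\<^sup>+x. ennreal (exp (- x\<^sup>2 / 4) * exp (k * ?f x)) \<partial>lborel) \<le>
      (\<integral>\<^sup>+x. ennreal (exp (k * M)) * ennreal (exp (- x\<^sup>2 / 4)) + (\<Sum>N. ?c N * ennreal (?d N x powr p)) \<partial>lborel)"
    proof (intro nn_integral_mono)
      fix x :: real
      have "ennreal (exp (- x\<^sup>2 / 4) * exp (k * ?f x)) \<le> ennreal (exp (- x\<^sup>2 / 4)) * (ennreal (exp (k * M)) + (\<Sum>N. ?c N * ennreal (?d N x powr p)))"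
        using pt[of x] by (subst ennreal_mult) (auto intro!: mult_left_mono)
      also have "\<dots> = ennreal (exp (k * M)) * ennreal (exp (- x\<^sup>2 / 4)) + ennreal (exp (- x\<^sup>2 / 4)) * (\<Sum>N. ?c N * ennreal (?d N x powr p))"
        by (simp only: distrib_left mult.commute)
      also have "\<dots> \<le> ennreal (exp (k * M)) * ennreal (exp (- x\<^sup>2 / 4)) + 1 * (\<Sum>N. ?c N * ennreal (?d N x powr p))"
        by (intro add_left_mono mult_right_mono) auto
      finally show "ennreal (exp (- x\<^sup>2 / 4) * exp (k * ?f x)) \<le> ennreal (exp (k * M)) * ennreal (exp (- x\<^sup>2 / 4)) + (\<Sum>N. ?c N * ennreal (?d N x powr p))"
        by simp
    qed
    also have "\<dots> = ennreal (exp (k * M)) * ennreal (sqrt (4 * pi)) + (\<Sum>N. ?c N * (\<integral>\<^sup>+x. ennreal (?d N x powr p) \<partial>lborel))"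
      by (simp add: nn_integral_add nn_integral_cmult nn_integral_suminf nn_integral_exp_quarter[simplified])
    also have "\<dots> \<le> ennreal (exp (k * M)) * ennreal (sqrt (4 * pi)) + (\<Sum>N. ennreal (exp (k * M) * 6 * R * (3/4)^N))"
    proof (intro add_left_mono suminf_le)
      fix N
      have assoc: "ennreal a * (ennreal b * ennreal R) = ennreal (a * (b * R))" if "0 \<le> a" "0 \<le> b" for a b
        using that R by (simp add: ennreal_mult)
      have "?c N * (\<integral>\<^sup>+x. ennreal (?d N x powr p) \<partial>lborel) \<le> ?c N * (ennreal (4 * (1/2)^N) * ennreal R)"
        using dyadic_mean_converges[OF p u, of N] mult_left_mono[OF E, of "ennreal (4 * (1/2)^N)"]
        by (intro mult_left_mono) auto
      also have "\<dots> = ennreal (exp (k * M) * (3/2) ^ Suc N * (4 * (1/2)^N * R))"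
        by (rule assoc) auto
      also have "exp (k * M) * (3/2) ^ Suc N * (4 * (1/2)^N * R) = exp (k * M) * 6 * R * ((3/2)^N * (1/2)^N)"
        by simp
      also have "(3/2)^N * (1/2)^N = ((3/4)^N :: real)" by (simp flip: power_mult_distrib)
      finally show "?c N * (\<integral>\<^sup>+x. ennreal (?d N x powr p) \<partial>lborel) \<le> ennreal (exp (k * M) * 6 * R * (3/4)^N)" .
    qed auto
    also have "(\<Sum>N. ennreal (exp (k * M) * 6 * R * (3/4)^N)) = ennreal (\<Sum>N. exp (k * M) * 6 * R * (3/4)^N)"
      using R by (intro suminf_ennreal2) auto
    also have "(\<Sum>N. exp (k * M) * 6 * R * (3/4)^N) = exp (k * M) * 6 * R * 4"
      by (subst suminf_mult) (auto simp: suminf_geometric)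
    also have "ennreal (exp (k * M)) * ennreal (sqrt (4 * pi)) + ennreal (exp (k * M) * 6 * R * 4) = ennreal C"
      using R by (simp add: C_def ennreal_mult[symmetric] ennreal_plus[symmetric] algebra_simps del: ennreal_plus)
    finally show ?thesis .
  qed
  have "0 < C" using R by (auto simp: C_def intro!: mult_pos_pos add_pos_nonneg)
  with bound show ?thesis by blast
qed

text \<open>u s and u t are compared through the unit-scale means attached to s and t. The p-th
  power of the distance of these means grows at most quadratically, so by \<open>le_eps_powr\<close>
  its k-fold is at most a constant plus (s^2 + t^2)/4. This consumes half of the Gaussian exponent;
  the other half is the weight exp (-x^2/4) of \<open>exp_osc_bound\<close>.\<close>

proposition exp_osc_integrable:
  fixes p k R :: real
  assumes p: "1 < p" and k: "0 \<le> k" and R: "0 \<le> R"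
  shows "\<exists>C>0. \<forall>u\<in>Bp_space p. Bp_energy p u \<le> ennreal R \<longrightarrow>
    (\<integral>\<^sup>+s. \<integral>\<^sup>+t. ennreal (exp (k * cmod (u s - u t))) \<partial>gauss \<partial>gauss) \<le> ennreal C"
proof -
  obtain C0 where C0: "0 < C0" "\<And>u. u \<in> Bp_space p \<Longrightarrow> Bp_energy p u \<le> ennreal R \<Longrightarrow>
    (\<integral>\<^sup>+x. ennreal (exp (- x\<^sup>2 / 4) * exp (k * cmod (u x - dyadic_mean 0 u x))) \<partial>lborel) \<le> ennreal C0"
    using exp_osc_bound[OF p k R] by blast
  \<comment> \<open>Solves e^(1-p) = 1 / (16 k R + 1): the quadratic term 4 k R (s^2 + t^2) times
    this is at most (s^2 + t^2)/4. The 1 added keeps the base positive when k R = 0.\<close>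
  define e where "e = (16 * k * R + 1) powr (1 / (p - 1))"
  have pos: "16 * k * R + 1 > 0" using k R by (simp add: add_nonneg_pos)
  have e: "0 < e" using pos by (simp add: e_def)
  have m1: "(1 / (p - 1)) * (1 - p) = -1" using p by (simp add: divide_simps)
  have ep: "e powr (1 - p) = 1 / (16 * k * R + 1)"
    unfolding e_def powr_powr m1 using pos by (simp add: powr_minus divide_simps)
  define B where "B = k * e + 1"
  have bound: "(\<integral>\<^sup>+s. \<integral>\<^sup>+t. ennreal (exp (k * cmod (u s - u t))) \<partial>gauss \<partial>gauss) \<le> ennreal (exp B * C0 * C0)"
    if u: "u \<in> Bp_space p" and E: "Bp_energy p u \<le> ennreal R" for u
  proof -
    have [measurable]: "u \<in> borel_measurable borel" using u by (auto simp: Bp_space_iff)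
    let ?f = "\<lambda>x. cmod (u x - dyadic_mean 0 u x)"
    let ?G = "\<lambda>x. ennreal (exp (- x\<^sup>2 / 4) * exp (k * ?f x))"
    have D: "k * cmod (dyadic_mean 0 u s - dyadic_mean 0 u t) \<le> B + (s\<^sup>2 + t\<^sup>2) / 4" for s t
    proof -
      let ?D = "cmod (dyadic_mean 0 u s - dyadic_mean 0 u t)"
      have "ennreal (?D powr p) \<le> ennreal ((\<bar>s - t\<bar> + 1)\<^sup>2 / ((t + 2 - (t + 1)) * (s + 2 - (s + 1)))) *
          (\<integral>\<^sup>+a. \<integral>\<^sup>+b. energy_density p u a b * indicator {t + 1<..t + 2} b * indicator {s + 1<..s + 2} a \<partial>lborel \<partial>lborel)"
        unfolding dyadic_mean_def by (simp only: power_0 mult_1_right, intro mean_dist_mean p u) auto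
      also have "\<dots> \<le> ennreal ((\<bar>s - t\<bar> + 1)\<^sup>2) * (\<integral>\<^sup>+a. \<integral>\<^sup>+b. energy_density p u a b \<partial>lborel \<partial>lborel)"
        by (intro mult_mono nn_integral_mono) (auto simp: indicator_def)
      also have "\<dots> \<le> ennreal ((\<bar>s - t\<bar> + 1)\<^sup>2) * ennreal R"
        using E by (intro mult_left_mono) (auto simp: Bp_energy_iterated energy_density_def)
      also have "\<dots> = ennreal ((\<bar>s - t\<bar> + 1)\<^sup>2 * R)"
        using R by (simp add: ennreal_mult)
      finally have "?D powr p \<le> (\<bar>s - t\<bar> + 1)\<^sup>2 * R" using R by simp
      also have "\<dots> \<le> (4 * (s\<^sup>2 + t\<^sup>2) + 2) * R"
      proof (intro mult_right_mono R)
        have "(\<bar>s - t\<bar> + 1)\<^sup>2 \<le> 2 * (s - t)\<^sup>2 + 2"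
          using zero_le_power2[of "\<bar>s - t\<bar> - 1"] by (simp add: power2_sum power2_diff)
        also have "(s - t)\<^sup>2 \<le> 2 * (s\<^sup>2 + t\<^sup>2)"
          using zero_le_power2[of "s + t"] by (simp add: power2_sum power2_diff)
        finally show "(\<bar>s - t\<bar> + 1)\<^sup>2 \<le> 4 * (s\<^sup>2 + t\<^sup>2) + 2" by simp
      qed
      finally have Dp: "?D powr p \<le> (4 * (s\<^sup>2 + t\<^sup>2) + 2) * R" .
      define d where "d = 1 / (16 * k * R + 1)"
      have d: "0 \<le> d" "16 * k * R * d \<le> 1" using pos by (auto simp: d_def divide_simps)
      have "?D \<le> e + d * ?D powr p"
        using le_eps_powr[OF p e, of ?D] by (simp add: ep d_def)
      also have "\<dots> \<le> e + d * ((4 * (s\<^sup>2 + t\<^sup>2) + 2) * R)"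
        using d Dp by (intro add_left_mono mult_left_mono) auto
      finally have "k * ?D \<le> k * (e + d * ((4 * (s\<^sup>2 + t\<^sup>2) + 2) * R))"
        using k by (rule mult_left_mono)
      also have "\<dots> = k * e + (16 * k * R * d) * ((4 * (s\<^sup>2 + t\<^sup>2) + 2) / 16)"
        by (simp add: algebra_simps)
      also have "\<dots> \<le> k * e + 1 * ((4 * (s\<^sup>2 + t\<^sup>2) + 2) / 16)"
        using d by (intro add_left_mono mult_right_mono) auto
      finally show ?thesis by (simp add: B_def field_simps)
    qed
    have pt: "std_normal_density s * (std_normal_density t * exp (k * cmod (u s - u t)))
        \<le> exp B * ((exp (- s\<^sup>2 / 4) * exp (k * ?f s)) * (exp (- t\<^sup>2 / 4) * exp (k * ?f t)))" for s t
    proof -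
      have "cmod (u s - u t) \<le> ?f s + ?f t + cmod (dyadic_mean 0 u s - dyadic_mean 0 u t)"
      proof -
        have "u s - u t = (u s - dyadic_mean 0 u s) - (u t - dyadic_mean 0 u t) + (dyadic_mean 0 u s - dyadic_mean 0 u t)" by simp
        thus ?thesis by (metis norm_triangle_ineq norm_triangle_ineq4 norm_triangle_mono order_refl)
      qed
      from mult_left_mono[OF this k] have "k * cmod (u s - u t) \<le> k * ?f s + k * ?f t + (B + (s\<^sup>2 + t\<^sup>2) / 4)"
        using D[of s t] by (simp add: algebra_simps)
      hence "exp (- s\<^sup>2 / 2) * (exp (- t\<^sup>2 / 2) * exp (k * cmod (u s - u t)))
          \<le> exp B * ((exp (- s\<^sup>2 / 4) * exp (k * ?f s)) * (exp (- t\<^sup>2 / 4) * exp (k * ?f t)))"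
        by (simp flip: exp_add add: field_simps)
      moreover have "std_normal_density s * (std_normal_density t * exp (k * cmod (u s - u t))) \<le>
          exp (- s\<^sup>2 / 2) * (exp (- t\<^sup>2 / 2) * exp (k * cmod (u s - u t)))"
        by (intro mult_mono std_normal_density_le) auto
      ultimately show ?thesis by linarith
    qed
    have "(\<integral>\<^sup>+s. \<integral>\<^sup>+t. ennreal (exp (k * cmod (u s - u t))) \<partial>gauss \<partial>gauss)
       = (\<integral>\<^sup>+s. \<integral>\<^sup>+t. ennreal (std_normal_density s) * (ennreal (std_normal_density t) * ennreal (exp (k * cmod (u s - u t)))) \<partial>lborel \<partial>lborel)"
      by (simp add: nn_integral_gauss nn_integral_cmult)
    also have "\<dots> \<le> (\<integral>\<^sup>+s. \<integral>\<^sup>+t. ennreal (exp B) * (?G s * ?G t) \<partial>lborel \<partial>lborel)"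
      using pt by (intro nn_integral_mono) (simp add: ennreal_mult[symmetric] ennreal_leI)
    also have "\<dots> = ennreal (exp B) * ((\<integral>\<^sup>+s. ?G s \<partial>lborel) * (\<integral>\<^sup>+t. ?G t \<partial>lborel))"
      by (simp add: nn_integral_cmult nn_integral_multc)
    also have "\<dots> \<le> ennreal (exp B) * (ennreal C0 * ennreal C0)"
      by (intro mult_left_mono mult_mono C0 u E) auto
    also have "\<dots> = ennreal (exp B * C0 * C0)"
      using C0(1) by (simp add: ennreal_mult mult.assoc)
    finally show ?thesis .
  qed
  have "0 < exp B * C0 * C0" using C0(1) by simp
  with bound show ?thesis by blast
qed

section \<open>Perturbation of exponential integrals\<close>

definition centered :: "(real \<Rightarrow> complex) \<Rightarrow> real \<Rightarrow> complex" where
  "centered u = (\<lambda>s. u s - (\<integral>t. u t \<partial>gauss))"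

lemma centered_measurable[measurable]:
  "u \<in> borel_measurable borel \<Longrightarrow> centered u \<in> borel_measurable borel"
  unfolding centered_def by simp

lemma centered_eq_integral:
  assumes "integrable gauss u"
  shows "centered u s = (\<integral>t. u s - u t \<partial>gauss)"
  using assms gauss.prob_space by (simp add: centered_def)

lemma centered_powr_le:
  assumes p: "1 < p" and u: "u \<in> Bp_space p"
  shows "(\<integral>\<^sup>+s. ennreal (cmod (centered u s) powr p) \<partial>gauss) \<le> gauss_osc p u"
  unfolding gauss_osc_def centered_eq_integral[OF integrable_gauss_Bp[OF p u]]
  using integrable_gauss_Bp[OF p u] p by (intro nn_integral_mono gauss.jensen_powr) auto

lemma centered_exp_le:
  assumes p: "1 < p" and u: "u \<in> Bp_space p" and k: "0 \<le> k"
  shows "(\<integral>\<^sup>+s. ennreal (exp (k * cmod (centered u s))) \<partial>gauss)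
      \<le> (\<integral>\<^sup>+s. \<integral>\<^sup>+t. ennreal (exp (k * cmod (u s - u t))) \<partial>gauss \<partial>gauss)"
  unfolding centered_eq_integral[OF integrable_gauss_Bp[OF p u]]
  using integrable_gauss_Bp[OF p u] k by (intro nn_integral_mono gauss.jensen_exp) auto

lemma centered_exp_bound:
  fixes p k R :: real
  assumes p: "1 < p" and k: "0 \<le> k" and R: "0 \<le> R"
  shows "\<exists>C>0. \<forall>u\<in>Bp_space p. Bp_energy p u \<le> ennreal R \<longrightarrow>
    (\<integral>\<^sup>+s. ennreal (exp (k * cmod (centered u s))) \<partial>gauss) \<le> ennreal C"
  using exp_osc_integrable[OF assms] centered_exp_le[OF p _ k] by (meson order_trans)

section \<open>B_p as a vector space, and the Gaussian oscillation seminorm\<close>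

lemma Bp_energy_cmult:
  assumes [measurable]: "u \<in> borel_measurable borel"
  shows "Bp_energy p (\<lambda>s. c * u s) = ennreal (cmod c powr p) * Bp_energy p u"
proof -
  have "cmod (c * u s - c * u t) powr p / (s - t)\<^sup>2 = cmod c powr p * (cmod (u s - u t) powr p / (s - t)\<^sup>2)" for s t
    by (simp add: right_diff_distrib[symmetric] norm_mult powr_mult)
  thus ?thesis
    by (simp add: Bp_energy_iterated ennreal_mult nn_integral_cmult del: times_divide_eq_right)
qed

lemma Bp_space_cmult: "u \<in> Bp_space p \<Longrightarrow> (\<lambda>s. c * u s) \<in> Bp_space p"
  by (auto simp: Bp_space_iff Bp_energy_cmult ennreal_mult_less_top)

lemma powr_add_le:
  fixes a b p :: real
  assumes "0 < p" "0 \<le> a" "0 \<le> b"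
  shows "(a + b) powr p \<le> 2 powr p * (a powr p + b powr p)"
proof -
  have "(a + b) powr p \<le> (2 * max a b) powr p"
    using assms by (intro powr_mono2) auto
  also have "\<dots> = 2 powr p * max a b powr p" using assms by (simp add: powr_mult)
  also have "\<dots> \<le> 2 powr p * (a powr p + b powr p)"
    by (intro mult_left_mono) (auto simp: max_def)
  finally show ?thesis .
qed

lemma Bp_energy_add_le:
  assumes [measurable]: "u \<in> borel_measurable borel" "v \<in> borel_measurable borel" and p: "0 < p"
  shows "Bp_energy p (\<lambda>s. u s + v s) \<le> ennreal (2 powr p) * (Bp_energy p u + Bp_energy p v)"
proof -
  have "cmod (u s + v s - (u t + v t)) powr p / (s - t)\<^sup>2
      \<le> 2 powr p * (cmod (u s - u t) powr p / (s - t)\<^sup>2 + cmod (v s - v t) powr p / (s - t)\<^sup>2)" for s t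
  proof -
    have "cmod (u s + v s - (u t + v t)) \<le> cmod (u s - u t) + cmod (v s - v t)"
      using norm_triangle_ineq[of "u s - u t" "v s - v t"] by (simp add: algebra_simps)
    hence "cmod (u s + v s - (u t + v t)) powr p \<le> (cmod (u s - u t) + cmod (v s - v t)) powr p"
      using p by (intro powr_mono2) auto
    also have "\<dots> \<le> 2 powr p * (cmod (u s - u t) powr p + cmod (v s - v t) powr p)"
      using p by (intro powr_add_le) auto
    finally have "cmod (u s + v s - (u t + v t)) powr p / (s - t)\<^sup>2 \<le>
       2 powr p * (cmod (u s - u t) powr p + cmod (v s - v t) powr p) / (s - t)\<^sup>2"
      by (intro divide_right_mono) auto
    thus ?thesis by (simp only: add_divide_distrib distrib_left times_divide_eq_right)
  qed
  hence "Bp_energy p (\<lambda>s. u s + v s) \<le> (\<integral>\<^sup>+s. \<integral>\<^sup>+t. ennreal (2 powr p) *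
      (ennreal (cmod (u s - u t) powr p / (s - t)\<^sup>2) + ennreal (cmod (v s - v t) powr p / (s - t)\<^sup>2)) \<partial>lborel \<partial>lborel)"
    by (subst Bp_energy_iterated, measurable, intro nn_integral_mono)
       (simp add: ennreal_plus[symmetric] ennreal_mult[symmetric] ennreal_leI del: ennreal_plus)
  also have "\<dots> = ennreal (2 powr p) * (Bp_energy p u + Bp_energy p v)"
    by (simp add: Bp_energy_iterated nn_integral_cmult nn_integral_add)
  finally show ?thesis .
qed

lemma Bp_space_add: "0 < p \<Longrightarrow> u \<in> Bp_space p \<Longrightarrow> v \<in> Bp_space p \<Longrightarrow> (\<lambda>s. u s + v s) \<in> Bp_space p"
  using Bp_energy_add_le[of u v p]
  by (auto simp: Bp_space_iff ennreal_mult_less_top intro: order.strict_trans1)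

lemma Bp_space_lincomb:
  "0 < p \<Longrightarrow> u \<in> Bp_space p \<Longrightarrow> v \<in> Bp_space p \<Longrightarrow> (\<lambda>s. a * u s + b * v s) \<in> Bp_space p"
  by (intro Bp_space_add Bp_space_cmult)

lemma Bp_space_diff: "0 < p \<Longrightarrow> u \<in> Bp_space p \<Longrightarrow> v \<in> Bp_space p \<Longrightarrow> (\<lambda>s. u s - v s) \<in> Bp_space p"
  using Bp_space_lincomb[of p u v 1 "-1"] by simp

text \<open>\<open>enn2real\<close> sends infinity to 0, so the value is meaningful only for finite
  \<open>gauss_osc\<close>, which \<open>gauss_osc_finite\<close> grants on
  \<open>Bp_space p\<close>.\<close>

definition osc_norm :: "real \<Rightarrow> (real \<Rightarrow> complex) \<Rightarrow> real" where
  "osc_norm p u = enn2real (gauss_osc p u) powr (1 / p)"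

lemma osc_norm_nonneg: "0 \<le> osc_norm p u"
  by (simp add: osc_norm_def)

lemma gauss_osc_le_energy:
  assumes "u \<in> borel_measurable borel"
  shows "gauss_osc p u \<le> 4 * Bp_energy p u"
  using gauss_osc_le[of "\<lambda>s. u (- s)" 1 p 0] Bp_energy_affine[of u "-1" p 0] assms by simp

lemma gauss_osc_finite: "u \<in> Bp_space p \<Longrightarrow> gauss_osc p u < \<infinity>"
  using gauss_osc_le_energy[of u p]
  by (auto simp: Bp_space_iff ennreal_mult_less_top intro: order.strict_trans1)

lemma osc_norm_le_Bp_norm:
  assumes p: "1 < p" and u: "u \<in> Bp_space p"
  shows "osc_norm p u \<le> 4 * Bp_norm p u"
proof -
  have "enn2real (gauss_osc p u) \<le> enn2real (4 * Bp_energy p u)"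
    using u by (intro enn2real_mono gauss_osc_le_energy) (auto simp: Bp_space_iff ennreal_mult_less_top)
  also have "\<dots> = 4 * enn2real (Bp_energy p u)" by (simp add: enn2real_mult)
  finally have "osc_norm p u \<le> (4 * enn2real (Bp_energy p u)) powr (1/p)"
    unfolding osc_norm_def using p by (intro powr_mono2) auto
  also have "\<dots> = 4 powr (1/p) * Bp_norm p u" by (simp add: Bp_norm_def powr_mult)
  also have "\<dots> \<le> 4 powr 1 * Bp_norm p u"
    using p by (intro mult_right_mono powr_mono) (auto simp: Bp_norm_def)
  finally show ?thesis by simp
qed

section \<open>Exponential integrals against bounded kernels\<close>

definition gint :: "(real \<Rightarrow> complex) \<Rightarrow> (real \<Rightarrow> complex) \<Rightarrow> complex" where
  "gint w X = (\<integral>s. w s * X s \<partial>gauss)"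

lemma gint_dominated:
  assumes [measurable]: "w \<in> borel_measurable borel" "X \<in> borel_measurable borel"
    and w: "\<And>s. cmod (w s) \<le> K" and K: "0 \<le> K" and B: "0 \<le> B" "(\<integral>\<^sup>+s. ennreal (cmod (X s)) \<partial>gauss) \<le> ennreal B"
  shows "integrable gauss (\<lambda>s. w s * X s)" "cmod (gint w X) \<le> K * B"
proof -
  have "(\<integral>\<^sup>+s. ennreal (cmod (w s * X s)) \<partial>gauss) \<le> (\<integral>\<^sup>+s. ennreal K * ennreal (cmod (X s)) \<partial>gauss)"
    using w K by (intro nn_integral_mono) (auto simp: norm_mult ennreal_mult[symmetric] intro!: ennreal_leI mult_right_mono)
  also have "\<dots> = ennreal K * (\<integral>\<^sup>+s. ennreal (cmod (X s)) \<partial>gauss)"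
    by (simp add: nn_integral_cmult)
  also have "\<dots> \<le> ennreal K * ennreal B" using B by (intro mult_left_mono) auto
  also have "\<dots> = ennreal (K * B)" using K B by (simp add: ennreal_mult)
  finally have le: "(\<integral>\<^sup>+s. ennreal (cmod (w s * X s)) \<partial>gauss) \<le> ennreal (K * B)" .
  show i: "integrable gauss (\<lambda>s. w s * X s)"
    by (rule integrableI_bounded) (use le in \<open>auto intro: order.strict_trans1\<close>)
  have "ennreal (cmod (gint w X)) \<le> (\<integral>\<^sup>+s. ennreal (cmod (w s * X s)) \<partial>gauss)"
    unfolding gint_def by (rule integral_norm_bound_ennreal[OF i])
  with le have "ennreal (cmod (gint w X)) \<le> ennreal (K * B)" by (rule order_trans[rotated])
  thus "cmod (gint w X) \<le> K * B" using K B by (simp add: ennreal_le_iff)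
qed

text \<open>The tail of the exponential series from index n on is at most |z|^n exp |z|, because (i
  + n)! >= i!; the cases n = 1 and n = 2.\<close>

lemma norm_exp_minus_1_le: "cmod (exp z - 1) \<le> cmod z * exp (cmod z)"
  and norm_exp_minus_1_minus_le: "cmod (exp z - 1 - z) \<le> (cmod z)\<^sup>2 * exp (cmod z)"
proof -
  have "cmod (exp z - (\<Sum>i<n. z^i /\<^sub>R fact i)) \<le> cmod z ^ n * exp (cmod z)" for n
  proof -
    have s: "(\<lambda>i. z^(i + n) /\<^sub>R fact (i + n)) sums (exp z - (\<Sum>i<n. z^i /\<^sub>R fact i))"
      using exp_converges[of z] by (rule sums_split_initial_segment)
    have s': "(\<lambda>i. cmod z ^ n * (cmod z ^ i /\<^sub>R fact i)) sums (cmod z ^ n * exp (cmod z))"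
      by (intro sums_mult exp_converges)
    have le: "norm (z^(i + n) /\<^sub>R fact (i + n)) \<le> cmod z ^ n * (cmod z ^ i /\<^sub>R fact i)" for i
    proof -
      have "fact i \<le> (fact (i + n) :: real)" by (intro fact_mono) simp
      hence "cmod z ^ (i + n) / fact (i + n) \<le> cmod z ^ (i + n) / fact i"
        by (intro divide_left_mono) auto
      thus ?thesis by (simp add: norm_mult norm_power power_add divide_inverse mult_ac)
    qed
    have sn: "summable (\<lambda>i. norm (z^(i + n) /\<^sub>R fact (i + n)))"
      using s' le by (intro summable_comparison_test'[OF sums_summable[OF s'], of 0]) auto
    have "cmod (exp z - (\<Sum>i<n. z^i /\<^sub>R fact i)) = norm (\<Sum>i. z^(i + n) /\<^sub>R fact (i + n))"
      using s by (simp add: sums_iff)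
    also have "\<dots> \<le> (\<Sum>i. norm (z^(i + n) /\<^sub>R fact (i + n)))" by (rule summable_norm[OF sn])
    also have "\<dots> \<le> (\<Sum>i. cmod z ^ n * (cmod z ^ i /\<^sub>R fact i))"
      using sn s' le by (intro suminf_le) (auto simp: sums_iff)
    also have "\<dots> = cmod z ^ n * exp (cmod z)" using s' by (simp add: sums_iff)
    finally show ?thesis .
  qed
  from this[of 1] this[of 2] show "cmod (exp z - 1) \<le> cmod z * exp (cmod z)" "cmod (exp z - 1 - z) \<le> (cmod z)\<^sup>2 * exp (cmod z)"
    by (simp_all add: numeral_2_eq_2 diff_diff_eq)
qed

lemma Bp_energy_eq_norm:
  assumes p: "1 < p" and u: "u \<in> Bp_space p"
  shows "Bp_energy p u = ennreal (Bp_norm p u powr p)"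
  using assms by (simp add: Bp_norm_def powr_powr Bp_space_iff less_top)

lemma nn_integral_centered_Hoelder:
  assumes p: "1 < p" and h: "h \<in> Bp_space p" and [measurable]: "g \<in> borel_measurable borel" and g: "\<And>s. 0 \<le> g s"
    and B: "(\<integral>\<^sup>+s. ennreal (g s powr (p / (p - 1))) \<partial>gauss) \<le> ennreal B" "0 < B"
  shows "(\<integral>\<^sup>+s. ennreal (cmod (centered h s) * g s) \<partial>gauss) \<le> ennreal (osc_norm p h * B powr (1 / (p / (p - 1))))"
proof -
  have [measurable]: "h \<in> borel_measurable borel" using h by (simp add: Bp_space_iff)
  have "(\<integral>\<^sup>+s. ennreal (cmod (centered h s) powr p) \<partial>gauss) \<le> ennreal (enn2real (gauss_osc p h))"
    using centered_powr_le[OF p h] gauss_osc_finite[OF h] by (simp add: less_top)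
  thus ?thesis unfolding osc_norm_def
    by (intro nn_integral_Hoelder[OF p refl]) (use B g in auto)
qed

text \<open>Bundled because one C has to serve both kernels and all u of energy at most R, hence
  every rescaling of a given function. The last clause separates the bound r on the B_p norm of h
  from its Gaussian oscillation: r gives smallness, and \<open>osc_norm p h\<close> survives for
  integration over the half plane.\<close>

definition perturbation_const :: "real \<Rightarrow> real \<Rightarrow> real \<Rightarrow> real \<Rightarrow> bool" where
  "perturbation_const p R K C \<longleftrightarrow> 1 \<le> C \<and> (\<forall>u w. u \<in> Bp_space p \<and> Bp_energy p u \<le> ennreal R \<and>
       w \<in> borel_measurable borel \<and> (\<forall>s. cmod (w s) \<le> K) \<longrightarrow>
     integrable gauss (\<lambda>s. w s * exp (centered u s)) \<and> cmod (gint w (\<lambda>s. exp (centered u s))) \<le> C \<and>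
     ((\<integral>s. w s \<partial>gauss) = 0 \<longrightarrow> cmod (gint w (\<lambda>s. exp (centered u s))) \<le> C * osc_norm p u) \<and>
     (\<forall>h\<in>Bp_space p. integrable gauss (\<lambda>s. w s * (centered h s * exp (centered u s))) \<and>
       cmod (gint w (\<lambda>s. centered h s * exp (centered u s))) \<le> C * osc_norm p h \<and>
       (\<forall>r. 0 < r \<and> r \<le> 1 \<and> Bp_norm p h \<le> r \<longrightarrow>
         cmod (gint w (\<lambda>s. exp (centered u s + centered h s)) - gint w (\<lambda>s. exp (centered u s)) -
           gint w (\<lambda>s. centered h s * exp (centered u s))) \<le> C * r * osc_norm p h)))"

lemma perturbation_constD:
  assumes "perturbation_const p R K C" "u \<in> Bp_space p" "Bp_energy p u \<le> ennreal R" "w \<in> borel_measurable borel" "\<And>s. cmod (w s) \<le> K"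
  shows "integrable gauss (\<lambda>s. w s * exp (centered u s))" "cmod (gint w (\<lambda>s. exp (centered u s))) \<le> C"
    "(\<integral>s. w s \<partial>gauss) = 0 \<Longrightarrow> cmod (gint w (\<lambda>s. exp (centered u s))) \<le> C * osc_norm p u"
    "h \<in> Bp_space p \<Longrightarrow> integrable gauss (\<lambda>s. w s * (centered h s * exp (centered u s)))"
    "h \<in> Bp_space p \<Longrightarrow> cmod (gint w (\<lambda>s. centered h s * exp (centered u s))) \<le> C * osc_norm p h"
    "h \<in> Bp_space p \<Longrightarrow> 0 < r \<Longrightarrow> r \<le> 1 \<Longrightarrow> Bp_norm p h \<le> r \<Longrightarrow>
      cmod (gint w (\<lambda>s. exp (centered u s + centered h s)) - gint w (\<lambda>s. exp (centered u s)) -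
        gint w (\<lambda>s. centered h s * exp (centered u s))) \<le> C * r * osc_norm p h"
  using assms unfolding perturbation_const_def by blast+

text \<open>Apart from the plain bound by C, every estimate is Hoelder's inequality with a centered
  function in L^p and exponentials in L^q. C0 controls exponentials of u, C1 those of an increment
  normalised to energy at most 1.\<close>

proposition perturbation_bounds:
  fixes p R K :: real
  assumes p: "1 < p" and R: "0 \<le> R" and K: "0 \<le> K"
  shows "\<exists>C. perturbation_const p R K C"
proof -
  define q where "q = p / (p - 1)"
  have q: "1 < q" using p by (simp add: q_def)
  have q0: "q > 0" "1/q > 0" using q by auto
  \<comment> \<open>4 q is the largest exponent that occurs: q from Hoelder, 2 from the two
    exponentials spent on the remainder, 2 from separating a product by squares.\<close>
  have "0 \<le> 4 * q" using q by simp
  then obtain C0 where C0: "0 < C0" "\<And>u. u \<in> Bp_space p \<Longrightarrow> Bp_energy p u \<le> ennreal R \<Longrightarrow>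
    (\<integral>\<^sup>+s. ennreal (exp (4 * q * cmod (centered u s))) \<partial>gauss) \<le> ennreal C0"
    using centered_exp_bound[OF p _ R] by blast
  obtain C1 where C1: "0 < C1" "\<And>u. u \<in> Bp_space p \<Longrightarrow> Bp_energy p u \<le> ennreal 1 \<Longrightarrow>
    (\<integral>\<^sup>+s. ennreal (exp (4 * q * cmod (centered u s))) \<partial>gauss) \<le> ennreal C1"
    using centered_exp_bound[OF p \<open>0 \<le> 4 * q\<close>, of 1] by auto
  define C2 where "C2 = (C0 + C1) powr (1 / q)"
  define C where "C = 1 + K * C0 + K * C2"
  have C2: "0 \<le> C2" "C0 powr (1 / q) \<le> C2"
    using C0(1) C1(1) q0 by (auto simp: C2_def intro!: powr_mono2)
  have Cge: "1 \<le> C" "K * C0 \<le> C" "K * C2 \<le> C" using K C0(1) C2 by (auto simp: C_def)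
  have expint: "(\<integral>\<^sup>+s. ennreal (exp (j * cmod (centered u s))) \<partial>gauss) \<le> ennreal C0"
    if u: "u \<in> Bp_space p" "Bp_energy p u \<le> ennreal R" and j: "j \<le> 4 * q" for u j
  proof -
    have "(\<integral>\<^sup>+s. ennreal (exp (j * cmod (centered u s))) \<partial>gauss) \<le> (\<integral>\<^sup>+s. ennreal (exp (4 * q * cmod (centered u s))) \<partial>gauss)"
      using j by (intro nn_integral_mono ennreal_leI) (auto intro!: mult_right_mono)
    thus ?thesis using C0(2)[OF u] by (rule order_trans)
  qed
  have Xbound: "(\<integral>\<^sup>+s. ennreal (cmod (centered h s) * exp (cmod (centered u s))) \<partial>gauss) \<le> ennreal (osc_norm p h * C2)"
    if u: "u \<in> Bp_space p" "Bp_energy p u \<le> ennreal R" and h: "h \<in> Bp_space p" for u h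
  proof -
    have [measurable]: "u \<in> borel_measurable borel" using u by (simp add: Bp_space_iff)
    have "(\<integral>\<^sup>+s. ennreal (exp (cmod (centered u s)) powr (p / (p - 1))) \<partial>gauss) \<le> ennreal C0"
      using expint[OF u, of q] q unfolding q_def[symmetric] by (simp add: exp_powr_real mult.commute)
    hence "(\<integral>\<^sup>+s. ennreal (cmod (centered h s) * exp (cmod (centered u s))) \<partial>gauss) \<le> ennreal (osc_norm p h * C0 powr (1 / (p / (p - 1))))"
      by (intro nn_integral_centered_Hoelder p h C0(1)) auto
    also have "\<dots> \<le> ennreal (osc_norm p h * C2)"
      using C2 by (intro ennreal_leI mult_left_mono osc_norm_nonneg) (auto simp: q_def)
    finally show ?thesis .
  qed
  have bound0: "integrable gauss (\<lambda>s. w s * exp (centered u s)) \<and> cmod (gint w (\<lambda>s. exp (centered u s))) \<le> C \<and>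
       ((\<integral>s. w s \<partial>gauss) = 0 \<longrightarrow> cmod (gint w (\<lambda>s. exp (centered u s))) \<le> C * osc_norm p u)"
    if u: "u \<in> Bp_space p" "Bp_energy p u \<le> ennreal R"
      and w[measurable]: "w \<in> borel_measurable borel" and wK: "\<And>s. cmod (w s) \<le> K" for u and w :: "real \<Rightarrow> complex"
  proof -
    have [measurable]: "u \<in> borel_measurable borel" using u by (simp add: Bp_space_iff)
    have b: "(\<integral>\<^sup>+s. ennreal (cmod (exp (centered u s))) \<partial>gauss) \<le> ennreal C0"
      using q by (intro order_trans[OF _ expint[OF u, of 1]] nn_integral_mono ennreal_leI) (auto simp: complex_Re_le_cmod)
    have i: "integrable gauss (\<lambda>s. w s * exp (centered u s))"
      by (rule gint_dominated(1)[OF _ _ wK K _ b]) (use C0(1) in auto)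
    have "cmod (gint w (\<lambda>s. exp (centered u s))) \<le> K * C0"
      by (rule gint_dominated(2)[OF _ _ wK K _ b]) (use C0(1) in auto)
    moreover have "cmod (gint w (\<lambda>s. exp (centered u s))) \<le> C * osc_norm p u" if w0: "(\<integral>s. w s \<partial>gauss) = 0"
    proof -
      have iw: "integrable gauss w"
        using wK by (intro gauss.integrable_const_bound[of _ K]) auto
      \<comment> \<open>A kernel of mean zero does not see the constant 1, and |exp z - 1| carries a
        factor |z| that becomes the oscillation.\<close>
      have "gint w (\<lambda>s. exp (centered u s)) = gint w (\<lambda>s. exp (centered u s) - 1)"
        using i iw w0 by (simp add: gint_def right_diff_distrib)
      also have "cmod \<dots> \<le> K * (osc_norm p u * C2)"
      proof (rule gint_dominated(2)[OF _ _ wK K])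
        show "(\<integral>\<^sup>+s. ennreal (cmod (exp (centered u s) - 1)) \<partial>gauss) \<le> ennreal (osc_norm p u * C2)"
          by (rule order_trans[OF nn_integral_mono Xbound[OF u u(1)]]) (intro ennreal_leI norm_exp_minus_1_le)
      qed (use C2 osc_norm_nonneg in auto)
      also have "\<dots> \<le> C * osc_norm p u"
        using mult_right_mono[OF Cge(3) osc_norm_nonneg[of p u]] by (simp add: mult_ac)
      finally show ?thesis .
    qed
    ultimately show ?thesis using i Cge by auto
  qed
  have bound1: "integrable gauss (\<lambda>s. w s * (centered h s * exp (centered u s))) \<and>
       cmod (gint w (\<lambda>s. centered h s * exp (centered u s))) \<le> C * osc_norm p h"
    if u: "u \<in> Bp_space p" "Bp_energy p u \<le> ennreal R" and h: "h \<in> Bp_space p"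
      and w[measurable]: "w \<in> borel_measurable borel" and wK: "\<And>s. cmod (w s) \<le> K" for u h and w :: "real \<Rightarrow> complex"
  proof -
    have [measurable]: "u \<in> borel_measurable borel" "h \<in> borel_measurable borel" using u h by (simp_all add: Bp_space_iff)
    have b: "(\<integral>\<^sup>+s. ennreal (cmod (centered h s * exp (centered u s))) \<partial>gauss) \<le> ennreal (osc_norm p h * C2)"
      by (rule order_trans[OF nn_integral_mono Xbound[OF u h]]) (auto simp: norm_mult complex_Re_le_cmod intro!: ennreal_leI mult_left_mono)
    have nn: "0 \<le> osc_norm p h * C2" using C2 osc_norm_nonneg by auto
    have "integrable gauss (\<lambda>s. w s * (centered h s * exp (centered u s)))"
      by (rule gint_dominated(1)[OF _ _ wK K nn b]) auto
    moreover have "cmod (gint w (\<lambda>s. centered h s * exp (centered u s))) \<le> K * (osc_norm p h * C2)"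
      by (rule gint_dominated(2)[OF _ _ wK K nn b]) auto
    ultimately show ?thesis
      using mult_right_mono[OF Cge(3) osc_norm_nonneg[of p h]] by (simp add: mult_ac)
  qed
  have bound2: "cmod (gint w (\<lambda>s. exp (centered u s + centered h s)) - gint w (\<lambda>s. exp (centered u s)) -
         gint w (\<lambda>s. centered h s * exp (centered u s))) \<le> C * r * osc_norm p h"
    if u: "u \<in> Bp_space p" "Bp_energy p u \<le> ennreal R" and h: "h \<in> Bp_space p"
      and w[measurable]: "w \<in> borel_measurable borel" and wK: "\<And>s. cmod (w s) \<le> K"
      and r: "0 < r" "r \<le> 1" "Bp_norm p h \<le> r" for u h and w :: "real \<Rightarrow> complex" and r
  proof -
    have [measurable]: "u \<in> borel_measurable borel" "h \<in> borel_measurable borel" using u h by (simp_all add: Bp_space_iff)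
    let ?v = "centered u" and ?h = "centered h"
    let ?X = "\<lambda>s. (exp (?h s) - 1 - ?h s) * exp (?v s)"
    let ?g = "\<lambda>s. r * exp (2 * cmod (?h s) / r + cmod (?v s))"
    \<comment> \<open>\<open>h / r\<close> lies in the unit ball, so one factor \<open>|h|\<close> of the quadratic remainder can be traded for \<open>r exp (|h| / r)\<close>.\<close>
    define k where "k = (\<lambda>s. of_real (1 / r) * h s)"
    have k: "k \<in> Bp_space p" unfolding k_def using h by (rule Bp_space_cmult)
    have [measurable]: "k \<in> borel_measurable borel" using k by (simp add: Bp_space_iff)
    have "Bp_energy p k = ennreal ((1 / r) powr p) * ennreal (Bp_norm p h powr p)"
      unfolding k_def using r by (subst Bp_energy_cmult) (simp_all add: Bp_energy_eq_norm[OF p h] norm_divide)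
    also have "\<dots> = ennreal ((Bp_norm p h / r) powr p)"
      using r by (simp add: ennreal_mult[symmetric] powr_divide Bp_norm_def)
    also have "\<dots> \<le> ennreal (1 powr p)"
      using r p by (intro ennreal_leI powr_mono2) (auto simp: Bp_norm_def)
    finally have Ek: "Bp_energy p k \<le> ennreal 1" by simp
    have ck: "cmod (centered k s) = cmod (?h s) / r" for s
    proof -
      have "centered k s = of_real (1 / r) * ?h s"
        unfolding centered_def k_def by (subst Bochner_Integration.integral_mult_right_zero) (simp add: right_diff_distrib)
      thus ?thesis using r by (simp add: norm_divide)
    qed
    have B: "(\<integral>\<^sup>+s. ennreal (?g s powr (p / (p - 1))) \<partial>gauss) \<le> ennreal (r powr q * (C1 + C0))"
    proof -
      have "?g s powr (p / (p - 1)) \<le> r powr q * (exp (4 * q * cmod (centered k s)) + exp (2 * q * cmod (?v s)))" for s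
      proof -
        let ?a = "exp (2 * q * cmod (centered k s))" and ?b = "exp (q * cmod (?v s))"
        have "exp (2 * cmod (?h s) / r + cmod (?v s)) powr q = ?a * ?b"
          by (simp add: exp_powr_real exp_add[symmetric] ck algebra_simps)
        \<comment> \<open>Decouples the increment from u, whose exponential moments are known only
          separately.\<close>
        also have "\<dots> \<le> ?a\<^sup>2 + ?b\<^sup>2"
        proof -
          have "0 < ?a * ?b" by simp
          thus ?thesis using sum_squares_bound[of ?a ?b] unfolding mult.assoc by linarith
        qed
        also have "\<dots> = exp (4 * q * cmod (centered k s)) + exp (2 * q * cmod (?v s))"
          by (simp add: power2_eq_square exp_add[symmetric] algebra_simps)
        finally show ?thesis using r by (simp add: powr_mult q_def[symmetric] mult_left_mono)
      qed
      hence "(\<integral>\<^sup>+s. ennreal (?g s powr (p / (p - 1))) \<partial>gauss) \<le>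
         (\<integral>\<^sup>+s. ennreal (r powr q) * (ennreal (exp (4 * q * cmod (centered k s))) + ennreal (exp (2 * q * cmod (?v s)))) \<partial>gauss)"
        by (intro nn_integral_mono) (simp add: ennreal_plus[symmetric] ennreal_mult[symmetric] ennreal_leI del: ennreal_plus)
      also have "\<dots> = ennreal (r powr q) * ((\<integral>\<^sup>+s. ennreal (exp (4 * q * cmod (centered k s))) \<partial>gauss) + (\<integral>\<^sup>+s. ennreal (exp (2 * q * cmod (?v s))) \<partial>gauss))"
        by (simp add: nn_integral_cmult nn_integral_add)
      also have "\<dots> \<le> ennreal (r powr q) * (ennreal C1 + ennreal C0)"
        using q by (intro mult_left_mono add_mono C1(2) k Ek expint u) auto
      also have "\<dots> = ennreal (r powr q * (C1 + C0))"
        using C0(1) C1(1) by (simp add: ennreal_mult)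
      finally show ?thesis .
    qed
    have "(\<integral>\<^sup>+s. ennreal (cmod (?h s) * ?g s) \<partial>gauss) \<le> ennreal (osc_norm p h * (r powr q * (C1 + C0)) powr (1 / (p / (p - 1))))"
      using r C0(1) C1(1) by (intro nn_integral_centered_Hoelder p h B) auto
    also have "(r powr q * (C1 + C0)) powr (1 / (p / (p - 1))) = r * C2"
      using r C0(1) C1(1) q0 unfolding q_def[symmetric]
      by (simp add: powr_mult powr_powr C2_def add.commute)
    finally have Xb: "(\<integral>\<^sup>+s. ennreal (cmod (?h s) * ?g s) \<partial>gauss) \<le> ennreal (osc_norm p h * (r * C2))" .
    \<comment> \<open>Of the two factors |h| in the second-order bound one is kept for the
      oscillation and the other is at most r exp (|h| / r); r <= 1 lets exp |h| be absorbed in a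
      second exp (|h| / r).\<close>
    have "cmod (?X s) \<le> cmod (?h s) * ?g s" for s
    proof -
      let ?y = "cmod (?h s)"
      have "?y / r \<le> exp (?y / r)" using exp_ge_add_one_self[of "?y / r"] by linarith
      hence y: "?y \<le> r * exp (?y / r)" using r by (simp add: field_simps)
      have y2: "?y \<le> ?y / r" using r by (simp add: field_simps mult_left_le_one_le)
      have "cmod (?X s) \<le> (?y\<^sup>2 * exp ?y) * exp (cmod (?v s))"
        unfolding norm_mult by (intro mult_mono norm_exp_minus_1_minus_le norm_exp) auto
      also have "\<dots> = ?y * (?y * exp ?y * exp (cmod (?v s)))" by (simp add: power2_eq_square)
      also have "\<dots> \<le> ?y * (r * exp (?y / r) * exp (?y / r) * exp (cmod (?v s)))"
        using y y2 r by (intro mult_left_mono mult_right_mono mult_mono) auto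
      also have "\<dots> = ?y * ?g s" by (simp add: exp_add[symmetric] mult.assoc)
      finally show ?thesis .
    qed
    hence b: "(\<integral>\<^sup>+s. ennreal (cmod (?X s)) \<partial>gauss) \<le> ennreal (osc_norm p h * (r * C2))"
      by (intro order_trans[OF nn_integral_mono Xb] ennreal_leI)
    have nn: "0 \<le> osc_norm p h * (r * C2)" using r C2 osc_norm_nonneg by auto
    have iX: "integrable gauss (\<lambda>s. w s * ?X s)"
      by (rule gint_dominated(1)[OF _ _ wK K nn b]) auto
    have leX: "cmod (gint w ?X) \<le> K * (osc_norm p h * (r * C2))"
      by (rule gint_dominated(2)[OF _ _ wK K nn b]) auto
    have b0: "(\<integral>\<^sup>+s. ennreal (cmod (exp (?v s))) \<partial>gauss) \<le> ennreal C0"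
      using q by (intro order_trans[OF _ expint[OF u, of 1]] nn_integral_mono ennreal_leI) (auto simp: complex_Re_le_cmod)
    have i0: "integrable gauss (\<lambda>s. w s * exp (?v s))"
      by (rule gint_dominated(1)[OF _ _ wK K _ b0]) (use C0(1) in auto)
    have b1: "(\<integral>\<^sup>+s. ennreal (cmod (?h s * exp (?v s))) \<partial>gauss) \<le> ennreal (osc_norm p h * C2)"
      by (rule order_trans[OF nn_integral_mono Xbound[OF u h]]) (auto simp: norm_mult complex_Re_le_cmod intro!: ennreal_leI mult_left_mono)
    have i1: "integrable gauss (\<lambda>s. w s * (?h s * exp (?v s)))"
      by (rule gint_dominated(1)[OF _ _ wK K _ b1]) (use C2 osc_norm_nonneg in auto)
    have "w s * exp (?v s + ?h s) = w s * ?X s + w s * exp (?v s) + w s * (?h s * exp (?v s))" for s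
      by (simp add: exp_add algebra_simps)
    hence "gint w (\<lambda>s. exp (?v s + ?h s)) = gint w ?X + gint w (\<lambda>s. exp (?v s)) + gint w (\<lambda>s. ?h s * exp (?v s))"
      unfolding gint_def using iX i0 i1 by simp
    hence "cmod (gint w (\<lambda>s. exp (?v s + ?h s)) - gint w (\<lambda>s. exp (?v s)) - gint w (\<lambda>s. ?h s * exp (?v s))) = cmod (gint w ?X)"
      by simp
    also have "\<dots> \<le> C * r * osc_norm p h"
    proof -
      have "0 \<le> r * osc_norm p h" using r osc_norm_nonneg by simp
      from mult_right_mono[OF Cge(3) this] leX show ?thesis by (simp add: mult_ac)
    qed
    finally show ?thesis .
  qed
  show ?thesis
    unfolding perturbation_const_def using Cge(1) bound0 bound1 bound2 by blast
qed

section \<open>The kernels\<close>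

lemma phi_deriv: "(phi has_real_derivative (-2 * x * phi x)) (at x)"
  unfolding phi_def[abs_def] by (auto intro!: derivative_eq_intros simp: field_simps)

lemma deriv_phi: "deriv phi = (\<lambda>x. -2 * x * phi x)"
  using phi_deriv by (auto intro: DERIV_imp_deriv)

lemma deriv_deriv_phi: "deriv (deriv phi) x = (4 * x\<^sup>2 - 2) * phi x"
proof -
  have "((\<lambda>x. -2 * x * phi x) has_real_derivative ((4 * x\<^sup>2 - 2) * phi x)) (at x)"
    by (rule derivative_eq_intros phi_deriv refl)+ (simp add: algebra_simps power2_eq_square)
  thus ?thesis unfolding deriv_phi by (rule DERIV_imp_deriv)
qed

lemma alpha_eq: "alpha x = complex_of_real (phi x) * Complex (1/2 - x\<^sup>2) (- 3/2 * x)"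
  unfolding alpha_def deriv_deriv_phi unfolding deriv_phi
  by (simp add: complex_eq_iff algebra_simps)

lemma beta_eq: "beta x = complex_of_real (phi x) * Complex (1/2 + x\<^sup>2) (- 1/2 * x)"
  unfolding beta_def deriv_deriv_phi unfolding deriv_phi
  by (simp add: complex_eq_iff algebra_simps)

text \<open>The density of \<open>phi\<close> relative to the standard Gaussian. Its remaining decay
  exp (-x^2/2) keeps the kernels below bounded.\<close>

definition gauss_ratio :: "real \<Rightarrow> real" where
  "gauss_ratio x = sqrt 2 * exp (- x\<^sup>2 / 2)"

lemma phi_eq: "phi x = std_normal_density x * gauss_ratio x"
  by (simp add: phi_def std_normal_density_def gauss_ratio_def real_sqrt_mult exp_add[symmetric])

lemma gauss_ratio_measurable[measurable]: "gauss_ratio \<in> borel_measurable borel"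
  unfolding gauss_ratio_def by measurable

lemma gauss_ratio_nonneg: "0 \<le> gauss_ratio x"
  by (simp add: gauss_ratio_def)

definition kernel_alpha :: "real \<Rightarrow> complex" where
  "kernel_alpha x = complex_of_real (gauss_ratio x) * Complex (1/2 - x\<^sup>2) (- 3/2 * x)"

definition kernel_beta :: "real \<Rightarrow> complex" where
  "kernel_beta x = complex_of_real (gauss_ratio x) * Complex (1/2 + x\<^sup>2) (- 1/2 * x)"

lemma Complex_measurable[measurable]:
  assumes [measurable]: "f \<in> borel_measurable M" "g \<in> borel_measurable M"
  shows "(\<lambda>x. Complex (f x) (g x)) \<in> borel_measurable M"
  unfolding Complex_eq by measurable

lemma kernel_measurable[measurable]:
  "kernel_alpha \<in> borel_measurable borel" "kernel_beta \<in> borel_measurable borel"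
  unfolding kernel_alpha_def kernel_beta_def by measurable

lemma gauss_ratio_bound: "gauss_ratio x * (2 + 2 * x\<^sup>2) \<le> 12"
proof -
  have "x\<^sup>2 / 2 \<le> exp (x\<^sup>2 / 2)" "1 \<le> exp (x\<^sup>2 / 2)" using exp_ge_add_one_self[of "x\<^sup>2/2"] by (linarith, simp)
  hence "2 + 2 * x\<^sup>2 \<le> 6 * exp (x\<^sup>2 / 2)" by linarith
  hence "exp (- x\<^sup>2 / 2) * (2 + 2 * x\<^sup>2) \<le> 6" by (simp add: exp_minus field_simps)
  moreover have "sqrt 2 \<le> 2" by (rule real_le_lsqrt) auto
  ultimately have "sqrt 2 * (exp (- x\<^sup>2 / 2) * (2 + 2 * x\<^sup>2)) \<le> 2 * 6"
    by (intro mult_mono) auto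
  thus ?thesis by (simp add: gauss_ratio_def mult.assoc)
qed

lemma kernel_bound: "cmod (kernel_alpha x) \<le> 12" "cmod (kernel_beta x) \<le> 12"
proof -
  have x: "\<bar>x\<bar> \<le> (1 + x\<^sup>2) / 2" using zero_le_power2[of "\<bar>x\<bar> - 1"] by (simp add: power2_diff)
  have "\<bar>1/2 - x\<^sup>2\<bar> \<le> 1/2 + x\<^sup>2" "\<bar>1/2 + x\<^sup>2\<bar> = 1/2 + x\<^sup>2" by (auto simp: abs_le_iff)
  note x = x this
  have "cmod (Complex (1/2 - x\<^sup>2) (- 3/2 * x)) \<le> 2 + 2 * x\<^sup>2"
    using cmod_le[of "Complex (1/2 - x\<^sup>2) (- 3/2 * x)"] x by (simp add: abs_mult field_simps)
  moreover have "cmod (Complex (1/2 + x\<^sup>2) (- 1/2 * x)) \<le> 2 + 2 * x\<^sup>2"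
    using cmod_le[of "Complex (1/2 + x\<^sup>2) (- 1/2 * x)"] x by (simp add: abs_mult field_simps)
  ultimately show "cmod (kernel_alpha x) \<le> 12" "cmod (kernel_beta x) \<le> 12"
    unfolding kernel_alpha_def kernel_beta_def norm_mult
    by (auto simp: gauss_ratio_nonneg intro!: order_trans[OF mult_left_mono gauss_ratio_bound])
qed

lemma integral_gauss:
  fixes f :: "real \<Rightarrow> complex"
  assumes "f \<in> borel_measurable borel"
  shows "(\<integral>s. f s \<partial>gauss) = (\<integral>s. std_normal_density s * f s \<partial>lborel)"
  using assms by (subst integral_density) (auto simp: scaleR_conv_of_real)

text \<open>Substitution t = x - y s; the Jacobian y cancels the normalisation 1 / y of
  \<open>scaled\<close>.\<close>

lemma conv_scaled_eq_gint:
  fixes f w k :: "real \<Rightarrow> complex"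
  assumes y: "0 < y" and [measurable]: "f \<in> borel_measurable borel" "w \<in> borel_measurable borel"
    and k: "\<And>s. k s = std_normal_density s * w s"
  shows "conv (scaled y k) f x = gint w (\<lambda>s. f (x - y * s))"
proof -
  have "conv (scaled y k) f x = (\<integral>t. k ((x - t) / y) / y * f t \<partial>lborel)"
    by (simp add: conv_def scaled_def)
  also have "\<dots> = \<bar>- y\<bar> *\<^sub>R (\<integral>s. k ((x - (x + (- y) * s)) / y) / y * f (x + (- y) * s) \<partial>lborel)"
    using y by (intro lborel_integral_real_affine) auto
  also have "\<dots> = (\<integral>s. std_normal_density s * (w s * f (x - y * s)) \<partial>lborel)"
    unfolding integral_scaleR_right[symmetric] using y
    by (intro Bochner_Integration.integral_cong refl) (simp add: k scaleR_conv_of_real)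
  also have "\<dots> = gint w (\<lambda>s. f (x - y * s))"
    unfolding gint_def by (rule integral_gauss[symmetric]) measurable
  finally show ?thesis .
qed

lemma alpha_kernel: "alpha s = std_normal_density s * kernel_alpha s"
  and beta_kernel: "beta s = std_normal_density s * kernel_beta s"
  by (simp_all add: alpha_eq beta_eq phi_eq kernel_alpha_def kernel_beta_def mult.assoc)

lemma Lambda_eq_gint:
  assumes "u \<in> borel_measurable borel"
  shows "Lambda u (x, y) = (if 0 < y then gint kernel_alpha (\<lambda>s. exp (u (x - y * s))) / gint kernel_beta (\<lambda>s. exp (u (x - y * s))) else 0)"
  using assms by (auto simp: Lambda_def Let_def conv_scaled_eq_gint[OF _ _ _ alpha_kernel] conv_scaled_eq_gint[OF _ _ _ beta_kernel])


lemma phi_density: "phi x = normal_density 0 (1 / sqrt 2) x"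
  by (simp add: phi_def normal_density_def power_divide)

lemma phi_integrals:
  "has_bochner_integral lborel phi 1"
  "has_bochner_integral lborel (\<lambda>x. phi x * x) 0"
  "has_bochner_integral lborel (\<lambda>x. phi x * x\<^sup>2) (1/2)"
  "has_bochner_integral lborel (\<lambda>x. phi x * \<bar>x\<bar>) (1 / sqrt pi)"
proof -
  have s: "0 < 1 / sqrt (2::real)" by simp
  show "has_bochner_integral lborel phi 1"
    unfolding phi_density[abs_def] using integrable_normal_density[OF s] integral_normal_density[OF s]
    by (simp add: has_bochner_integral_iff)
  show "has_bochner_integral lborel (\<lambda>x. phi x * x) 0"
    using normal_moment_odd[OF s, of 0 0] by (simp add: phi_density)
  show "has_bochner_integral lborel (\<lambda>x. phi x * x\<^sup>2) (1/2)"
    using normal_moment_even[OF s, of 0 1] by (simp add: phi_density power2_eq_square numeral_2_eq_2 field_simps)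
  show "has_bochner_integral lborel (\<lambda>x. phi x * \<bar>x\<bar>) (1 / sqrt pi)"
    using normal_moment_abs_odd[OF s, of 0 0] by (simp add: phi_density real_sqrt_divide)
qed

text \<open>\<open>alpha\<close> combines only derivatives of \<open>phi\<close>, so its integral
  vanishes; here it is read off from the moments 1, 0, 1/2 of \<open>phi\<close>. This is the
  cancellation that makes \<open>Lambda u\<close> small where u oscillates little.\<close>

lemma integral_kernel_alpha: "(\<integral>s. kernel_alpha s \<partial>gauss) = 0"
proof -
  have "has_bochner_integral lborel (\<lambda>x. complex_of_real (phi x * (1/2) - phi x * x\<^sup>2)) (of_real (1 * (1/2) - 1/2))"
    by (intro has_bochner_integral_of_real has_bochner_integral_diff has_bochner_integral_mult_left phi_integrals)
  moreover have "has_bochner_integral lborel (\<lambda>x. \<i> * complex_of_real (phi x * x * (-3/2))) (\<i> * of_real (0 * (-3/2)))"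
    by (intro has_bochner_integral_mult_right has_bochner_integral_of_real has_bochner_integral_mult_left phi_integrals)
  ultimately have "has_bochner_integral lborel (\<lambda>x. complex_of_real (phi x * (1/2) - phi x * x\<^sup>2) + \<i> * complex_of_real (phi x * x * (-3/2)))
     (of_real (1 * (1/2) - 1/2) + \<i> * of_real (0 * (-3/2)))"
    by (rule has_bochner_integral_add)
  also have "(\<lambda>x. complex_of_real (phi x * (1/2) - phi x * x\<^sup>2) + \<i> * complex_of_real (phi x * x * (-3/2))) = alpha"
    by (auto simp: alpha_eq complex_eq_iff algebra_simps)
  finally show ?thesis
    by (simp add: integral_gauss alpha_kernel[symmetric] has_bochner_integral_iff)
qed

text \<open>
  \<open>|B|\<^sup>2 - |A|\<^sup>2 = 2 (W 0 W 2 - (W 1)\<^sup>2)\<close> for the moments \<open>W j\<close> of \<open>phi exp v\<close>. Both \<open>W 0\<close> and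
  the variance are bounded below by \<open>2 t a \<le> a\<^sup>2 exp v + t\<^sup>2 exp (- v)\<close>, applied with \<open>a = 1\<close> and
  \<open>a = |s - m|\<close>.
\<close>

lemma real_exponent_ellipticity:
  fixes v :: "real \<Rightarrow> real"
  assumes [measurable]: "v \<in> borel_measurable borel"
    and C: "(\<integral>\<^sup>+s. ennreal (exp \<bar>v s\<bar>) \<partial>gauss) \<le> ennreal C" "1 \<le> C"
  defines "A \<equiv> gint kernel_alpha (\<lambda>s. exp (complex_of_real (v s)))" and "B \<equiv> gint kernel_beta (\<lambda>s. exp (complex_of_real (v s)))"
  shows "(cmod A)\<^sup>2 + 1 / (16 * C\<^sup>2) \<le> (cmod B)\<^sup>2"
proof -
  let ?r = gauss_ratio
  have ebound: "(\<integral>\<^sup>+s. ennreal (cmod (exp (complex_of_real (c * v s)))) \<partial>gauss) \<le> ennreal C" if "\<bar>c\<bar> \<le> 1" for c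
  proof (rule order_trans[OF nn_integral_mono C(1)], intro ennreal_leI)
    fix s
    have "c * v s \<le> \<bar>c\<bar> * \<bar>v s\<bar>" by (metis abs_ge_self abs_mult)
    also have "\<dots> \<le> \<bar>v s\<bar>" using that by (simp add: mult_left_le_one_le)
    finally show "cmod (exp (complex_of_real (c * v s))) \<le> exp \<bar>v s\<bar>" by simp
  qed
  have le12: "\<bar>?r s * s ^ j\<bar> \<le> 12" if "j \<le> 2" for s j
  proof -
    have x: "\<bar>s\<bar> \<le> (1 + s\<^sup>2) / 2" using zero_le_power2[of "\<bar>s\<bar> - 1"] by (simp add: power2_diff)
    have "\<bar>s ^ j\<bar> \<le> 2 + 2 * s\<^sup>2"
      using that x zero_le_power2[of s] by (cases "j = 0 \<or> j = 1") (auto simp: le_Suc_eq numeral_2_eq_2)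
    hence "?r s * \<bar>s ^ j\<bar> \<le> 12"
      by (intro order_trans[OF mult_left_mono gauss_ratio_bound] gauss_ratio_nonneg)
    thus ?thesis by (simp add: abs_mult gauss_ratio_nonneg)
  qed
  have int: "integrable gauss (\<lambda>s. ?r s * s ^ j * exp (c * v s))" if "\<bar>c\<bar> \<le> 1" "j \<le> 2" for c j
  proof -
    have "integrable gauss (\<lambda>s. complex_of_real (?r s * s ^ j) * exp (complex_of_real (c * v s)))"
      by (rule gint_dominated(1)[of _ _ 12, OF _ _ _ _ _ ebound[OF that(1)]])
         (use le12[OF that(2)] C(2) in \<open>auto simp del: of_real_mult of_real_power of_real_exp\<close>)
    hence "integrable gauss (\<lambda>s. Re (complex_of_real (?r s * s ^ j) * exp (complex_of_real (c * v s))))"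
      by (rule integrable_Re)
    thus ?thesis by (simp only: exp_of_real of_real_mult[symmetric] Re_complex_of_real)
  qed
  define W where "W j = (\<integral>s. ?r s * s ^ j * exp (v s) \<partial>gauss)" for j :: nat
  define V where "V = (\<integral>s. ?r s * exp (- v s) \<partial>gauss)"
  have i: "integrable gauss (\<lambda>s. ?r s * s ^ j * exp (v s))" if "j \<le> 2" for j
    using int[of 1 j] that by simp
  have iV: "integrable gauss (\<lambda>s. ?r s * exp (- v s))" using int[of "-1" 0] by simp
  have i012: "integrable gauss (\<lambda>s. ?r s * exp (v s))" "integrable gauss (\<lambda>s. ?r s * s * exp (v s))"
     "integrable gauss (\<lambda>s. ?r s * s\<^sup>2 * exp (v s))"
    using i[of 0] i[of 1] i[of 2] by simp_all
  have A: "A = Complex (W 0 / 2 - W 2) (- 3/2 * W 1)"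
  proof -
    have "A = (\<integral>s. complex_of_real (?r s * exp (v s) / 2 - ?r s * s\<^sup>2 * exp (v s)) + \<i> * complex_of_real (- 3/2 * (?r s * s * exp (v s))) \<partial>gauss)"
      unfolding A_def gint_def
      by (intro Bochner_Integration.integral_cong) (auto simp: kernel_alpha_def complex_eq_iff exp_of_real algebra_simps)
    also have "\<dots> = of_real (W 0 / 2 - W 2) + \<i> * of_real (- 3/2 * W 1)"
      unfolding W_def using i012
      by (subst Bochner_Integration.integral_add)
         (auto simp: integral_complex_of_real simp del: of_real_add of_real_diff of_real_mult of_real_divide)
    finally show ?thesis by (simp add: complex_eq_iff)
  qed
  have B: "B = Complex (W 0 / 2 + W 2) (- 1/2 * W 1)"
  proof -
    have "B = (\<integral>s. complex_of_real (?r s * exp (v s) / 2 + ?r s * s\<^sup>2 * exp (v s)) + \<i> * complex_of_real (- 1/2 * (?r s * s * exp (v s))) \<partial>gauss)"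
      unfolding B_def gint_def
      by (intro Bochner_Integration.integral_cong) (auto simp: kernel_beta_def complex_eq_iff exp_of_real algebra_simps)
    also have "\<dots> = of_real (W 0 / 2 + W 2) + \<i> * of_real (- 1/2 * W 1)"
      unfolding W_def using i012
      by (subst Bochner_Integration.integral_add)
         (auto simp: integral_complex_of_real simp del: of_real_add of_real_diff of_real_mult of_real_divide)
    finally show ?thesis by (simp add: complex_eq_iff)
  qed
  have diff: "(cmod B)\<^sup>2 - (cmod A)\<^sup>2 = 2 * (W 0 * W 2 - (W 1)\<^sup>2)"
    unfolding A B cmod_power2 by (simp add: power2_eq_square algebra_simps)
  have phi_gauss: "(\<integral>s. ?r s * f s \<partial>gauss) = (\<integral>s. phi s * f s \<partial>lborel)" if [measurable]: "f \<in> borel_measurable borel" for f :: "real \<Rightarrow> real"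
    by (subst integral_density) (auto simp: phi_eq mult_ac)
  have mom: "integrable gauss (\<lambda>s. ?r s * f s) \<and> (\<integral>s. ?r s * f s \<partial>gauss) = c"
    if "has_bochner_integral lborel (\<lambda>s. phi s * f s) c" and [measurable]: "f \<in> borel_measurable borel" for f :: "real \<Rightarrow> real" and c
  proof -
    have "integrable gauss (\<lambda>s. ?r s * f s)"
      using that(1) by (subst integrable_density) (auto simp: has_bochner_integral_iff phi_eq mult_ac)
    thus ?thesis using that(1) phi_gauss[OF that(2)] by (simp add: has_bochner_integral_iff)
  qed
  have m0: "integrable gauss ?r" "(\<integral>s. ?r s \<partial>gauss) = 1"
    using mom[of "\<lambda>_. 1" 1] phi_integrals(1) by auto
  have msgn: "has_bochner_integral lborel (\<lambda>s. phi s * sgn s) 0"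
  proof -
    have ph: "phi (- s) = phi s" for s by (simp add: phi_def)
    have "integrable lborel (\<lambda>s. phi s * sgn s)"
      by (rule Bochner_Integration.integrable_bound[of _ phi])
         (use phi_integrals(1) in \<open>auto simp: has_bochner_integral_iff abs_mult sgn_if phi_def\<close>)
    moreover have "(\<integral>s. phi s * sgn s \<partial>lborel) = \<bar>-1\<bar> *\<^sub>R (\<integral>s. phi (0 + (-1) * s) * sgn (0 + (-1) * s) \<partial>lborel)"
      by (rule lborel_integral_real_affine) auto
    ultimately show ?thesis by (simp add: has_bochner_integral_iff ph sgn_minus)
  qed
  have msg: "integrable gauss (\<lambda>s. ?r s * sgn s)" "(\<integral>s. ?r s * sgn s \<partial>gauss) = 0"
    using mom[OF msgn] by auto
  have mabs: "integrable gauss (\<lambda>s. ?r s * \<bar>s\<bar>)" "(\<integral>s. ?r s * \<bar>s\<bar> \<partial>gauss) = 1 / sqrt pi"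
    using mom[OF phi_integrals(4)] by auto
  have VC: "V \<le> 2 * C"
  proof -
    have ie: "integrable gauss (\<lambda>s. exp (- v s))"
    proof (rule integrableI_bounded)
      have "(\<integral>\<^sup>+s. ennreal (norm (exp (- v s))) \<partial>gauss) \<le> ennreal C" using ebound[of "-1"] by simp
      thus "(\<integral>\<^sup>+s. ennreal (norm (exp (- v s))) \<partial>gauss) < \<infinity>" by (rule order.strict_trans1) simp
    qed simp
    have "?r s \<le> 2" for s
    proof -
      have "sqrt 2 * exp (- s\<^sup>2 / 2) \<le> 2 * 1" by (intro mult_mono real_le_lsqrt) auto
      thus ?thesis by (simp add: gauss_ratio_def)
    qed
    hence "V \<le> (\<integral>s. 2 * exp (- v s) \<partial>gauss)"
      unfolding V_def using iV ie by (intro integral_mono) auto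
    also have "\<dots> = 2 * (\<integral>s. exp (- v s) \<partial>gauss)" by simp
    also have "(\<integral>s. exp (- v s) \<partial>gauss) \<le> C"
    proof -
      have "ennreal (\<integral>s. exp (- v s) \<partial>gauss) = (\<integral>\<^sup>+s. ennreal (exp (- v s)) \<partial>gauss)"
        using ie by (subst nn_integral_eq_integral) auto
      also have "\<dots> \<le> ennreal C" using ebound[of "-1"] by simp
      finally show ?thesis using C(2) by simp
    qed
    finally show ?thesis by simp
  qed
  have amgm: "2 * t * a \<le> a\<^sup>2 * e + t\<^sup>2 / e" if "0 < e" for t a e :: real
  proof -
    have "0 \<le> (a * e - t)\<^sup>2" by simp
    thus ?thesis using that by (simp add: field_simps power2_eq_square)
  qed
  have W0: "2 * t - t\<^sup>2 * V \<le> W 0" for t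
  proof -
    have "(\<integral>s. 2 * t * ?r s \<partial>gauss) \<le> (\<integral>s. ?r s * exp (v s) + t\<^sup>2 * (?r s * exp (- v s)) \<partial>gauss)"
    proof (rule integral_mono)
      fix s
      have "?r s * (2 * t) \<le> ?r s * (exp (v s) + t\<^sup>2 * exp (- v s))"
        using amgm[of "exp (v s)" t 1] by (intro mult_left_mono gauss_ratio_nonneg) (simp add: exp_minus divide_inverse)
      thus "2 * t * ?r s \<le> ?r s * exp (v s) + t\<^sup>2 * (?r s * exp (- v s))" by (simp add: algebra_simps)
    qed (use i012 iV m0 in auto)
    thus ?thesis using i012 iV m0 by (simp add: W_def V_def)
  qed
  \<comment> \<open>From |s - m| >= |s| - m sgn s: the odd \<open>sgn\<close> term integrates to
    zero against the even weight, so the lower bound is the same for every m.\<close>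
  have W2: "2 * t * (1 / sqrt pi) - t\<^sup>2 * V \<le> W 2 - 2 * m * W 1 + m\<^sup>2 * W 0" if t: "0 \<le> t" for t m
  proof -
    have "(\<integral>s. 2 * t * (?r s * \<bar>s\<bar>) - 2 * t * m * (?r s * sgn s) \<partial>gauss) \<le>
       (\<integral>s. ?r s * s\<^sup>2 * exp (v s) - 2 * m * (?r s * s * exp (v s)) + m\<^sup>2 * (?r s * exp (v s)) + t\<^sup>2 * (?r s * exp (- v s)) \<partial>gauss)"
    proof (rule integral_mono)
      fix s
      have "2 * t * (\<bar>s\<bar> - m * sgn s) \<le> 2 * t * \<bar>s - m\<bar>"
        using t by (intro mult_left_mono) (auto simp: sgn_if)
      also have "\<dots> \<le> (s - m)\<^sup>2 * exp (v s) + t\<^sup>2 * exp (- v s)"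
        using amgm[of "exp (v s)" t "\<bar>s - m\<bar>"] by (simp add: exp_minus divide_inverse)
      finally have "?r s * (2 * t * (\<bar>s\<bar> - m * sgn s)) \<le> ?r s * ((s - m)\<^sup>2 * exp (v s) + t\<^sup>2 * exp (- v s))"
        by (intro mult_left_mono gauss_ratio_nonneg)
      thus "2 * t * (?r s * \<bar>s\<bar>) - 2 * t * m * (?r s * sgn s) \<le>
         ?r s * s\<^sup>2 * exp (v s) - 2 * m * (?r s * s * exp (v s)) + m\<^sup>2 * (?r s * exp (v s)) + t\<^sup>2 * (?r s * exp (- v s))"
        by (simp add: power2_diff algebra_simps)
    qed (use i012 iV msg mabs in auto)
    thus ?thesis using i012 iV msg mabs by (simp add: W_def V_def)
  qed
  \<comment> \<open>The factor 2 bounds \<open>gauss_ratio\<close>, which turns the hypothesis into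
    a bound for V.\<close>
  define C' where "C' = 2 * C"
  have C': "V \<le> C'" "1 \<le> C'" using VC C(2) by (auto simp: C'_def)
  have W0b: "1 / C' \<le> W 0"
  proof -
    have "(1 / C')\<^sup>2 * V \<le> (1 / C')\<^sup>2 * C'" using C' by (intro mult_left_mono) auto
    also have "\<dots> = 1 / C'" by (simp add: power2_eq_square)
    finally show ?thesis using W0[of "1 / C'"] by simp
  qed
  \<comment> \<open>The mean of the weighted measure; for this m the second moment about m, times
    \<open>W 0\<close>, is exactly \<open>W 0 * W 2 - (W 1)\<^sup>2\<close>.\<close>
  define m where "m = W 1 / W 0"
  have W0p: "0 < W 0" using W0b C' by (smt (verit) divide_pos_pos)
  have var: "1 / (pi * C') \<le> W 2 - 2 * m * W 1 + m\<^sup>2 * W 0"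
  proof -
    \<comment> \<open>The maximiser of 2 t / sqrt pi - t^2 C', with maximum 1 / (pi C').\<close>
    define t where "t = 1 / (sqrt pi * C')"
    have t: "0 \<le> t" using C' by (simp add: t_def)
    have "t\<^sup>2 * V \<le> t\<^sup>2 * C'" using C' by (intro mult_left_mono) auto
    also have "t\<^sup>2 * C' = 1 / (pi * C')" by (simp add: t_def power_divide power_mult_distrib power2_eq_square[of C'])
    finally have "2 * t * (1 / sqrt pi) - 1 / (pi * C') \<le> W 2 - 2 * m * W 1 + m\<^sup>2 * W 0"
      using W2[OF t, of m] by linarith
    moreover have "2 * t * (1 / sqrt pi) = 2 * (1 / (pi * C'))"
      by (simp add: t_def)
    ultimately show ?thesis by linarith
  qed
  have "1 / C' * (1 / (pi * C')) \<le> W 0 * (W 2 - 2 * m * W 1 + m\<^sup>2 * W 0)"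
    using W0b W0p var C' by (intro mult_mono) auto
  also have "\<dots> = W 0 * W 2 - (W 1)\<^sup>2"
    using W0p by (simp add: m_def field_simps power2_eq_square)
  also have "1 / C' * (1 / (pi * C')) = 1 / (pi * C'\<^sup>2)" by (simp add: power2_eq_square)
  finally have "2 * (1 / (pi * C'\<^sup>2)) \<le> (cmod B)\<^sup>2 - (cmod A)\<^sup>2"
    unfolding diff by simp
  moreover have "1 / (16 * C\<^sup>2) \<le> 2 * (1 / (pi * C'\<^sup>2))"
    using pi_less_4 C(2) by (simp add: C'_def power_mult_distrib divide_simps)
  ultimately show ?thesis by simp
qed

section \<open>Pointwise estimates in the half plane\<close>

definition zoom :: "real \<Rightarrow> real \<Rightarrow> (real \<Rightarrow> complex) \<Rightarrow> real \<Rightarrow> complex" where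
  "zoom x y u = (\<lambda>s. u (x - y * s))"

lemma zoom_measurable[measurable]:
  assumes [measurable]: "u \<in> borel_measurable borel"
  shows "zoom x y u \<in> borel_measurable borel"
  unfolding zoom_def by measurable

lemma Bp_energy_zoom: "u \<in> borel_measurable borel \<Longrightarrow> y > 0 \<Longrightarrow> Bp_energy p (zoom x y u) = Bp_energy p u"
  using Bp_energy_affine[of u "- y" p x] by (simp add: zoom_def)

lemma Bp_space_zoom: "u \<in> Bp_space p \<Longrightarrow> y > 0 \<Longrightarrow> zoom x y u \<in> Bp_space p"
  using Bp_energy_zoom[of u y p x] by (auto simp: Bp_space_iff)

lemma Bp_norm_zoom: "u \<in> Bp_space p \<Longrightarrow> y > 0 \<Longrightarrow> Bp_norm p (zoom x y u) = Bp_norm p u"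
  by (simp add: Bp_norm_def Bp_energy_zoom Bp_space_iff)

lemma centered_add:
  assumes "integrable gauss u" "integrable gauss h"
  shows "centered (\<lambda>s. u s + h s) = (\<lambda>s. centered u s + centered h s)"
  using assms by (auto simp: centered_def)

text \<open>Subtracting the mean of u only produces a common factor, and the mean d of h adds d
  times the undifferentiated integral. Both effects cancel in quotients, which is why estimates may
  be made for centered functions.\<close>

lemma gint_uncenter:
  assumes p: "1 < p" and u: "u \<in> Bp_space p" and h: "h \<in> Bp_space p"
    and w[measurable]: "w \<in> borel_measurable borel" and wK: "\<And>s. cmod (w s) \<le> K"
  shows "gint w (\<lambda>s. exp (u s)) = exp (\<integral>t. u t \<partial>gauss) * gint w (\<lambda>s. exp (centered u s))"
    and "integrable gauss (\<lambda>s. w s * (h s * exp (u s)))"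
    and "gint w (\<lambda>s. h s * exp (u s)) = exp (\<integral>t. u t \<partial>gauss) *
      (gint w (\<lambda>s. centered h s * exp (centered u s)) + (\<integral>t. h t \<partial>gauss) * gint w (\<lambda>s. exp (centered u s)))"
proof -
  have K: "0 \<le> K" using wK[of 0] norm_ge_zero order_trans by blast
  let ?c = "\<integral>t. u t \<partial>gauss" and ?d = "\<integral>t. h t \<partial>gauss"
  have eu: "exp (u s) = exp ?c * exp (centered u s)" for s by (simp add: centered_def flip: exp_add)
  have eh: "h s = centered h s + ?d" for s by (simp add: centered_def)
  \<comment> \<open>With R equal to the energy of u itself, the uniform bounds supply the
    integrability claims.\<close>
  have E: "Bp_energy p u \<le> ennreal (enn2real (Bp_energy p u))" using u by (simp add: Bp_space_iff less_top)
  have C: "integrable gauss (\<lambda>s. w s * exp (centered u s))"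
     "integrable gauss (\<lambda>s. w s * (centered h s * exp (centered u s)))"
    using perturbation_bounds[OF p enn2real_nonneg K] perturbation_constD(1,4)[OF _ u E w wK] h by blast+
  show "gint w (\<lambda>s. exp (u s)) = exp ?c * gint w (\<lambda>s. exp (centered u s))"
    unfolding gint_def by (simp add: eu mult.left_commute[of _ "exp ?c"])
  have eq: "w s * (h s * exp (u s)) = exp ?c * (w s * (centered h s * exp (centered u s)) + ?d * (w s * exp (centered u s)))" for s
    by (subst eh, subst eu) (simp add: algebra_simps)
  show "integrable gauss (\<lambda>s. w s * (h s * exp (u s)))"
    unfolding eq using C by simp
  show "gint w (\<lambda>s. h s * exp (u s)) = exp ?c *
      (gint w (\<lambda>s. centered h s * exp (centered u s)) + ?d * gint w (\<lambda>s. exp (centered u s)))"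
    unfolding gint_def eq using C by simp
qed

abbreviation num :: "(real \<Rightarrow> complex) \<Rightarrow> complex" where
  "num v \<equiv> gint kernel_alpha (\<lambda>s. exp (v s))"

abbreviation den :: "(real \<Rightarrow> complex) \<Rightarrow> complex" where
  "den v \<equiv> gint kernel_beta (\<lambda>s. exp (v s))"

abbreviation dnum :: "(real \<Rightarrow> complex) \<Rightarrow> (real \<Rightarrow> complex) \<Rightarrow> complex" where
  "dnum v h \<equiv> gint kernel_alpha (\<lambda>s. h s * exp (v s))"

abbreviation dden :: "(real \<Rightarrow> complex) \<Rightarrow> (real \<Rightarrow> complex) \<Rightarrow> complex" where
  "dden v h \<equiv> gint kernel_beta (\<lambda>s. h s * exp (v s))"

lemma Lambda_centered:
  assumes p: "1 < p" and u: "u \<in> Bp_space p" and y: "0 < y"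
  shows "Lambda u (x, y) = num (centered (zoom x y u)) / den (centered (zoom x y u))"
proof -
  have "Lambda u (x, y) = num (zoom x y u) / den (zoom x y u)"
    using u y by (simp add: Lambda_eq_gint Bp_space_iff zoom_def)
  also have "\<dots> = num (centered (zoom x y u)) / den (centered (zoom x y u))"
    by (subst (1 2) gint_uncenter(1)[OF p Bp_space_zoom[OF u y] Bp_space_zoom[OF u y]]) (auto intro: kernel_bound)
  finally show ?thesis .
qed

text \<open>The quotient rule for \<open>num / den\<close>, taken with the uncentered profiles so
  that linearity in h is linearity of the integral. The value 0 off the half plane matches
  \<open>Lambda\<close>.\<close>

definition dLambda :: "(real \<Rightarrow> complex) \<Rightarrow> (real \<Rightarrow> complex) \<Rightarrow> real \<times> real \<Rightarrow> complex" where
  "dLambda u h z = (if 0 < snd z then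
     (let v = zoom (fst z) (snd z) u; k = zoom (fst z) (snd z) h in
        (dnum v k * den v - num v * dden v k) / (den v)\<^sup>2) else 0)"

text \<open>The mean d of h contributes d (A B - A B) = 0 to the numerator, and the factor from the
  mean of u appears squared above and below.\<close>

lemma dLambda_centered:
  fixes x y :: real
  assumes p: "1 < p" and u: "u \<in> Bp_space p" and h: "h \<in> Bp_space p" and y: "0 < y"
  defines "v \<equiv> centered (zoom x y u)" and "k \<equiv> centered (zoom x y h)"
  shows "dLambda u h (x, y) = (dnum v k * den v - num v * dden v k) / (den v)\<^sup>2"
proof -
  let ?e = "exp (\<integral>t. zoom x y u t \<partial>gauss)" and ?d = "\<integral>t. zoom x y h t \<partial>gauss"
  note un = gint_uncenter[OF p Bp_space_zoom[OF u y, of x] Bp_space_zoom[OF h y, of x] kernel_measurable(1) kernel_bound(1), folded v_def k_def]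
    gint_uncenter[OF p Bp_space_zoom[OF u y, of x] Bp_space_zoom[OF h y, of x] kernel_measurable(2) kernel_bound(2), folded v_def k_def]
  have "dLambda u h (x, y) = (?e * (dnum v k + ?d * num v) * (?e * den v) - ?e * num v * (?e * (dden v k + ?d * den v))) / (?e * den v)\<^sup>2"
    using y by (simp add: dLambda_def Let_def un)
  also have "\<dots> = (?e\<^sup>2 * (dnum v k * den v - num v * dden v k)) / (?e\<^sup>2 * (den v)\<^sup>2)"
    by (simp add: algebra_simps power2_eq_square)
  also have "\<dots> = (dnum v k * den v - num v * dden v k) / (den v)\<^sup>2" by simp
  finally show ?thesis .
qed

lemma dLambda_lincomb:
  assumes p: "1 < p" and u: "u \<in> Bp_space p" and h: "h \<in> Bp_space p" and k: "k \<in> Bp_space p"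
  shows "dLambda u (\<lambda>t. a * h t + b * k t) = (\<lambda>z. a * dLambda u h z + b * dLambda u k z)"
proof
  fix z :: "real \<times> real"
  obtain x y where z: "z = (x, y)" by force
  show "dLambda u (\<lambda>t. a * h t + b * k t) z = a * dLambda u h z + b * dLambda u k z"
  proof (cases "0 < y")
    case True
    let ?v = "zoom x y u"
    have lin: "gint w (\<lambda>s. zoom x y (\<lambda>t. a * h t + b * k t) s * exp (?v s))
        = a * gint w (\<lambda>s. zoom x y h s * exp (?v s)) + b * gint w (\<lambda>s. zoom x y k s * exp (?v s))"
      if [measurable]: "w \<in> borel_measurable borel" and wK: "\<And>s. cmod (w s) \<le> 12" for w
    proof -
      note i = gint_uncenter(2)[OF p Bp_space_zoom[OF u True] Bp_space_zoom[OF _ True] that]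
      have "w s * (zoom x y (\<lambda>t. a * h t + b * k t) s * exp (?v s))
          = a * (w s * (zoom x y h s * exp (?v s))) + b * (w s * (zoom x y k s * exp (?v s)))" for s
        by (simp add: zoom_def algebra_simps)
      thus ?thesis unfolding gint_def using i[OF h] i[OF k] by simp
    qed
    have field: "((a * h1 + b * k1) * B - A * (a * h2 + b * k2)) / B\<^sup>2 =
        a * ((h1 * B - A * h2) / B\<^sup>2) + b * ((k1 * B - A * k2) / B\<^sup>2)" for A B h1 h2 k1 k2 :: complex
      unfolding times_divide_eq_right add_divide_distrib[symmetric]
      by (rule arg_cong[where f="\<lambda>c. c / B\<^sup>2"]) (simp add: algebra_simps)
    show ?thesis using True
      by (simp only: z dLambda_def Let_def fst_conv snd_conv if_True
          lin[OF kernel_measurable(1) kernel_bound(1)] lin[OF kernel_measurable(2) kernel_bound(2)] field)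
  qed (simp add: z dLambda_def)
qed

lemma norm_mult_diff_le: "cmod (a * b - c * d) \<le> cmod a * cmod b + cmod c * cmod d"
  by (metis norm_mult norm_triangle_ineq4)

text \<open>The part of the estimate that is pure algebra: A1 and B1 are the first variations, n is
  the local oscillation of the increment and r its global size. The condition on 16 C r keeps B' at
  distance at least \<eta> / 2 from zero.\<close>

lemma quotient_remainder:
  fixes A B A1 B1 A' B' :: complex and C \<eta> n r :: real
  assumes \<eta>: "0 < \<eta>" "\<eta> \<le> cmod B" and C: "1 \<le> C" "cmod A \<le> C" "cmod B \<le> C"
    and one: "cmod A1 \<le> C * n" "cmod B1 \<le> C * n"
    and two: "cmod (A' - A - A1) \<le> C * r * n" "cmod (B' - B - B1) \<le> C * r * n"
    and n: "0 \<le> n" "n \<le> 4 * r" and r: "0 < r" "r \<le> 1" "16 * C * r \<le> \<eta>"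
  shows "cmod (A' - A) \<le> 8 * C * r" "cmod (B' - B) \<le> 8 * C * r" "\<eta> / 2 \<le> cmod B'"
    "cmod (A' / B' - A / B - (A1 * B - A * B1) / B\<^sup>2) \<le> (4 * C\<^sup>2 / \<eta>\<^sup>2 + 32 * C^3 / \<eta>^3) * r * n"
proof -
  have rn: "C * r * n \<le> C * n" using mult_left_mono[of r 1 "C * n"] C n r by (simp add: mult_ac)
  have Cn: "C * n \<le> C * (4 * r)" using C n by (intro mult_left_mono) auto
  have "cmod (A' - A) \<le> cmod (A' - A - A1) + cmod A1"
    using norm_triangle_ineq[of "A' - A - A1" A1] by simp
  thus a: "cmod (A' - A) \<le> 8 * C * r" using two one rn Cn by linarith
  have "cmod (B' - B) \<le> cmod (B' - B - B1) + cmod B1"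
    using norm_triangle_ineq[of "B' - B - B1" B1] by simp
  thus b: "cmod (B' - B) \<le> 8 * C * r" using two one rn Cn by linarith
  have "cmod B \<le> cmod B' + cmod (B' - B)"
    using norm_triangle_ineq2[of B B'] by (simp add: norm_minus_commute)
  thus B': "\<eta> / 2 \<le> cmod B'" using \<eta> b r by linarith
  have nz: "B \<noteq> 0" "B' \<noteq> 0" using \<eta> B' by auto
  let ?X = "(A' - A - A1) * B - A * (B' - B - B1)" and ?Y = "A1 * B - A * B1"
  \<comment> \<open>The first term collects the remainders of numerator and denominator; the second
    is the error made by replacing B' with B under the linear term ?Y.\<close>
  have eq: "A' / B' - A / B - ?Y / B\<^sup>2 = ?X / (B * B') - ?Y * (B' - B) / (B\<^sup>2 * B')"
    using nz by (simp add: divide_simps power2_eq_square) (simp add: algebra_simps)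
  have X: "cmod ?X \<le> 2 * C\<^sup>2 * r * n"
  proof -
    have "cmod ?X \<le> cmod (A' - A - A1) * cmod B + cmod A * cmod (B' - B - B1)"
      by (rule norm_mult_diff_le)
    also have "\<dots> \<le> (C * r * n) * C + C * (C * r * n)"
      using C two n r by (intro add_mono mult_mono) auto
    finally show ?thesis by (simp add: power2_eq_square algebra_simps)
  qed
  have Y: "cmod ?Y \<le> 2 * C\<^sup>2 * n"
  proof -
    have "cmod ?Y \<le> cmod A1 * cmod B + cmod A * cmod B1"
      by (rule norm_mult_diff_le)
    also have "\<dots> \<le> (C * n) * C + C * (C * n)"
      using C one n by (intro add_mono mult_mono) auto
    finally show ?thesis by (simp add: power2_eq_square algebra_simps)
  qed
  have "cmod (?X / (B * B')) \<le> (2 * C\<^sup>2 * r * n) / (\<eta> * (\<eta> / 2))"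
    unfolding norm_divide norm_mult using X \<eta> B' C n r by (intro frac_le mult_mono) auto
  moreover have "cmod (?Y * (B' - B) / (B\<^sup>2 * B')) \<le> ((2 * C\<^sup>2 * n) * (8 * C * r)) / (\<eta>\<^sup>2 * (\<eta> / 2))"
    unfolding norm_divide norm_mult norm_power using Y b \<eta> B' C n r
    by (intro frac_le mult_mono power_mono) auto
  ultimately have "cmod (A' / B' - A / B - ?Y / B\<^sup>2) \<le>
      (2 * C\<^sup>2 * r * n) / (\<eta> * (\<eta> / 2)) + ((2 * C\<^sup>2 * n) * (8 * C * r)) / (\<eta>\<^sup>2 * (\<eta> / 2))"
    unfolding eq using norm_triangle_ineq4 order_trans add_mono by meson
  also have "\<dots> = (4 * C\<^sup>2 / \<eta>\<^sup>2 + 32 * C^3 / \<eta>^3) * r * n"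
    by (simp add: field_simps power2_eq_square power3_eq_cube)
  finally show "cmod (A' / B' - A / B - ?Y / B\<^sup>2) \<le> (4 * C\<^sup>2 / \<eta>\<^sup>2 + 32 * C^3 / \<eta>^3) * r * n" .
qed

text \<open>Adding a constant to v rescales \<open>num v\<close> and \<open>den v\<close> alike, so
  only the first condition depends on it; it has a meaning uniform in (x, y) once v is
  centered.\<close>

definition elliptic :: "real \<Rightarrow> (real \<Rightarrow> complex) \<Rightarrow> bool" where
  "elliptic \<eta> v \<longleftrightarrow> \<eta> \<le> cmod (den v) \<and> cmod (num v) \<le> (1 - \<eta>) * cmod (den v)"

definition elliptic_domain :: "real \<Rightarrow> (real \<Rightarrow> complex) set" where
  "elliptic_domain p = {u \<in> Bp_space p. \<exists>\<eta>>0. \<forall>x y. 0 < y \<longrightarrow> elliptic \<eta> (centered (zoom x y u))}"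

text \<open>Rescaling leaves energy and B_p norm unchanged, so a single perturbation constant
  applies at all points of the half plane; with a single \<eta> this gives D and r0 independent of
  (x, y).\<close>

proposition pointwise_estimates:
  assumes p: "1 < p" and u: "u \<in> Bp_space p" and \<eta>: "0 < \<eta>"
    and ell: "\<And>x y. 0 < y \<Longrightarrow> elliptic \<eta> (centered (zoom x y u))"
  obtains D r0 where "0 < D" "0 < r0"
    "\<And>x y. 0 < y \<Longrightarrow> cmod (Lambda u (x, y)) \<le> D * osc_norm p (zoom x y u)"
    "\<And>x y h. 0 < y \<Longrightarrow> h \<in> Bp_space p \<Longrightarrow> cmod (dLambda u h (x, y)) \<le> D * osc_norm p (zoom x y h)"
    "\<And>x y h r. 0 < y \<Longrightarrow> h \<in> Bp_space p \<Longrightarrow> 0 < r \<Longrightarrow> r \<le> r0 \<Longrightarrow> Bp_norm p h \<le> r \<Longrightarrow>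
       cmod (Lambda (\<lambda>t. u t + h t) (x, y) - Lambda u (x, y) - dLambda u h (x, y)) \<le> D * r * osc_norm p (zoom x y h)"
    "\<And>x y h. 0 < y \<Longrightarrow> h \<in> Bp_space p \<Longrightarrow> Bp_norm p h \<le> r0 \<Longrightarrow> elliptic (\<eta> / 2) (centered (zoom x y (\<lambda>t. u t + h t)))"
proof -
  define R where "R = enn2real (Bp_energy p u)"
  have R: "0 \<le> R" "Bp_energy p u = ennreal R" using u by (auto simp: R_def Bp_space_iff less_top)
  obtain C where PC: "perturbation_const p R 12 C"
    using perturbation_bounds[OF p R(1), of 12] by auto
  note CD = perturbation_constD[OF PC]
  have C: "1 \<le> C" using PC by (simp add: perturbation_const_def)
  \<comment> \<open>A norm can be at most (1 - \<eta>) times a positive number only if 1 - \<eta> is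
    nonnegative; the point (0, 1) is as good as any.\<close>
  have \<eta>1: "\<eta> \<le> 1"
  proof -
    have "\<eta> \<le> cmod (den (centered (zoom 0 1 u)))" "cmod (num (centered (zoom 0 1 u))) \<le> (1 - \<eta>) * cmod (den (centered (zoom 0 1 u)))"
      using ell[of 1 0] by (auto simp: elliptic_def)
    hence "0 < cmod (den (centered (zoom 0 1 u)))" "0 \<le> (1 - \<eta>) * cmod (den (centered (zoom 0 1 u)))"
      using \<eta> norm_ge_zero order_trans by (linarith, blast)
    thus ?thesis by (simp add: zero_le_mult_iff)
  qed
  \<comment> \<open>Serves twice: it implies 16 C r <= \<eta> for \<open>quotient_remainder\<close>,
    and the total loss 16 C r0 = (\<eta>/2)^2 is at most \<eta>/2 times the perturbed denominator,
    so the ellipticity constant is only halved.\<close>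
  define r0 where "r0 = \<eta>\<^sup>2 / (64 * C)"
  have r0: "0 < r0" "64 * C * r0 = \<eta>\<^sup>2" using \<eta> C by (auto simp: r0_def)
  have \<eta>2: "\<eta>\<^sup>2 \<le> \<eta>" using \<eta> \<eta>1 by (simp add: power2_eq_square mult_left_le_one_le)
  have rr: "64 * C * r \<le> \<eta>\<^sup>2" "16 * C * r \<le> \<eta>" "r \<le> 1" if "0 < r" "r \<le> r0" for r
  proof -
    have "64 * C * r \<le> 64 * C * r0" using that C by (intro mult_left_mono) auto
    thus 1: "64 * C * r \<le> \<eta>\<^sup>2" using r0 by simp
    have "0 \<le> C * r" "r \<le> C * r" using that C by auto
    thus "16 * C * r \<le> \<eta>" "r \<le> 1" using 1 \<eta>2 \<eta>1 by linarith+
  qed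
  define D where "D = C / \<eta> + 2 * C\<^sup>2 / \<eta>\<^sup>2 + (4 * C\<^sup>2 / \<eta>\<^sup>2 + 32 * C^3 / \<eta>^3)"
  have D: "0 < D" "C / \<eta> \<le> D" "2 * C\<^sup>2 / \<eta>\<^sup>2 \<le> D" "4 * C\<^sup>2 / \<eta>\<^sup>2 + 32 * C^3 / \<eta>^3 \<le> D"
  proof -
    have "0 < C / \<eta>" "0 \<le> 2 * C\<^sup>2 / \<eta>\<^sup>2" "0 \<le> 4 * C\<^sup>2 / \<eta>\<^sup>2" "0 \<le> 32 * C^3 / \<eta>^3" using C \<eta> by auto
    thus "0 < D" "C / \<eta> \<le> D" "2 * C\<^sup>2 / \<eta>\<^sup>2 \<le> D" "4 * C\<^sup>2 / \<eta>\<^sup>2 + 32 * C^3 / \<eta>^3 \<le> D"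
      unfolding D_def by linarith+
  qed
  have um: "u \<in> borel_measurable borel" using u by (simp add: Bp_space_iff)
  have zu: "zoom x y u \<in> Bp_space p" "Bp_energy p (zoom x y u) \<le> ennreal R" if "0 < y" for x y
    using Bp_space_zoom[OF u that] Bp_energy_zoom[OF um that] R by auto
  note ka = kernel_measurable(1) kernel_bound(1) and kb = kernel_measurable(2) kernel_bound(2)
  have est: "cmod (num (centered (zoom x y u))) \<le> C" "cmod (num (centered (zoom x y u))) \<le> C * osc_norm p (zoom x y u)"
     "cmod (den (centered (zoom x y u))) \<le> C" "\<eta> \<le> cmod (den (centered (zoom x y u)))"
     "cmod (num (centered (zoom x y u))) \<le> (1 - \<eta>) * cmod (den (centered (zoom x y u)))" if y: "0 < y" for x y
    using CD(2,3)[OF zu[OF y, of x] ka] CD(2)[OF zu[OF y, of x] kb] ell[OF y, of x] integral_kernel_alpha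
    by (auto simp: elliptic_def)
  have est1: "cmod (dnum (centered (zoom x y u)) (centered (zoom x y h))) \<le> C * osc_norm p (zoom x y h)"
     "cmod (dden (centered (zoom x y u)) (centered (zoom x y h))) \<le> C * osc_norm p (zoom x y h)"
    if y: "0 < y" and h: "h \<in> Bp_space p" for x y h
    using CD(5)[OF zu[OF y, of x] ka Bp_space_zoom[OF h y, of x]] CD(5)[OF zu[OF y, of x] kb Bp_space_zoom[OF h y, of x]] by auto
  have cadd: "centered (zoom x y (\<lambda>t. u t + h t)) = (\<lambda>s. centered (zoom x y u) s + centered (zoom x y h) s)"
    if y: "0 < y" and h: "h \<in> Bp_space p" for x y h
    using centered_add[OF integrable_gauss_Bp[OF p zu(1)[OF y, of x]] integrable_gauss_Bp[OF p Bp_space_zoom[OF h y, of x]]]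
    by (simp add: zoom_def)
  have QR: "cmod (num (centered (zoom x y (\<lambda>t. u t + h t))) - num (centered (zoom x y u))) \<le> 8 * C * r \<and>
     cmod (den (centered (zoom x y (\<lambda>t. u t + h t))) - den (centered (zoom x y u))) \<le> 8 * C * r \<and>
     \<eta> / 2 \<le> cmod (den (centered (zoom x y (\<lambda>t. u t + h t)))) \<and>
     cmod (Lambda (\<lambda>t. u t + h t) (x, y) - Lambda u (x, y) - dLambda u h (x, y)) \<le>
      (4 * C\<^sup>2 / \<eta>\<^sup>2 + 32 * C^3 / \<eta>^3) * r * osc_norm p (zoom x y h)"
    if y: "0 < y" and h: "h \<in> Bp_space p" and r: "0 < r" "r \<le> r0" and hr: "Bp_norm p h \<le> r" for x y h r
  proof -
    have hz: "zoom x y h \<in> Bp_space p" "Bp_norm p (zoom x y h) \<le> r"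
      using Bp_space_zoom[OF h y] Bp_norm_zoom[OF h y] hr by auto
    note r1 = rr[OF r]
    have n: "osc_norm p (zoom x y h) \<le> 4 * r" using osc_norm_le_Bp_norm[OF p hz(1)] hz(2) by linarith
    have uh: "(\<lambda>t. u t + h t) \<in> Bp_space p" using p by (intro Bp_space_add u h) auto
    note q = quotient_remainder[OF \<eta> est(4)[OF y, of x] C est(1)[OF y, of x] est(3)[OF y, of x] est1[OF y h, of x]
       CD(6)[OF zu[OF y, of x] ka hz(1) r(1) r1(3) hz(2), folded cadd[OF y h]]
       CD(6)[OF zu[OF y, of x] kb hz(1) r(1) r1(3) hz(2), folded cadd[OF y h]] osc_norm_nonneg n r(1) r1(3) r1(2)]
    show ?thesis using q unfolding Lambda_centered[OF p uh y] Lambda_centered[OF p u y] dLambda_centered[OF p u h y]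
      by (simp only: cadd[OF y h])
  qed
  show thesis
  proof (rule that[of D r0])
    show "0 < D" "0 < r0" by fact+
  next
    fix x y :: real assume y: "0 < y"
    have "cmod (Lambda u (x, y)) \<le> C * osc_norm p (zoom x y u) / \<eta>"
      unfolding Lambda_centered[OF p u y] norm_divide using est[OF y, of x] \<eta> C osc_norm_nonneg
      by (intro frac_le) auto
    also have "\<dots> = C / \<eta> * osc_norm p (zoom x y u)" by simp
    also have "\<dots> \<le> D * osc_norm p (zoom x y u)" using D by (intro mult_right_mono osc_norm_nonneg) auto
    finally show "cmod (Lambda u (x, y)) \<le> D * osc_norm p (zoom x y u)" .
  next
    fix x y :: real and h assume y: "0 < y" and h: "h \<in> Bp_space p"
    let ?v = "centered (zoom x y u)" and ?k = "centered (zoom x y h)" and ?n = "osc_norm p (zoom x y h)"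
    note e = est[OF y, of x] est1[OF y h, of x]
    have "cmod (dnum ?v ?k * den ?v - num ?v * dden ?v ?k) \<le> cmod (dnum ?v ?k) * cmod (den ?v) + cmod (num ?v) * cmod (dden ?v ?k)"
      by (rule norm_mult_diff_le)
    also have "\<dots> \<le> C * ?n * C + C * (C * ?n)"
      using e C osc_norm_nonneg[of p "zoom x y h"] by (intro add_mono mult_mono) auto
    also have "\<dots> = 2 * C\<^sup>2 * ?n" by (simp add: power2_eq_square)
    finally have "cmod (dLambda u h (x, y)) \<le> 2 * C\<^sup>2 * ?n / \<eta>\<^sup>2"
      unfolding dLambda_centered[OF p u h y] norm_divide norm_power using e \<eta> C osc_norm_nonneg[of p "zoom x y h"]
      by (intro frac_le power_mono) auto
    also have "\<dots> = 2 * C\<^sup>2 / \<eta>\<^sup>2 * ?n" by simp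
    also have "\<dots> \<le> D * ?n" using D by (intro mult_right_mono osc_norm_nonneg) auto
    finally show "cmod (dLambda u h (x, y)) \<le> D * ?n" .
  next
    fix x y :: real and h r assume y: "0 < y" and h: "h \<in> Bp_space p" and r: "0 < r" "r \<le> r0" and hr: "Bp_norm p h \<le> r"
    have "0 \<le> r * osc_norm p (zoom x y h)" using r osc_norm_nonneg by simp
    from mult_right_mono[OF D(4) this] QR[OF y h r hr, of x]
    show "cmod (Lambda (\<lambda>t. u t + h t) (x, y) - Lambda u (x, y) - dLambda u h (x, y)) \<le> D * r * osc_norm p (zoom x y h)"
      by (simp add: mult.assoc)
  next
    fix x y :: real and h assume y: "0 < y" and h: "h \<in> Bp_space p" and hr: "Bp_norm p h \<le> r0"
    define A B A' B' where "A = cmod (num (centered (zoom x y u)))" and "B = cmod (den (centered (zoom x y u)))"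
      and "A' = cmod (num (centered (zoom x y (\<lambda>t. u t + h t))))" and "B' = cmod (den (centered (zoom x y (\<lambda>t. u t + h t))))"
    have Q: "A' \<le> A + 8 * C * r0" "B \<le> B' + 8 * C * r0" "\<eta> / 2 \<le> B'"
      using QR[OF y h r0(1) order_refl hr, of x]
        norm_triangle_ineq2[of "num (centered (zoom x y (\<lambda>t. u t + h t)))" "num (centered (zoom x y u))"]
        norm_triangle_ineq3[of "den (centered (zoom x y (\<lambda>t. u t + h t)))" "den (centered (zoom x y u))"]
      unfolding A_def B_def A'_def B'_def by linarith+
    have "A' \<le> (1 - \<eta>) * B + 8 * C * r0" using est(5)[OF y, of x] Q(1) by (simp add: A_def B_def)
    also have "\<dots> \<le> (1 - \<eta>) * (B' + 8 * C * r0) + 8 * C * r0"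
      using Q \<eta>1 by (intro add_right_mono mult_left_mono) auto
    also have "\<dots> \<le> (1 - \<eta>) * B' + 16 * C * r0"
    proof -
      have "0 \<le> 8 * C * r0" using C r0 by simp
      hence "(1 - \<eta>) * (8 * C * r0) \<le> 1 * (8 * C * r0)" using \<eta> by (intro mult_right_mono) auto
      thus ?thesis by (simp add: distrib_left)
    qed
    also have "16 * C * r0 = \<eta> / 2 * (\<eta> / 2)" using r0(2) by (simp add: power2_eq_square)
    also have "\<dots> \<le> \<eta> / 2 * B'" using Q \<eta> by (intro mult_left_mono) auto
    finally have "A' \<le> (1 - \<eta> / 2) * B'" by (simp add: algebra_simps)
    thus "elliptic (\<eta> / 2) (centered (zoom x y (\<lambda>t. u t + h t)))"
      using Q(3) by (simp add: elliptic_def A'_def B'_def)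
  qed
qed

section \<open>Norm estimates and boundary behaviour\<close>

lemma gint_zoom_measurable:
  assumes [measurable]: "w \<in> borel_measurable borel" "f \<in> borel_measurable borel"
  shows "(\<lambda>z. gint w (\<lambda>s. f (fst z - snd z * s))) \<in> borel_measurable (borel \<Otimes>\<^sub>M borel)"
  unfolding gint_def by (rule gauss.borel_measurable_lebesgue_integral) measurable

lemma measurable_UHP: "f \<in> borel_measurable (borel \<Otimes>\<^sub>M borel) \<Longrightarrow> f \<in> borel_measurable UHP_measure"
  unfolding UHP_measure_def borel_prod by (intro measurable_restrict_space1) simp

lemma Lambda_measurable:
  assumes [measurable]: "u \<in> borel_measurable borel"
  shows "Lambda u \<in> borel_measurable (borel \<Otimes>\<^sub>M borel)"
proof -
  have [measurable]: "(\<lambda>z. num (\<lambda>s. u (fst z - snd z * s))) \<in> borel_measurable (borel \<Otimes>\<^sub>M borel)"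
     "(\<lambda>z. den (\<lambda>s. u (fst z - snd z * s))) \<in> borel_measurable (borel \<Otimes>\<^sub>M borel)"
    using gint_zoom_measurable[of _ "\<lambda>t. exp (u t)"] by auto
  have "Lambda u = (\<lambda>z. if 0 < snd z then num (\<lambda>s. u (fst z - snd z * s)) / den (\<lambda>s. u (fst z - snd z * s)) else 0)"
    using Lambda_eq_gint[OF assms] by (auto simp: fun_eq_iff)
  thus ?thesis by simp
qed

lemma dLambda_measurable:
  assumes [measurable]: "u \<in> borel_measurable borel" "h \<in> borel_measurable borel"
  shows "dLambda u h \<in> borel_measurable (borel \<Otimes>\<^sub>M borel)"
proof -
  have [measurable]: "(\<lambda>z. num (\<lambda>s. u (fst z - snd z * s))) \<in> borel_measurable (borel \<Otimes>\<^sub>M borel)"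
     "(\<lambda>z. den (\<lambda>s. u (fst z - snd z * s))) \<in> borel_measurable (borel \<Otimes>\<^sub>M borel)"
     "(\<lambda>z. dnum (\<lambda>s. u (fst z - snd z * s)) (\<lambda>s. h (fst z - snd z * s))) \<in> borel_measurable (borel \<Otimes>\<^sub>M borel)"
     "(\<lambda>z. dden (\<lambda>s. u (fst z - snd z * s)) (\<lambda>s. h (fst z - snd z * s))) \<in> borel_measurable (borel \<Otimes>\<^sub>M borel)"
    using gint_zoom_measurable[of _ "\<lambda>t. exp (u t)"] gint_zoom_measurable[of _ "\<lambda>t. h t * exp (u t)"] by auto
  show ?thesis unfolding dLambda_def[abs_def] Let_def zoom_def by measurable
qed

lemma space_UHP_measure: "space UHP_measure = UHP"
  by (simp add: UHP_measure_def space_restrict_space)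

text \<open>One pointwise bound yields both parts of the norm: the sup part through
  \<open>osc_norm_le_Bp_norm\<close> (constant 4) and the integral part through
  \<open>nn_integral_UHP_gauss_osc\<close> (constant 2^(1/p) <= 2). It is applied to
  \<open>Lambda u\<close>, to the derivative and to the Taylor remainder.\<close>

lemma Lp_norm_from_oscillation:
  assumes p: "1 < p" and h: "h \<in> Bp_space p" and m: "m \<in> borel_measurable UHP_measure" and D: "0 \<le> D"
    and le: "\<And>x y. 0 < y \<Longrightarrow> cmod (m (x, y)) \<le> D * osc_norm p (zoom x y h)"
  shows "m \<in> Lp_space p" "Lp_norm p m \<le> 6 * D * Bp_norm p h"
proof -
  have [measurable]: "h \<in> borel_measurable borel" using h by (simp add: Bp_space_iff)
  have nn: "0 \<le> Bp_norm p h" by (simp add: Bp_norm_def)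
  have sup: "cmod (m z) \<le> D * (4 * Bp_norm p h)" if zU: "z \<in> UHP" for z
  proof -
    obtain x y where z: "z = (x, y)" "0 < y" using zU by (cases z) (auto simp: UHP_def)
    have "cmod (m z) \<le> D * osc_norm p (zoom x y h)" using le z by simp
    also have "\<dots> \<le> D * (4 * Bp_norm p (zoom x y h))"
      using z by (intro mult_left_mono osc_norm_le_Bp_norm p Bp_space_zoom h D) auto
    finally show ?thesis using Bp_norm_zoom[OF h z(2)] by simp
  qed
  have Li: "Linf_norm m \<le> ereal (4 * D * Bp_norm p h)"
    unfolding Linf_norm_def
    by (rule esssup_I) (use m sup in \<open>auto simp: space_UHP_measure mult_ac intro!: AE_I2\<close>)
  have LI: "Lp_integral p m \<le> ennreal (D powr p * 2 * Bp_norm p h powr p)"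
  proof -
    have "Lp_integral p m \<le> (\<integral>\<^sup>+z. ennreal (D powr p) * (gauss_osc p (\<lambda>s. h (fst z - snd z * s)) * ennreal (1 / (snd z)\<^sup>2)) \<partial>UHP_measure)"
      unfolding Lp_integral_def
    proof (rule nn_integral_mono)
      fix z assume "z \<in> space UHP_measure"
      then obtain x y where z: "z = (x, y)" "0 < y" by (cases z) (auto simp: UHP_def space_UHP_measure)
      have hz: "zoom x y h \<in> Bp_space p" using h z by (intro Bp_space_zoom)
      have "cmod (m z) powr p \<le> (D * osc_norm p (zoom x y h)) powr p"
        using le z p by (intro powr_mono2) auto
      also have "\<dots> = D powr p * enn2real (gauss_osc p (zoom x y h))"
        using D p by (simp add: powr_mult osc_norm_def powr_powr)
      finally have "ennreal (cmod (m z) powr p / y\<^sup>2) \<le> ennreal (D powr p * enn2real (gauss_osc p (zoom x y h)) * (1 / y\<^sup>2))"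
        by (intro ennreal_leI) (simp add: divide_right_mono)
      also have "\<dots> = ennreal (D powr p) * (gauss_osc p (zoom x y h) * ennreal (1 / y\<^sup>2))"
        using gauss_osc_finite[OF hz] by (simp add: ennreal_mult mult.assoc less_top del: times_divide_eq_right)
      finally show "ennreal (cmod (m z) powr p / (snd z)\<^sup>2) \<le> ennreal (D powr p) * (gauss_osc p (\<lambda>s. h (fst z - snd z * s)) * ennreal (1 / (snd z)\<^sup>2))"
        using z by (simp add: zoom_def)
    qed
    also have "\<dots> = ennreal (D powr p) * (\<integral>\<^sup>+z. gauss_osc p (\<lambda>s. h (fst z - snd z * s)) * ennreal (1 / (snd z)\<^sup>2) \<partial>UHP_measure)"
      by (intro nn_integral_cmult measurable_UHP) measurable
    also have "\<dots> \<le> ennreal (D powr p) * (2 * Bp_energy p h)"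
      by (intro mult_left_mono nn_integral_UHP_gauss_osc) auto
    also have "\<dots> = ennreal (D powr p * 2 * Bp_norm p h powr p)"
      by (simp add: Bp_energy_eq_norm[OF p h] ennreal_mult mult.assoc)
    finally show ?thesis .
  qed
  show "m \<in> Lp_space p"
    using m Li LI by (auto simp: Lp_space_def intro: order.strict_trans1)
  have "real_of_ereal (Linf_norm m) \<le> 4 * D * Bp_norm p h"
    using Li D nn by (cases "Linf_norm m") auto
  moreover have "enn2real (Lp_integral p m) powr (1 / p) \<le> 2 * D * Bp_norm p h"
  proof -
    have "enn2real (Lp_integral p m) \<le> D powr p * 2 * Bp_norm p h powr p"
      using LI by (intro enn2real_leI) auto
    hence "enn2real (Lp_integral p m) powr (1 / p) \<le> (D powr p * 2 * Bp_norm p h powr p) powr (1 / p)"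
      using p by (intro powr_mono2) auto
    also have "\<dots> = D * 2 powr (1 / p) * Bp_norm p h"
      using p D nn by (simp add: powr_mult powr_powr)
    also have "\<dots> \<le> D * 2 powr 1 * Bp_norm p h"
      using p D nn by (intro mult_right_mono mult_left_mono powr_mono) auto
    finally show ?thesis by simp
  qed
  ultimately show "Lp_norm p m \<le> 6 * D * Bp_norm p h" by (simp add: Lp_norm_def)
qed

section \<open>Decay of the oscillation at the boundary\<close>

text \<open>\<open>bump\<close> is not monotone; \<open>1 / (1 + r\<^sup>2)\<close> is a majorant that makes the bound monotone in \<open>y\<close>.\<close>

definition tail_energy :: "real \<Rightarrow> (real \<Rightarrow> complex) \<Rightarrow> real \<Rightarrow> ennreal" where
  "tail_energy p u y = (\<integral>\<^sup>+z. ennreal (cmod (u (fst z) - u (snd z)) powr p / (fst z - snd z)\<^sup>2 * (1 / (1 + ((fst z - snd z) / y)\<^sup>2))) \<partial>lborel)"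

text \<open>Quadratic Taylor bound for exp (r^2/4); 36 is large enough since its r^4 term, 36 r^4 /
  32, already exceeds r^4.\<close>

lemma bump_le_rational: "bump r \<le> 36 * (1 / (1 + r\<^sup>2))"
proof -
  let ?t = "r\<^sup>2 / 4"
  have e: "1 + ?t + ?t\<^sup>2 / 2 \<le> exp ?t" by (intro exp_lower_Taylor_quadratic) simp
  have "r\<^sup>2 * (1 + r\<^sup>2) \<le> 36 * (1 + ?t + ?t\<^sup>2 / 2)"
    using zero_le_power2[of "r\<^sup>2"] by (simp add: power2_eq_square field_simps)
  also have "\<dots> \<le> 36 * exp ?t" using e by simp
  finally have "r\<^sup>2 * (1 + r\<^sup>2) * exp (- ?t) \<le> 36"
    by (simp add: exp_minus field_simps)
  moreover have "0 < 1 + r\<^sup>2" by (simp add: add_pos_nonneg)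
  ultimately show ?thesis by (simp add: bump_def field_simps)
qed

text \<open>The rational majorant increases with the scale, so scale t controls all smaller y, for
  all x simultaneously.\<close>

lemma gauss_osc_zoom_le_tail:
  assumes [measurable]: "u \<in> borel_measurable borel" and y: "0 < y" "y \<le> t"
  shows "gauss_osc p (zoom x y u) \<le> 36 * tail_energy p u t"
proof -
  let ?e = "\<lambda>a b. cmod (u a - u b) powr p / (a - b)\<^sup>2"
  have "gauss_osc p (zoom x y u) \<le> (\<integral>\<^sup>+a. \<integral>\<^sup>+b. ennreal (?e a b * bump ((a - b) / y)) \<partial>lborel \<partial>lborel)"
    unfolding zoom_def using y by (intro gauss_osc_scaled_le) auto
  also have "\<dots> \<le> (\<integral>\<^sup>+a. \<integral>\<^sup>+b. 36 * ennreal (?e a b * (1 / (1 + ((a - b) / t)\<^sup>2))) \<partial>lborel \<partial>lborel)"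
  proof (intro nn_integral_mono)
    fix a b :: real
    have "(a - b)\<^sup>2 / t\<^sup>2 \<le> (a - b)\<^sup>2 / y\<^sup>2" using y by (intro divide_left_mono power_mono) auto
    hence "1 / (1 + ((a - b) / y)\<^sup>2) \<le> 1 / (1 + ((a - b) / t)\<^sup>2)"
      by (intro divide_left_mono) (auto simp: power_divide add_pos_nonneg)
    hence "bump ((a - b) / y) \<le> 36 * (1 / (1 + ((a - b) / t)\<^sup>2))"
      using bump_le_rational[of "(a - b) / y"] by linarith
    hence "?e a b * bump ((a - b) / y) \<le> ?e a b * (36 * (1 / (1 + ((a - b) / t)\<^sup>2)))"
      by (intro mult_left_mono) auto
    hence "ennreal (?e a b * bump ((a - b) / y)) \<le> ennreal (36 * (?e a b * (1 / (1 + ((a - b) / t)\<^sup>2))))"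
      by (intro ennreal_leI) (simp add: mult_ac)
    thus "ennreal (?e a b * bump ((a - b) / y)) \<le> 36 * ennreal (?e a b * (1 / (1 + ((a - b) / t)\<^sup>2)))"
      by (subst (asm) ennreal_mult) auto
  qed
  also have "\<dots> = 36 * (\<integral>\<^sup>+a. \<integral>\<^sup>+b. ennreal (?e a b * (1 / (1 + ((a - b) / t)\<^sup>2))) \<partial>lborel \<partial>lborel)"
    by (subst nn_integral_cmult[symmetric], measurable, subst nn_integral_cmult[symmetric], measurable)
  also have "(\<integral>\<^sup>+a. \<integral>\<^sup>+b. ennreal (?e a b * (1 / (1 + ((a - b) / t)\<^sup>2))) \<partial>lborel \<partial>lborel) = tail_energy p u t"
    unfolding tail_energy_def
    unfolding lborel_prod[symmetric] by (subst lborel.nn_integral_fst[symmetric]) auto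
  finally show ?thesis .
qed

text \<open>Dominated convergence with the energy density as majorant: off the diagonal the extra
  factor tends to 0, on it the numerator vanishes. A sequence of scales is enough because of the
  monotonicity in \<open>gauss_osc_zoom_le_tail\<close>.\<close>

lemma tail_energy_tendsto_0:
  assumes u: "u \<in> Bp_space p"
  shows "(\<lambda>n. tail_energy p u (1 / real (Suc n))) \<longlonglongrightarrow> 0"
proof -
  have [measurable]: "u \<in> borel_measurable borel" using u by (simp add: Bp_space_iff)
  let ?e = "\<lambda>z. cmod (u (fst z) - u (snd z)) powr p / (fst z - snd z)\<^sup>2"
  let ?f = "\<lambda>n z. ?e z * (1 / (1 + ((fst z - snd z) / (1 / real (Suc n)))\<^sup>2))"
  have "(\<lambda>n. \<integral>\<^sup>+z. ennreal (?f n z) \<partial>lborel) \<longlonglongrightarrow> (\<integral>\<^sup>+z. 0 \<partial>(lborel :: (real \<times> real) measure))"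
  proof (rule nn_integral_dominated_convergence[where w="\<lambda>z. ennreal (?e z)"])
    show "(\<lambda>z. ennreal (?f n z)) \<in> borel_measurable lborel" for n
      unfolding lborel_prod[symmetric] by measurable
    show "(\<lambda>z. ennreal (?e z)) \<in> borel_measurable lborel"
      unfolding lborel_prod[symmetric] by measurable
    show "(\<integral>\<^sup>+z. ennreal (?e z) \<partial>lborel) < \<infinity>"
      using u by (simp add: Bp_space_iff Bp_energy_def)
    show "AE z in lborel. ennreal (?f n z) \<le> ennreal (?e z)" for n
    proof (intro AE_I2 ennreal_leI)
      fix z :: "real \<times> real"
      have "1 / (1 + ((fst z - snd z) / (1 / real (Suc n)))\<^sup>2) \<le> 1"
        by (simp add: divide_le_eq_1 add_pos_nonneg)
      from mult_left_mono[OF this, of "?e z"] show "?f n z \<le> ?e z" by simp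
    qed
    show "AE z in lborel. (\<lambda>n. ennreal (?f n z)) \<longlonglongrightarrow> 0"
    proof (intro AE_I2)
      fix z :: "real \<times> real"
      show "(\<lambda>n. ennreal (?f n z)) \<longlonglongrightarrow> 0"
      proof (cases "fst z = snd z")
        case False
        have "(\<lambda>n. ?e z * (1 / (1 + ((fst z - snd z) / (1 / real (Suc n)))\<^sup>2))) \<longlonglongrightarrow> ?e z * 0"
        proof (intro tendsto_mult tendsto_const)
          define d where "d = fst z - snd z"
          have d: "d \<noteq> 0" using False by (simp add: d_def)
          have "(\<lambda>n. 1 / (1 + (d / (1 / real (Suc n)))\<^sup>2)) \<longlonglongrightarrow> 0"
          proof -
            have "filterlim (\<lambda>n. \<bar>d\<bar> * real (Suc n)) at_top sequentially"
              using d
              by (intro filterlim_tendsto_pos_mult_at_top[OF tendsto_const] filterlim_compose[OF filterlim_real_sequentially] filterlim_Suc) auto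
            hence "filterlim (\<lambda>n. 1 + (\<bar>d\<bar> * real (Suc n))\<^sup>2) at_top sequentially"
              by (intro filterlim_tendsto_add_at_top[OF tendsto_const] filterlim_pow_at_top) auto
            hence "(\<lambda>n. inverse (1 + (\<bar>d\<bar> * real (Suc n))\<^sup>2)) \<longlonglongrightarrow> 0"
              by (rule tendsto_inverse_0_at_top)
            thus ?thesis by (simp add: power_mult_distrib divide_inverse)
          qed
          thus "(\<lambda>n. 1 / (1 + ((fst z - snd z) / (1 / real (Suc n)))\<^sup>2)) \<longlonglongrightarrow> 0" by (simp only: d_def)
        qed
        hence "(\<lambda>n. ?f n z) \<longlonglongrightarrow> 0" by simp
        from tendsto_ennrealI[OF this] show ?thesis by simp
      qed simp
    qed
  qed auto
  thus ?thesis by (simp add: tail_energy_def)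
qed

lemma osc_norm_zoom_uniformly_small:
  assumes p: "1 < p" and u: "u \<in> Bp_space p" and e: "0 < e"
  obtains t where "0 < t" "\<And>x y. 0 < y \<Longrightarrow> y \<le> t \<Longrightarrow> osc_norm p (zoom x y u) \<le> e"
proof -
  have m: "u \<in> borel_measurable borel" using u by (simp add: Bp_space_iff)
  have "0 < ennreal (e powr p / 36)" using e by simp
  from order_tendstoD(2)[OF tail_energy_tendsto_0[OF u] this]
  obtain n where n: "tail_energy p u (1 / real (Suc n)) < ennreal (e powr p / 36)"
    by (auto simp: eventually_sequentially)
  show thesis
  proof (rule that[of "1 / real (Suc n)"])
    fix x y :: real assume y: "0 < y" "y \<le> 1 / real (Suc n)"
    have "gauss_osc p (zoom x y u) \<le> 36 * ennreal (e powr p / 36)"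
      using gauss_osc_zoom_le_tail[OF m y, of p x] mult_left_mono[OF less_imp_le[OF n], of 36] by (auto intro: order_trans)
    also have "\<dots> = ennreal (e powr p)"
      by (simp flip: ennreal_numeral ennreal_mult)
    finally have "enn2real (gauss_osc p (zoom x y u)) \<le> e powr p"
      by (intro enn2real_leI) auto
    hence "osc_norm p (zoom x y u) \<le> (e powr p) powr (1 / p)"
      unfolding osc_norm_def using p by (intro powr_mono2) auto
    thus "osc_norm p (zoom x y u) \<le> e" using p e by (simp add: powr_powr)
  qed simp
qed

text \<open>Over a null space the essential supremum would be minus infinity; a strip of positive
  measure gives the lower half of the limit at the boundary.\<close>

lemma emeasure_strip_nonzero:
  assumes "0 < t"
  shows "emeasure (restrict_space lborel {z :: real \<times> real. 0 < snd z \<and> snd z < t}) (space (restrict_space lborel {z. 0 < snd z \<and> snd z < t})) \<noteq> 0"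
proof -
  let ?S = "{z :: real \<times> real. 0 < snd z \<and> snd z < t}"
  have o: "open ?S" by (intro open_Collect_conj open_Collect_less continuous_intros)
  have "(0, t/2) \<in> ?S" using assms by simp
  hence "\<not> negligible ?S" using open_not_negligible[OF o] by blast
  hence "emeasure lborel ?S \<noteq> 0"
    using o by (auto simp: negligible_iff_null_sets null_sets_completion_iff null_sets_def)
  thus ?thesis using o by (simp add: emeasure_restrict_space space_restrict_space)
qed

lemma Lambda_vanishes_at_boundary:
  assumes p: "1 < p" and u: "u \<in> Bp_space p" and D: "0 < D"
    and le: "\<And>x y. 0 < y \<Longrightarrow> cmod (Lambda u (x, y)) \<le> D * osc_norm p (zoom x y u)"
  shows "((\<lambda>t. esssup (restrict_space lborel {z. 0 < snd z \<and> snd z < t}) (\<lambda>z. ereal (cmod (Lambda u z)))) \<longlongrightarrow> 0) (at_right 0)"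
proof (rule order_tendstoI)
  let ?S = "\<lambda>t. {z :: real \<times> real. 0 < snd z \<and> snd z < t}"
  let ?N = "\<lambda>t. esssup (restrict_space lborel (?S t)) (\<lambda>z. ereal (cmod (Lambda u z)))"
  have Lm: "Lambda u \<in> borel_measurable borel"
    using Lambda_measurable[of u] u by (simp add: Bp_space_iff borel_prod)
  have m: "(\<lambda>z. ereal (cmod (Lambda u z))) \<in> borel_measurable (restrict_space lborel (?S t))" for t
    using Lm by (intro measurable_restrict_space1) simp
  {
    fix a :: ereal assume a: "a < 0"
    have "0 \<le> ?N t" if "0 < t" for t
      using esssup_const[OF emeasure_strip_nonzero[OF that], of "0::ereal"]
        esssup_mono[of "\<lambda>_. 0 :: ereal" "restrict_space lborel (?S t)" "\<lambda>z. ereal (cmod (Lambda u z))"] by simp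
    hence "eventually (\<lambda>t. 0 \<le> ?N t) (at_right 0)"
      by (auto simp: eventually_at_right_field intro!: exI[of _ 1])
    thus "eventually (\<lambda>t. a < ?N t) (at_right 0)"
      by (rule eventually_mono) (use a in \<open>auto intro: less_le_trans\<close>)
  next
    fix a :: ereal assume "0 < a"
    then obtain e where e: "0 < ereal e" "ereal e < a" by (rule ereal_dense2[THEN exE]) auto
    have "0 < e / D" using e D by simp
    then obtain t0 where t0: "0 < t0" "\<And>x y. 0 < y \<Longrightarrow> y \<le> t0 \<Longrightarrow> osc_norm p (zoom x y u) \<le> e / D"
      using osc_norm_zoom_uniformly_small[OF p u] by blast
    have "?N t \<le> ereal e" if t: "t < t0" for t
    proof (rule esssup_I[OF m], rule AE_I2)
      fix z assume "z \<in> space (restrict_space lborel (?S t))"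
      then obtain x y where z: "z = (x, y)" "0 < y" "y < t" by (cases z) (auto simp: space_restrict_space)
      have "cmod (Lambda u z) \<le> D * (e / D)"
        using le[OF z(2), of x] mult_left_mono[OF t0(2)[OF z(2), of x], of D] z t D by auto
      thus "ereal (cmod (Lambda u z)) \<le> ereal e" using D by simp
    qed
    hence "eventually (\<lambda>t. ?N t \<le> ereal e) (at_right 0)"
      using t0(1) by (auto simp: eventually_at_right_field intro!: exI[of _ t0])
    thus "eventually (\<lambda>t. ?N t < a) (at_right 0)"
      by (rule eventually_mono) (use e in \<open>auto intro: le_less_trans\<close>)
  }
qed

section \<open>The domain and the holomorphy of \<open>Lambda\<close> on it\<close>

lemma real_valued_in_elliptic_domain:
  assumes p: "1 < p" and u: "u \<in> BpR_space p"
  shows "u \<in> elliptic_domain p"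
proof -
  have uB: "u \<in> Bp_space p" and ur: "\<And>t. u t \<in> \<real>" using u by (auto simp: BpR_space_def)
  define R where "R = enn2real (Bp_energy p u)"
  have R: "0 \<le> R" "Bp_energy p u = ennreal R" using uB by (auto simp: R_def Bp_space_iff less_top)
  have um: "u \<in> borel_measurable borel" using uB by (simp add: Bp_space_iff)
  obtain C0 where C0: "0 < C0" "\<And>u. u \<in> Bp_space p \<Longrightarrow> Bp_energy p u \<le> ennreal R \<Longrightarrow>
    (\<integral>\<^sup>+s. ennreal (exp (1 * cmod (centered u s))) \<partial>gauss) \<le> ennreal C0"
    using centered_exp_bound[OF p zero_le_one R(1)] by blast
  define C where "C = max 1 C0"
  have C: "1 \<le> C" "ennreal C0 \<le> ennreal C" by (auto simp: C_def intro!: ennreal_leI)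
  obtain K where PK: "perturbation_const p R 12 K"
    using perturbation_bounds[OF p R(1), of 12] by auto
  have K: "1 \<le> K" using PK by (simp add: perturbation_const_def)
  define c where "c = 1 / (16 * C\<^sup>2)"
  \<comment> \<open>Turns the additive gap |A|^2 + c <= |B|^2 into a ratio by |B| <= K: 2 \<eta>
    |B|^2 <= c gives |A|^2 <= (1 - 2 \<eta>) |B|^2 <= (1 - \<eta>)^2 |B|^2, while c <= K |B| bounds
    |B| below.\<close>
  define \<eta> where "\<eta> = c / (2 * K\<^sup>2)"
  have c: "0 < c" "c \<le> 1"
  proof -
    have "1 \<le> C\<^sup>2" using C by simp
    thus "0 < c" "c \<le> 1" by (auto simp: c_def divide_simps)
  qed
  have K2: "1 \<le> K\<^sup>2" using K by simp
  have "elliptic \<eta> (centered (zoom x y u))" if y: "0 < y" for x y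
  proof -
    let ?v = "centered (zoom x y u)"
    have zu: "zoom x y u \<in> Bp_space p" "Bp_energy p (zoom x y u) \<le> ennreal R"
      using Bp_space_zoom[OF uB y] Bp_energy_zoom[OF um y] R by auto
    define w where "w = (\<lambda>s. Re (?v s))"
    \<comment> \<open>The Gaussian mean of a real function is real, so centering keeps the exponent
      real, as \<open>real_exponent_ellipticity\<close> requires.\<close>
    have "zoom x y u = (\<lambda>s. complex_of_real (Re (zoom x y u s)))"
      using ur by (auto simp: zoom_def)
    hence "(\<integral>t. zoom x y u t \<partial>gauss) = complex_of_real (\<integral>t. Re (zoom x y u t) \<partial>gauss)"
      by (metis integral_complex_of_real)
    hence "?v s \<in> \<real>" for s using ur by (simp add: centered_def zoom_def)
    hence v: "?v s = complex_of_real (w s)" for s by (simp add: w_def)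
    have wm[measurable]: "w \<in> borel_measurable borel" using um unfolding w_def by measurable
    have "(\<integral>\<^sup>+s. ennreal (exp \<bar>w s\<bar>) \<partial>gauss) \<le> ennreal C"
      using order_trans[OF C0(2)[OF zu] C(2)] by (simp add: v)
    from real_exponent_ellipticity[OF wm this C(1)]
    have AB: "(cmod (num ?v))\<^sup>2 + c \<le> (cmod (den ?v))\<^sup>2" by (simp add: v c_def)
    have BK: "cmod (den ?v) \<le> K" by (rule perturbation_constD(2)[OF PK zu kernel_measurable(2) kernel_bound(2)])
    have B2: "(cmod (den ?v))\<^sup>2 \<le> K\<^sup>2" using BK by (intro power_mono) auto
    have "c \<le> (cmod (den ?v))\<^sup>2" using AB zero_le_power2[of "cmod (num ?v)"] by linarith
    also have "\<dots> \<le> cmod (den ?v) * K" using BK by (simp add: power2_eq_square mult_left_mono)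
    finally have "c / K \<le> cmod (den ?v)" using K by (simp add: field_simps)
    moreover have "\<eta> \<le> c / K"
      unfolding \<eta>_def using K c by (intro divide_left_mono) (auto simp: power2_eq_square)
    moreover have "cmod (num ?v) \<le> (1 - \<eta>) * cmod (den ?v)"
    proof (rule power2_le_imp_le)
      have e1: "\<eta> \<le> 1" "0 < \<eta>" unfolding \<eta>_def using c K2 by (auto simp: divide_simps)
      show "0 \<le> (1 - \<eta>) * cmod (den ?v)" using e1 by simp
      have "2 * \<eta> * (cmod (den ?v))\<^sup>2 \<le> 2 * \<eta> * K\<^sup>2" using e1 B2 by (intro mult_left_mono) auto
      also have "\<dots> = c" using K by (simp add: \<eta>_def)
      finally have "(cmod (num ?v))\<^sup>2 \<le> (1 - 2 * \<eta>) * (cmod (den ?v))\<^sup>2"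
        using AB by (simp add: algebra_simps)
      also have "\<dots> \<le> (1 - \<eta>)\<^sup>2 * (cmod (den ?v))\<^sup>2"
        by (intro mult_right_mono) (auto simp: power2_diff)
      finally show "(cmod (num ?v))\<^sup>2 \<le> ((1 - \<eta>) * cmod (den ?v))\<^sup>2" by (simp add: power_mult_distrib)
    qed
    ultimately show ?thesis by (simp add: elliptic_def)
  qed
  moreover have "0 < \<eta>" unfolding \<eta>_def using c K by (auto intro!: divide_pos_pos)
  ultimately show ?thesis using uB by (auto simp: elliptic_domain_def)
qed

lemma Bp_open_elliptic_domain:
  assumes p: "1 < p"
  shows "Bp_open p (elliptic_domain p)"
  unfolding Bp_open_def
proof (intro conjI ballI)
  show "elliptic_domain p \<subseteq> Bp_space p" by (auto simp: elliptic_domain_def)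
  fix u assume "u \<in> elliptic_domain p"
  then obtain \<eta> where u: "u \<in> Bp_space p" and \<eta>: "0 < \<eta>" and ell: "\<And>x y. 0 < y \<Longrightarrow> elliptic \<eta> (centered (zoom x y u))"
    by (auto simp: elliptic_domain_def)
  obtain r0 where r0: "0 < r0" "\<And>x y h. 0 < y \<Longrightarrow> h \<in> Bp_space p \<Longrightarrow> Bp_norm p h \<le> r0 \<Longrightarrow> elliptic (\<eta> / 2) (centered (zoom x y (\<lambda>t. u t + h t)))"
  proof (rule pointwise_estimates[OF p u \<eta> ell], goal_cases)
    case (2 D r0)
    show ?case by (rule 2(1)[OF 2(3) 2(7)])
  qed
  have "v \<in> elliptic_domain p" if v: "v \<in> Bp_space p" "Bp_norm p (\<lambda>t. v t - u t) < r0" for v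
  proof -
    have "(\<lambda>t. v t - u t) \<in> Bp_space p" using p v u by (intro Bp_space_diff) auto
    from r0(2)[OF _ this] v(2) have "elliptic (\<eta> / 2) (centered (zoom x y v))" if "0 < y" for x y
      using that by simp
    thus ?thesis using v \<eta> unfolding elliptic_domain_def by (auto intro!: exI[of _ "\<eta> / 2"])
  qed
  thus "\<exists>e>0. \<forall>v\<in>Bp_space p. Bp_norm p (\<lambda>t. v t - u t) < e \<longrightarrow> v \<in> elliptic_domain p"
    using r0(1) by blast
qed

lemma Lambda_elliptic_domain:
  assumes p: "1 < p" and u: "u \<in> elliptic_domain p"
  shows "Lambda u \<in> Mp_space p \<inter> M0_space"
proof -
  obtain \<eta> where uB: "u \<in> Bp_space p" and \<eta>: "0 < \<eta>" and ell: "\<And>x y. 0 < y \<Longrightarrow> elliptic \<eta> (centered (zoom x y u))"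
    using u by (auto simp: elliptic_domain_def)
  obtain D where D: "0 < D" "\<And>x y. 0 < y \<Longrightarrow> cmod (Lambda u (x, y)) \<le> D * osc_norm p (zoom x y u)"
  proof (rule pointwise_estimates[OF p uB \<eta> ell], goal_cases)
    case (2 D r0)
    show ?case by (rule 2(1)[OF 2(2) 2(4)])
  qed
  have m: "Lambda u \<in> borel_measurable UHP_measure"
    using uB by (intro measurable_UHP Lambda_measurable) (simp add: Bp_space_iff)
  have Lp: "Lambda u \<in> Lp_space p"
    by (rule Lp_norm_from_oscillation(1)[OF p uB m less_imp_le[OF D(1)] D(2)])
  have "cmod (Lambda u z) \<le> 1 - \<eta>" if zU: "z \<in> UHP" for z
  proof -
    obtain x y where z: "z = (x, y)" "0 < y" using zU by (cases z) (auto simp: UHP_def)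
    have e: "\<eta> \<le> cmod (den (centered (zoom x y u)))" "cmod (num (centered (zoom x y u))) \<le> (1 - \<eta>) * cmod (den (centered (zoom x y u)))"
      using ell[OF z(2), of x] by (auto simp: elliptic_def)
    hence "0 < cmod (den (centered (zoom x y u)))" using \<eta> by linarith
    thus ?thesis using e(2) by (simp add: z Lambda_centered[OF p uB z(2)] norm_divide divide_le_eq)
  qed
  hence "Linf_norm (Lambda u) \<le> ereal (1 - \<eta>)"
    unfolding Linf_norm_def
    by (intro esssup_I) (use m in \<open>auto simp: space_UHP_measure intro!: AE_I2\<close>)
  also have "\<dots> < 1" using \<eta> by (simp add: one_ereal_def)
  finally have "Lambda u \<in> M_ball" using m by (simp add: M_ball_def)
  thus ?thesis using Lp Lambda_vanishes_at_boundary[OF p uB D] by (simp add: Mp_space_def M0_space_def)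
qed

text \<open>The derivative at u is \<open>dLambda u\<close>: a remainder of at most D r times the
  oscillation of h has norm at most 6 D r times the norm of h, and r may be shrunk.\<close>

lemma Lambda_holomorphic:
  assumes p: "1 < p"
  shows "Bp_Lp_holomorphic p (elliptic_domain p) Lambda"
  unfolding Bp_Lp_holomorphic_def
proof (intro ballI conjI)
  fix u assume u: "u \<in> elliptic_domain p"
  show "Lambda u \<in> Lp_space p" using Lambda_elliptic_domain[OF p u] by (simp add: Mp_space_def)
  obtain \<eta> where uB: "u \<in> Bp_space p" and \<eta>: "0 < \<eta>" and ell: "\<And>x y. 0 < y \<Longrightarrow> elliptic \<eta> (centered (zoom x y u))"
    using u by (auto simp: elliptic_domain_def)
  have um: "u \<in> borel_measurable borel" using uB by (simp add: Bp_space_iff)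
  obtain D r0 where D: "0 < D" and r0: "0 < r0" and
    d1: "\<And>x y h. 0 < y \<Longrightarrow> h \<in> Bp_space p \<Longrightarrow> cmod (dLambda u h (x, y)) \<le> D * osc_norm p (zoom x y h)" and
    d2: "\<And>x y h r. 0 < y \<Longrightarrow> h \<in> Bp_space p \<Longrightarrow> 0 < r \<Longrightarrow> r \<le> r0 \<Longrightarrow> Bp_norm p h \<le> r \<Longrightarrow>
       cmod (Lambda (\<lambda>t. u t + h t) (x, y) - Lambda u (x, y) - dLambda u h (x, y)) \<le> D * r * osc_norm p (zoom x y h)"
  proof (rule pointwise_estimates[OF p uB \<eta> ell], goal_cases)
    case (2 D r0)
    show ?case by (rule 2(1)[OF 2(2) 2(3) 2(5) 2(6)])
  qed
  have dm: "dLambda u h \<in> borel_measurable UHP_measure" if "h \<in> Bp_space p" for h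
    using that um by (intro measurable_UHP dLambda_measurable) (auto simp: Bp_space_iff)
  note dL = Lp_norm_from_oscillation[OF p _ dm less_imp_le[OF D] d1]
  have rem: "Lp_norm p (\<lambda>z. Lambda (\<lambda>t. u t + h t) z - Lambda u z - dLambda u h z) \<le> e * Bp_norm p h"
    if e: "0 < e" and h: "h \<in> Bp_space p" and hr: "Bp_norm p h < min r0 (e / (6 * D))" for e h
  proof -
    \<comment> \<open>A fixed radius in place of the norm of h itself: it stays positive for h of
      seminorm zero, and 6 D r <= e.\<close>
    define r where "r = min r0 (e / (6 * D))"
    have r: "0 < r" "r \<le> r0" "Bp_norm p h \<le> r" "r \<le> e / (6 * D)" using e D r0 hr by (auto simp: r_def)
    have hm: "h \<in> borel_measurable borel" using h by (simp add: Bp_space_iff)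
    have m: "(\<lambda>z. Lambda (\<lambda>t. u t + h t) z - Lambda u z - dLambda u h z) \<in> borel_measurable UHP_measure"
      using um hm by (intro borel_measurable_diff measurable_UHP Lambda_measurable dLambda_measurable) auto
    have "Lp_norm p (\<lambda>z. Lambda (\<lambda>t. u t + h t) z - Lambda u z - dLambda u h z) \<le> 6 * (D * r) * Bp_norm p h"
      using D r d2[OF _ h r(1,2,3)] by (intro Lp_norm_from_oscillation(2)[OF p h m]) auto
    also have "\<dots> \<le> e * Bp_norm p h"
      using r(4) D by (intro mult_right_mono) (auto simp: Bp_norm_def field_simps)
    finally show ?thesis .
  qed
  show "\<exists>L. (\<forall>h\<in>Bp_space p. L h \<in> Lp_space p)
          \<and> (\<forall>h\<in>Bp_space p. \<forall>k\<in>Bp_space p. \<forall>a b::complex. L (\<lambda>t. a * h t + b * k t) = (\<lambda>z. a * L h z + b * L k z))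
          \<and> (\<exists>C. \<forall>h\<in>Bp_space p. Lp_norm p (L h) \<le> C * Bp_norm p h)
          \<and> (\<forall>e>0. \<exists>d>0. \<forall>h\<in>Bp_space p. Bp_norm p h < d \<longrightarrow>
                Lp_norm p (\<lambda>z. Lambda (\<lambda>t. u t + h t) z - Lambda u z - L h z) \<le> e * Bp_norm p h)"
  proof (intro exI[of _ "dLambda u"] conjI ballI allI impI)
    show "dLambda u h \<in> Lp_space p" if "h \<in> Bp_space p" for h using dL(1) that by blast
    show "dLambda u (\<lambda>t. a * h t + b * k t) = (\<lambda>z. a * dLambda u h z + b * dLambda u k z)"
      if "h \<in> Bp_space p" "k \<in> Bp_space p" for h k a b
      using dLambda_lincomb[OF p uB that] .
    show "\<exists>C. \<forall>h\<in>Bp_space p. Lp_norm p (dLambda u h) \<le> C * Bp_norm p h"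
      using dL(2) by blast
    show "\<exists>d>0. \<forall>h\<in>Bp_space p. Bp_norm p h < d \<longrightarrow>
        Lp_norm p (\<lambda>z. Lambda (\<lambda>t. u t + h t) z - Lambda u z - dLambda u h z) \<le> e * Bp_norm p h" if "0 < e" for e
      using rem[OF that] that D r0 by (intro exI[of _ "min r0 (e / (6 * D))"]) auto
  qed
qed

theorem theorem4p4:
  fixes p :: real
  assumes "p > 1"
  shows "\<exists>U. Bp_open p U \<and> BpR_space p \<subseteq> U \<and> Bp_Lp_holomorphic p U Lambda
             \<and> Lambda ` U \<subseteq> Mp_space p \<inter> M0_space"
  using Bp_open_elliptic_domain[OF assms] real_valued_in_elliptic_domain[OF assms]
    Lambda_holomorphic[OF assms] Lambda_elliptic_domain[OF assms]
  by (intro exI[of _ "elliptic_domain p"]) auto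

end
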